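(* Let $\gamma$ be a hyperbolic orientation-preserving isometry of $\mathbb H^2$ of length $\ell>0$, and let $\mathfrak Z=\{\gamma^n:n\in\mathbb Z\}$ be the group it generates. Let $h$ be a complex-valued function such that, for some $\sigma>1/2$: (a) $h$ is analytic for $|\mathrm{Im}\,\rho|\le\sigma$; (b) $h(-\rho)=h(\rho)$; (c) there are $\delta>0$ and $C>0$ such that $|h(\rho)|\le C(1+|\mathrm{Re}\,\rho|)^{-2-\delta}$ for all $\rho$ in the strip $|\mathrm{Im}\,\rho|\le\sigma$. Let $g(t)=\frac1{2\pi}\int_{\mathbb R}h(\rho)e^{-i\rho t}\,d\rho$, let $k(z,w)$ be the point-pair invariant associated with $h$, and let $k_{\mathfrak Z}(z,w)=\sum_{n\in\mathbb Z}k(\gamma^nz,w)$. Then $$\int_{\mathfrak Z\backslash\mathbb H^2}\bigl[k_{\mathfrak Z}(z,z)-k(z,z)\bigr]\,d\mu=\sum_{n=1}^\infty\frac{\ell\,g(n\ell)}{\sinh(n\ell/2)}.$$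
   Context: $\mathbb H^2$ is the hyperbolic plane of curvature $-1$ with distance $d$ and area measure $d\mu$ ($d\mu=dx\,dy/y^2$ in the half-plane model). The length of an isometry $\gamma$ is $\ell(\gamma)=\inf_{z\in\mathbb H^2}d(\gamma z,z)$; an orientation-preserving isometry is hyperbolic if its length is positive. The integral over $\mathfrak Z\backslash\mathbb H^2$ is the integral over any fundamental domain of $\mathfrak Z$ in $\mathbb H^2$. The point-pair invariant is $k(z,w)=\frac1{\pi i}\int_{-\infty}^\infty G_\rho(z,w)\,\rho\,h(\rho)\,d\rho$, where $G_\rho(z,w)=-\frac1{2\pi}Q_{-\frac12+i\rho}(\cosh d(z,w))$ and $Q_{-\frac12+i\rho}(\cosh\tau)=\frac1{\sqrt2}\int_\tau^\infty\frac{e^{-i\rho t}}{\sqrt{\cosh t-\cosh\tau}}\,dt$ is the Legendre function of the second kind. Equivalently (and also for $z=w$), with $\tau=d(z,w)$, $k(z,w)=-\frac1{\pi\sqrt2}\int_\tau^\infty\frac{g'(t)}{\sqrt{\cosh t-\cosh\tau}}\,dt$. *)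

theory Defs
  imports "HOL-Analysis.Analysis" "HOL-Algebra.Bij"
begin

definition half_plane :: "complex set" where
  "half_plane = {z. Im z > 0}"

definition hyp_dist :: "complex \<Rightarrow> complex \<Rightarrow> real" where
  "hyp_dist z w = arcosh (1 + (cmod (z - w))\<^sup>2 / (2 * Im z * Im w))"

definition hyp_area :: "complex measure" where
  "hyp_area = density (lebesgue_on half_plane) (\<lambda>z. ennreal (1 / (Im z)\<^sup>2))"

(* Elements of Bij S are extensional (undefined outside S), so two isometries are equal iff they
   agree on the half-plane, and BijGroup half_plane supplies composition and integer powers. *)
definition hyp_isometries :: "(complex \<Rightarrow> complex) set" where
  "hyp_isometries =
     {f \<in> Bij half_plane. \<forall>z\<in>half_plane. \<forall>w\<in>half_plane. hyp_dist (f z) (f w) = hyp_dist z w}"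

(* Im (cnj (D 1) * D \<i>) is the determinant of the real-linear map D on the plane,
   i.e. the Jacobian determinant of f at z. *)
definition orientation_preserving :: "(complex \<Rightarrow> complex) \<Rightarrow> bool" where
  "orientation_preserving f \<longleftrightarrow>
     (\<forall>z\<in>half_plane. \<exists>D. (f has_derivative D) (at z) \<and> Im (cnj (D 1) * D \<i>) > 0)"

definition isometry_length :: "(complex \<Rightarrow> complex) \<Rightarrow> real" where
  "isometry_length f = (INF z\<in>half_plane. hyp_dist (f z) z)"

definition hyperbolic_isometry :: "(complex \<Rightarrow> complex) \<Rightarrow> bool" where
  "hyperbolic_isometry f \<longleftrightarrow>
     f \<in> hyp_isometries \<and> orientation_preserving f \<and> isometry_length f > 0"

definition iso_pow :: "(complex \<Rightarrow> complex) \<Rightarrow> int \<Rightarrow> complex \<Rightarrow> complex" where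
  "iso_pow f n = f [^]\<^bsub>BijGroup half_plane\<^esub> n"

(* Overlaps are only required to be null, so that both exact systems of orbit representatives and
   closed domains with null boundary qualify. *)
definition fundamental_domain :: "(complex \<Rightarrow> complex) set \<Rightarrow> complex set \<Rightarrow> bool" where
  "fundamental_domain G F \<longleftrightarrow>
     F \<in> sets hyp_area \<and>
     half_plane - (\<Union>f\<in>G. f ` F) \<in> null_sets hyp_area \<and>
     (\<forall>f1\<in>G. \<forall>f2\<in>G. f1 \<noteq> f2 \<longrightarrow> f1 ` F \<inter> f2 ` F \<in> null_sets hyp_area)"

(* The Legendre function Q_{-1/2 + i rho}(cosh tau), as a function of rho and tau > 0. *)
definition legendre_Q_cosh :: "real \<Rightarrow> real \<Rightarrow> complex" where
  "legendre_Q_cosh \<rho> \<tau> =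
     1 / of_real (sqrt 2) *
     (LINT t:{\<tau><..}|lborel. exp (- (\<i> * of_real \<rho> * of_real t)) / of_real (sqrt (cosh t - cosh \<tau>)))"

definition green :: "real \<Rightarrow> complex \<Rightarrow> complex \<Rightarrow> complex" where
  "green \<rho> z w = - (1 / (2 * of_real pi)) * legendre_Q_cosh \<rho> (hyp_dist z w)"

definition g_transform :: "(complex \<Rightarrow> complex) \<Rightarrow> real \<Rightarrow> complex" where
  "g_transform h t =
     1 / (2 * of_real pi) * (LINT \<rho>|lborel. h (of_real \<rho>) * exp (- (\<i> * of_real \<rho> * of_real t)))"

(* The defining integral over green makes no sense for z = w, where green has a logarithmic
   singularity; on the diagonal k is given by
     -1/(pi sqrt 2) * integral over t > tau of g'(t) / sqrt (cosh t - cosh tau)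
   with tau = 0, a formula which for z ~= w agrees with the defining one at tau = hyp_dist z w. *)
definition point_pair_invariant :: "(complex \<Rightarrow> complex) \<Rightarrow> complex \<Rightarrow> complex \<Rightarrow> complex" where
  "point_pair_invariant h z w =
     (if z \<noteq> w
      then 1 / (of_real pi * \<i>) * (LINT \<rho>|lborel. green \<rho> z w * of_real \<rho> * h (of_real \<rho>))
      else - (1 / (of_real pi * of_real (sqrt 2))) *
           (LINT t:{0<..}|lborel.
              vector_derivative (g_transform h) (at t) / of_real (sqrt (cosh t - cosh 0))))"

definition periodized_invariant ::
    "(complex \<Rightarrow> complex) \<Rightarrow> (complex \<Rightarrow> complex) \<Rightarrow> complex \<Rightarrow> complex \<Rightarrow> complex" where
  "periodized_invariant h f z w = (\<Sum>\<^sub>\<infinity>n::int. point_pair_invariant h (iso_pow f n z) w)"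

end

(* For z \<noteq> w the point-pair invariant is an Abel transform of g' evaluated at v = cosh (d z w).
   An orientation-preserving hyperbolic isometry of length l is conjugate, by a real Moebius map m,
   to the dilation by exp l. In the coordinates m z = exp s * (u + \<i>) the area is ds du and the group
   acts by s \<mapsto> s + n * l, so u sends every fundamental domain to l times Lebesgue measure, while
   cosh (d (\<gamma>^n z) z) = cosh (n l) + 2 sinh (n l / 2)^2 u^2. Integrating the Abel kernel over u gives
   a constant by the arcsine integral, and what remains of the n-th term is the integral of g' over
   {n * l<..}. Summation only needs g' to be bounded and integrable on the half-line, which follows
   by shifting the contour in the strip. *)

theory Submission
  imports Defs "HOL-Complex_Analysis.Complex_Analysis" "HOL-Real_Asymp.Real_Asymp"
begin

section \<open>Fourier integrals on a strip\<close>

text \<open>The value of k on the diagonal never has to be computed: it is the term for n = 0 and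
  cancels in the integrand. In every other term cosh of the distance exceeds 1, where the Abel
  integral of a bounded function converges absolutely. In the final coefficient, the 2 of 2 sinh (n
  l / 2), which comes from the arcsine integral, cancels against the equal contributions of n and
  -n. The decay of order 2 + \<delta> of h is spent as follows: the factor \<rho> in g' costs one
  order, and the remaining 1 + \<delta> makes the Fourier integrals absolutely convergent, so that
  integrals in \<rho> and t may be interchanged. Decay in t is invisible on the real line, where the
  exponential has modulus 1; on a lower horizontal line it is the modulus of the exponential. A
  fundamental domain may have any shape and is controlled only up to null sets. Nothing is
  integrated over it directly: the area of its part over a Borel set of values of u is compared with
  that of a standard strip.\<close>

lemma integrable_one_plus_abs_powr:
  fixes \<delta> :: real
  assumes "\<delta> > 0"
  shows "integrable lborel (\<lambda>x::real. (1 + \<bar>x\<bar>) powr (- 1 - \<delta>))"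
proof -
  have "set_integrable lborel (einterval 0 \<infinity>) (\<lambda>x. (1 + x) powr (- 1 - \<delta>))"
  proof (rule interval_integral_FTC_nonneg(1))
    show "((\<lambda>x. - ((1 + x) powr (- \<delta>)) / \<delta>) has_real_derivative (1 + x) powr (- 1 - \<delta>)) (at x)"
      if "0 < ereal x" for x
      using that assms
      by (auto intro!: derivative_eq_intros simp: divide_simps powr_diff powr_minus)
    show "isCont (\<lambda>x. (1 + x) powr (- 1 - \<delta>)) x" if "0 < ereal x" for x
      using that by (auto intro!: continuous_intros)
    show "(((\<lambda>x. - ((1 + x) powr (- \<delta>)) / \<delta>) \<circ> real_of_ereal) \<longlongrightarrow> - (1 / \<delta>)) (at_right 0)"
      unfolding zero_ereal_def ereal_tendsto_simps
      using assms by (auto intro!: tendsto_eq_intros)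
    have "((\<lambda>x. - ((1 + x) powr (- \<delta>)) / \<delta>) \<longlongrightarrow> - 0 / \<delta>) at_top"
      by (intro tendsto_intros tendsto_neg_powr filterlim_tendsto_add_at_top filterlim_ident)
        (use assms in auto)
    then show "(((\<lambda>x. - ((1 + x) powr (- \<delta>)) / \<delta>) \<circ> real_of_ereal) \<longlongrightarrow> 0) (at_left \<infinity>)"
      unfolding ereal_tendsto_simps by simp
  qed auto
  then have pos: "set_integrable lborel {0<..} (\<lambda>x. (1 + \<bar>x\<bar>) powr (- 1 - \<delta>))"
    by (rule set_integrable_cong[THEN iffD1, rotated -1]) (auto simp: zero_ereal_def)
  then have "integrable lborel (\<lambda>x. indicator {0<..} x *\<^sub>R (1 + \<bar>x\<bar>) powr (- 1 - \<delta>))"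
    by (simp add: set_integrable_def)
  from lborel_integrable_real_affine[OF this, of "- 1" 0]
  have "set_integrable lborel {..<0} (\<lambda>x. (1 + \<bar>x\<bar>) powr (- 1 - \<delta>))"
    by (simp add: set_integrable_def indicator_def)
  with pos have "set_integrable lborel ({0<..} \<union> {..<0}) (\<lambda>x. (1 + \<bar>x\<bar>) powr (- 1 - \<delta>))"
    by (rule set_integrable_Un) auto
  then have "integrable lborel (\<lambda>x. indicator ({0<..} \<union> {..<0}) x *\<^sub>R (1 + \<bar>x\<bar>) powr (- 1 - \<delta>))"
    by (simp add: set_integrable_def)
  then show ?thesis
    by (rule integrable_cong_AE_imp)
      (auto intro!: AE_I[of _ _ "{0}"] simp: indicator_def split: if_splits)
qed

lemma tendsto_integral_symmetric_interval:
  fixes f :: "real \<Rightarrow> 'a :: euclidean_space"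
  assumes "integrable lborel f"
  shows "(\<lambda>n. LINT x:{- real n..real n}|lborel. f x) \<longlonglongrightarrow> (LINT x|lborel. f x)"
  unfolding set_lebesgue_integral_def
proof (rule integral_dominated_convergence[where w = "\<lambda>x. norm (f x)"])
  show "AE x in lborel. (\<lambda>i. indicat_real {- real i..real i} x *\<^sub>R f x) \<longlonglongrightarrow> f x"
  proof (intro AE_I2 tendsto_eventually)
    fix x :: real
    show "\<forall>\<^sub>F i in sequentially. indicat_real {- real i..real i} x *\<^sub>R f x = f x"
      using eventually_ge_at_top[of "nat \<lceil>\<bar>x\<bar>\<rceil>"]
      by eventually_elim (auto simp: indicator_def le_nat_iff nat_le_iff ceiling_le_iff)
  qed
qed (use assms in \<open>auto intro!: borel_measurable_scaleR borel_measurable_indicator simp: indicator_def\<close>)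

text \<open>The primitive of the integrand turns the contour shift into the evaluation of the
  primitive at the four corners of a rectangle; the contribution of the two vertical sides
  vanishes in the limit.\<close>

lemma integral_strip_shift:
  fixes \<phi> :: "complex \<Rightarrow> complex"
  assumes hol: "\<phi> holomorphic_on {z. \<bar>Im z\<bar> < \<sigma>}"
    and eps: "0 \<le> \<epsilon>" "\<epsilon> < \<sigma>"
    and int0: "integrable lborel (\<lambda>x. \<phi> (of_real x))"
    and int1: "integrable lborel (\<lambda>x. \<phi> (of_real x - \<i> * of_real \<epsilon>))"
    and bound: "\<And>z. - \<epsilon> \<le> Im z \<Longrightarrow> Im z \<le> 0 \<Longrightarrow> norm (\<phi> z) \<le> B \<bar>Re z\<bar>"
    and lim: "(B \<longlongrightarrow> 0) at_top"
  shows "(LINT x|lborel. \<phi> (of_real x)) = (LINT x|lborel. \<phi> (of_real x - \<i> * of_real \<epsilon>))"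
proof -
  define S where "S = {z. \<bar>Im z\<bar> < \<sigma>}"
  have S: "S = {z. Im z < \<sigma>} \<inter> {z. Im z > - \<sigma>}"
    by (auto simp: S_def)
  have "convex S" "open S"
    unfolding S by (auto intro!: convex_Int convex_halfspace_Im_lt convex_halfspace_Im_gt
        open_Int open_halfspace_Im_lt open_halfspace_Im_gt)
  then obtain F where F: "\<And>z. z \<in> S \<Longrightarrow> (F has_field_derivative \<phi> z) (at z within S)"
    using holomorphic_convex_primitive' hol unfolding S_def by metis
  have line: "(LINT x:{- r..r}|lborel. \<phi> (of_real x - \<i> * of_real c)) =
      F (of_real r - \<i> * of_real c) - F (of_real (- r) - \<i> * of_real c)"
    if "0 \<le> c" "c \<le> \<epsilon>" "0 \<le> r" for r c
  proof -
    have mem: "of_real x - \<i> * of_real c \<in> S" for x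
      using that eps by (simp add: S_def)
    show ?thesis
      unfolding set_lebesgue_integral_def
    proof (rule integral_FTC_atLeastAtMost)
      show "((\<lambda>x. F (of_real x - \<i> * of_real c)) has_vector_derivative
          \<phi> (of_real x - \<i> * of_real c)) (at x within {- r..r})" for x
      proof -
        have "((F \<circ> (\<lambda>x. of_real x - \<i> * of_real c)) has_vector_derivative
            1 * \<phi> (of_real x - \<i> * of_real c)) (at x within {- r..r})"
        proof (rule field_vector_diff_chain_within)
          show "((\<lambda>x. of_real x - \<i> * of_real c) has_vector_derivative 1) (at x within {- r..r})"
            by (auto intro!: derivative_eq_intros)
          show "(F has_field_derivative \<phi> (of_real x - \<i> * of_real c))
              (at (of_real x - \<i> * of_real c) within (\<lambda>x. of_real x - \<i> * of_real c) ` {- r..r})"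
            using F[OF mem] by (rule DERIV_subset) (use mem in auto)
        qed
        then show ?thesis by (simp add: o_def)
      qed
      have "continuous_on S \<phi>"
        using hol by (simp add: S_def holomorphic_on_imp_continuous_on)
      then show "continuous_on {- r..r} (\<lambda>x. \<phi> (of_real x - \<i> * of_real c))"
        by (rule continuous_on_compose2) (use mem in \<open>auto intro!: continuous_intros\<close>)
    qed (use that in auto)
  qed
  \<comment> \<open>The mean value inequality for the primitive on a vertical segment takes the
    place of an estimate of a contour integral.\<close>
  have vert: "norm (F (of_real x) - F (of_real x - \<i> * of_real \<epsilon>)) \<le> B \<bar>x\<bar> * \<epsilon>" for x
  proof -
    define L where "L = {z. Re z = x \<and> - \<epsilon> \<le> Im z \<and> Im z \<le> 0}"
    have L: "L = {z. Re z = x} \<inter> {z. Im z \<ge> - \<epsilon>} \<inter> {z. Im z \<le> 0}"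
      by (auto simp: L_def)
    have "norm (F (of_real x) - F (of_real x - \<i> * of_real \<epsilon>)) \<le>
        B \<bar>x\<bar> * norm (of_real x - (of_real x - \<i> * of_real \<epsilon>) :: complex)"
    proof (rule field_differentiable_bound)
      have "convex {z. Re z = x}"
        using convex_hyperplane[of "1::complex" x] by simp
      then show "convex L"
        unfolding L by (intro convex_Int convex_halfspace_Im_ge convex_halfspace_Im_le)
      show "(F has_field_derivative \<phi> z) (at z within L)" if "z \<in> L" for z
        by (rule DERIV_subset[OF F]) (use that eps in \<open>auto simp: S_def L_def\<close>)
      show "norm (\<phi> z) \<le> B \<bar>x\<bar>" if "z \<in> L" for z
        using bound[of z] that by (auto simp: L_def)
    qed (use eps in \<open>auto simp: L_def\<close>)
    then show ?thesis using eps by (simp add: norm_mult)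
  qed
  have "(\<lambda>n. B (real n) * \<epsilon>) \<longlonglongrightarrow> 0 * \<epsilon>"
    using filterlim_compose[OF lim filterlim_real_sequentially] by (intro tendsto_mult tendsto_const)
  then have B0: "(\<lambda>n. 2 * (B (real n) * \<epsilon>)) \<longlonglongrightarrow> 0"
    by (auto intro: tendsto_mult_right_zero)
  have "(\<lambda>n. (LINT x:{- real n..real n}|lborel. \<phi> (of_real x)) -
      (LINT x:{- real n..real n}|lborel. \<phi> (of_real x - \<i> * of_real \<epsilon>))) \<longlonglongrightarrow> 0"
  proof (rule Lim_null_comparison[OF _ B0], intro always_eventually allI)
    fix n
    let ?d = "\<lambda>x. F (of_real x) - F (of_real x - \<i> * of_real \<epsilon>)"
    have "(LINT x:{- real n..real n}|lborel. \<phi> (of_real x)) -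
        (LINT x:{- real n..real n}|lborel. \<phi> (of_real x - \<i> * of_real \<epsilon>)) =
        ?d (real n) - ?d (- real n)"
      using line[of 0 "real n"] line[of \<epsilon> "real n"] eps by simp
    also have "norm \<dots> \<le> norm (?d (real n)) + norm (?d (- real n))"
      by (rule norm_triangle_ineq4)
    also have "\<dots> \<le> 2 * (B (real n) * \<epsilon>)"
      using vert[of "real n"] vert[of "- real n"] by simp
    finally show "norm ((LINT x:{- real n..real n}|lborel. \<phi> (of_real x)) -
      (LINT x:{- real n..real n}|lborel. \<phi> (of_real x - \<i> * of_real \<epsilon>))) \<le> 2 * (B (real n) * \<epsilon>)" .
  qed
  moreover have "(\<lambda>n. (LINT x:{- real n..real n}|lborel. \<phi> (of_real x)) -
      (LINT x:{- real n..real n}|lborel. \<phi> (of_real x - \<i> * of_real \<epsilon>))) \<longlonglongrightarrow>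
      (LINT x|lborel. \<phi> (of_real x)) - (LINT x|lborel. \<phi> (of_real x - \<i> * of_real \<epsilon>))"
    by (intro tendsto_diff tendsto_integral_symmetric_interval int0 int1)
  ultimately show ?thesis
    using LIMSEQ_unique by fastforce
qed

text \<open>On the line of imaginary part -\<epsilon> the exponential has the constant modulus exp
  (- \<epsilon> t), so the power bound on f alone decides integrability.\<close>

lemma strip_fourier_integrable:
  fixes f :: "complex \<Rightarrow> complex"
  assumes hol: "f holomorphic_on {z. \<bar>Im z\<bar> < \<sigma>}"
    and eps: "0 \<le> \<epsilon>" "\<epsilon> < \<sigma>" and "\<delta> > 0"
    and bound: "\<And>z. \<bar>Im z\<bar> < \<sigma> \<Longrightarrow> norm (f z) \<le> C * (1 + \<bar>Re z\<bar>) powr (- 1 - \<delta>)"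
  shows "integrable lborel (\<lambda>x. f (of_real x - \<i> * of_real \<epsilon>) *
      exp (- (\<i> * (of_real x - \<i> * of_real \<epsilon>) * of_real t)))"
proof -
  let ?p = "\<lambda>x. of_real x - \<i> * of_real \<epsilon> :: complex"
  have fm: "(\<lambda>x. f (?p x)) \<in> borel_measurable borel"
    by (intro borel_measurable_continuous_onI continuous_on_compose2
        [OF holomorphic_on_imp_continuous_on[OF hol]] continuous_intros) (use eps in auto)
  have norm_exp: "norm (exp (- (\<i> * ?p x * of_real t))) = exp (- \<epsilon> * t)" for x
    by (simp add: norm_exp_eq_Re algebra_simps)
  show ?thesis
  proof (rule Bochner_Integration.integrable_bound)
    show "integrable lborel (\<lambda>x. (C * exp (- \<epsilon> * t)) * (1 + \<bar>x\<bar>) powr (- 1 - \<delta>))"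
      using \<open>\<delta> > 0\<close> by (intro integrable_mult_right integrable_one_plus_abs_powr)
    show "AE x in lborel. norm (f (?p x) * exp (- (\<i> * ?p x * of_real t)))
        \<le> norm (C * exp (- \<epsilon> * t) * (1 + \<bar>x\<bar>) powr (- 1 - \<delta>))"
    proof (rule AE_I2)
      fix x
      have "norm (f (?p x)) \<le> C * (1 + \<bar>x\<bar>) powr (- 1 - \<delta>)"
        using bound[of "?p x"] eps by simp
      then have "norm (f (?p x)) * exp (- \<epsilon> * t) \<le> C * (1 + \<bar>x\<bar>) powr (- 1 - \<delta>) * exp (- \<epsilon> * t)"
        by (intro mult_right_mono) auto
      also have "\<dots> \<le> \<bar>C * (1 + \<bar>x\<bar>) powr (- 1 - \<delta>) * exp (- \<epsilon> * t)\<bar>"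
        by (rule abs_ge_self)
      finally show "norm (f (?p x) * exp (- (\<i> * ?p x * of_real t)))
        \<le> norm (C * exp (- \<epsilon> * t) * (1 + \<bar>x\<bar>) powr (- 1 - \<delta>))"
        by (simp add: norm_mult norm_exp abs_mult mult_ac)
    qed
    show "(\<lambda>x. f (?p x) * exp (- (\<i> * ?p x * of_real t))) \<in> borel_measurable lborel"
      using fm by (intro borel_measurable_times)
        (auto intro!: borel_measurable_continuous_onI continuous_intros)
  qed
qed

text \<open>The modulus of exp (- i z t) is exp (t Im z). For t \<ge> 0 the line is therefore moved
  downwards: the exponential stays at most 1 on the way, which lets the vertical sides vanish, and
  has become exp (- \<epsilon> t) on the new line.\<close>

lemma strip_fourier_decay:
  fixes f :: "complex \<Rightarrow> complex"
  assumes hol: "f holomorphic_on {z. \<bar>Im z\<bar> < \<sigma>}"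
    and eps: "0 \<le> \<epsilon>" "\<epsilon> < \<sigma>" and "\<delta> > 0" and "t \<ge> 0"
    and bound: "\<And>z. \<bar>Im z\<bar> < \<sigma> \<Longrightarrow> norm (f z) \<le> C * (1 + \<bar>Re z\<bar>) powr (- 1 - \<delta>)"
  shows "norm (LINT x|lborel. f (of_real x) * exp (- (\<i> * of_real x * of_real t)))
    \<le> C * (LINT x|lborel. (1 + \<bar>x\<bar>) powr (- 1 - \<delta>)) * exp (- \<epsilon> * t)"
proof -
  let ?\<phi> = "\<lambda>z. f z * exp (- (\<i> * z * of_real t))"
  let ?p = "\<lambda>x. of_real x - \<i> * of_real \<epsilon> :: complex"
  have norm_exp: "norm (exp (- (\<i> * z * of_real t))) = exp (Im z * t)" for z
    by (simp add: norm_exp_eq_Re)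
  have pow: "((\<lambda>r. C * (1 + r) powr (- 1 - \<delta>)) \<longlongrightarrow> 0) at_top"
    by (intro tendsto_mult_right_zero tendsto_neg_powr filterlim_tendsto_add_at_top
        tendsto_const filterlim_ident) (use assms in auto)
  have int: "integrable lborel (\<lambda>x. ?\<phi> (?p x))"
    by (rule strip_fourier_integrable[OF hol eps \<open>\<delta> > 0\<close> bound])
  have "(LINT x|lborel. ?\<phi> (of_real x)) = (LINT x|lborel. ?\<phi> (?p x))"
  proof (rule integral_strip_shift[OF _ eps])
    show "?\<phi> holomorphic_on {z. \<bar>Im z\<bar> < \<sigma>}"
      by (intro holomorphic_intros hol)
    show "integrable lborel (\<lambda>x. ?\<phi> (of_real x))"
      using strip_fourier_integrable[OF hol order_refl _ \<open>\<delta> > 0\<close> bound, of t] eps by simp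
    show "((\<lambda>r. C * (1 + r) powr (- 1 - \<delta>)) \<longlongrightarrow> 0) at_top" by (rule pow)
    show "norm (?\<phi> z) \<le> C * (1 + \<bar>Re z\<bar>) powr (- 1 - \<delta>)" if "- \<epsilon> \<le> Im z" "Im z \<le> 0" for z
    proof -
      have "norm (?\<phi> z) \<le> norm (f z) * 1"
        unfolding norm_mult norm_exp using that \<open>t \<ge> 0\<close>
        by (intro mult_left_mono) (auto simp: mult_nonpos_nonneg)
      also have "\<dots> \<le> C * (1 + \<bar>Re z\<bar>) powr (- 1 - \<delta>)"
        using bound[of z] that eps by simp
      finally show ?thesis .
    qed
  qed (rule int)
  also have "norm \<dots> \<le> (LINT x|lborel. norm (?\<phi> (?p x)))"
    by (rule integral_norm_bound)
  also have "\<dots> \<le> (LINT x|lborel. (C * exp (- \<epsilon> * t)) * (1 + \<bar>x\<bar>) powr (- 1 - \<delta>))"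
  proof (rule integral_mono)
    show "integrable lborel (\<lambda>x. norm (?\<phi> (?p x)))" using int by simp
    show "integrable lborel (\<lambda>x. (C * exp (- \<epsilon> * t)) * (1 + \<bar>x\<bar>) powr (- 1 - \<delta>))"
      using \<open>\<delta> > 0\<close> by (intro integrable_mult_right integrable_one_plus_abs_powr)
    show "norm (?\<phi> (?p x)) \<le> C * exp (- \<epsilon> * t) * (1 + \<bar>x\<bar>) powr (- 1 - \<delta>)" for x
      using mult_right_mono[OF bound[of "?p x"], of "exp (- \<epsilon> * t)"] eps
      unfolding norm_mult norm_exp by (simp add: mult_ac)
  qed
  finally show ?thesis by (simp add: mult_ac)
qed

lemma set_integrable_exp_minus:
  fixes c :: real
  assumes "0 < c"
  shows "set_integrable lborel {a..} (\<lambda>t. exp (- c * t))"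
proof -
  \<comment> \<open>The open interval starts at a - 1 so that it contains the closed half-line from
    a.\<close>
  have "set_integrable lborel (einterval (ereal (a - 1)) \<infinity>) (\<lambda>t. exp (- c * t))"
  proof (rule interval_integral_FTC_nonneg(1))
    show "((\<lambda>t. - exp (- c * t) / c) has_real_derivative exp (- c * x)) (at x)" for x
      using assms by (auto intro!: derivative_eq_intros)
    show "(((\<lambda>t. - exp (- c * t) / c) \<circ> real_of_ereal) \<longlongrightarrow> - exp (- c * (a - 1)) / c)
        (at_right (ereal (a - 1)))"
      unfolding ereal_tendsto_simps using assms by (auto intro!: tendsto_eq_intros)
    have "((\<lambda>t. - exp (- c * t) / c) \<longlongrightarrow> 0) at_top"
      using assms by real_asymp
    then show "(((\<lambda>t. - exp (- c * t) / c) \<circ> real_of_ereal) \<longlongrightarrow> 0) (at_left \<infinity>)"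
      unfolding ereal_tendsto_simps .
  qed (auto intro!: continuous_intros)
  then show ?thesis
    by (rule set_integrable_subset) (auto simp: einterval_def)
qed

section \<open>Abel inversion\<close>

text \<open>Indexed by v = cosh \<tau> instead of \<tau>, because v is quadratic in the coordinate
  over which it will be integrated. For v \<ge> 1 the condition 0 < t selects the branch t > \<tau>
  of cosh t > v; the extension by 0 makes the kernel a Borel function of both arguments, as Fubini
  needs.\<close>

definition abel_kernel :: "real \<Rightarrow> real \<Rightarrow> real" where
  "abel_kernel v t = (if 0 < t \<and> v < cosh t then 1 / sqrt (cosh t - v) else 0)"

text \<open>The constant is the one in the formula for k through g', so that nothing is left over
  when f is that derivative.\<close>

definition abel_inverse :: "(real \<Rightarrow> complex) \<Rightarrow> real \<Rightarrow> complex" where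
  "abel_inverse f v = - (1 / of_real (pi * sqrt 2)) * (LINT t|lborel. f t * of_real (abel_kernel v t))"

lemma abel_kernel_nonneg: "0 \<le> abel_kernel v t"
  by (simp add: abel_kernel_def)

lemma borel_measurable_cosh [measurable]: "(cosh :: real \<Rightarrow> real) \<in> borel_measurable borel"
  by (intro borel_measurable_continuous_onI continuous_intros)

lemma borel_measurable_abel_kernel [measurable]:
  assumes [measurable]: "v \<in> borel_measurable M" "t \<in> borel_measurable M"
  shows "(\<lambda>x. abel_kernel (v x) (t x)) \<in> borel_measurable M"
proof -
  have [measurable]: "(\<lambda>x. cosh (t x)) \<in> borel_measurable M"
    by (rule measurable_compose[OF assms(2) borel_measurable_cosh])
  show ?thesis
    unfolding abel_kernel_def by measurable
qed

text \<open>A model for the Abel kernel, with the same inverse square root singularity at its left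
  end and the same exponential decay, but with the elementary primitive 2 arctan (sqrt (exp r -
  1)).\<close>

lemma integral_inverse_sqrt_exp_minus_one:
  shows "set_integrable lborel {0<..} (\<lambda>r::real. 1 / sqrt (exp r - 1))"
    and "(LINT r:{0<..}|lborel. 1 / sqrt (exp r - 1)) = pi"
proof -
  have D: "((\<lambda>r. 2 * arctan (sqrt (exp r - 1))) has_real_derivative 1 / sqrt (exp x - 1)) (at x)"
    if "0 < ereal x" for x
    using that by (auto intro!: derivative_eq_intros simp: divide_simps)
  have c: "isCont (\<lambda>r. 1 / sqrt (exp r - 1)) x" if "0 < ereal x" for x
    using that by (auto intro!: continuous_intros)
  have nn: "AE x in lborel. 0 < ereal x \<longrightarrow> ereal x < \<infinity> \<longrightarrow> 0 \<le> 1 / sqrt (exp x - 1)"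
    by auto
  have "isCont (\<lambda>r. 2 * arctan (sqrt (exp r - 1))) (0::real)"
    by (intro continuous_intros)
  then have "((\<lambda>r. 2 * arctan (sqrt (exp r - 1))) \<longlongrightarrow> 0) (at_right (0::real))"
    unfolding isCont_def by (auto intro: filterlim_at_split[THEN iffD1, THEN conjunct2])
  then have l0: "(((\<lambda>r. 2 * arctan (sqrt (exp r - 1))) \<circ> real_of_ereal) \<longlongrightarrow> 0) (at_right 0)"
    unfolding zero_ereal_def ereal_tendsto_simps .
  have "filterlim (\<lambda>r::real. sqrt (- 1 + exp r)) at_top at_top"
    by (rule filterlim_compose[OF sqrt_at_top])
      (rule filterlim_tendsto_add_at_top[OF tendsto_const exp_at_top])
  then have "((\<lambda>r. 2 * arctan (sqrt (exp r - 1))) \<longlongrightarrow> 2 * (pi / 2)) at_top"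
    by (intro tendsto_intros filterlim_compose[OF tendsto_arctan_at_top]) simp
  then have l1: "(((\<lambda>r. 2 * arctan (sqrt (exp r - 1))) \<circ> real_of_ereal) \<longlongrightarrow> pi) (at_left \<infinity>)"
    unfolding ereal_tendsto_simps by simp
  have e: "einterval 0 \<infinity> = {0::real<..}"
    by (auto simp: einterval_def zero_ereal_def)
  note FTC = interval_integral_FTC_nonneg[OF _ D c nn l0 l1]
  show "set_integrable lborel {0<..} (\<lambda>r::real. 1 / sqrt (exp r - 1))"
    using FTC(1) by (simp add: e)
  show "(LINT r:{0<..}|lborel. 1 / sqrt (exp r - 1)) = pi"
    using FTC(2) by (simp add: interval_lebesgue_integral_def e)
qed

text \<open>Write v = cosh \<tau> and t = \<tau> + r. Then cosh t - v \<ge> sinh \<tau> (exp r - 1)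
  \<ge> (v - 1) (exp r - 1), the last step because cosh \<tau> - sinh \<tau> = exp (- \<tau>) \<le>
  1. The kernel is thus dominated by a shift of the model function divided by sqrt (v - 1).\<close>

lemma abel_kernel_integral:
  assumes "1 < v"
  shows "integrable lborel (abel_kernel v)"
    and "(LINT t|lborel. abel_kernel v t) \<le> pi / sqrt (v - 1)"
proof -
  define \<tau> where "\<tau> = arcosh v"
  have v: "v = cosh \<tau>" and "0 < \<tau>"
    using assms by (simp_all add: \<tau>_def)
  let ?w = "\<lambda>r::real. indicator {0<..} r *\<^sub>R (1 / sqrt (exp r - 1))"
  have s: "v - 1 \<le> sinh \<tau>" "0 < sinh \<tau>"
  proof -
    have "cosh \<tau> - sinh \<tau> = exp (- \<tau>)"
      by (simp add: cosh_def sinh_def field_simps)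
    also have "\<dots> \<le> 1" using \<open>0 < \<tau>\<close> by simp
    finally show "v - 1 \<le> sinh \<tau>" by (simp add: v)
    show "0 < sinh \<tau>" using \<open>0 < \<tau>\<close> by simp
  qed
  have le: "abel_kernel v t \<le> (1 / sqrt (v - 1)) * ?w (t - \<tau>)" for t
  proof (cases "0 < t \<and> \<tau> < t")
    case True
    define r where "r = t - \<tau>"
    have "r > 0" "t = \<tau> + r" using True by (auto simp: r_def)
    have "(v - 1) * (exp r - 1) \<le> sinh \<tau> * (exp r - 1)"
      using s \<open>r > 0\<close> by (intro mult_right_mono) auto
    also have "\<dots> \<le> cosh (\<tau> + r) - cosh \<tau>"
    proof -
      have "cosh (\<tau> + r) - cosh \<tau> - sinh \<tau> * (exp r - 1) = 
          cosh \<tau> * (cosh r - 1) - sinh \<tau> * (cosh r - 1)"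
        by (simp add: cosh_add sinh_plus_cosh[symmetric] algebra_simps)
      also have "\<dots> = (cosh \<tau> - sinh \<tau>) * (cosh r - 1)"
        by (simp add: algebra_simps)
      also have "\<dots> \<ge> 0"
        by (intro mult_nonneg_nonneg) (auto simp: cosh_real_ge_1 sinh_le_cosh_real)
      finally show ?thesis by simp
    qed
    finally have "(v - 1) * (exp r - 1) \<le> cosh t - v"
      by (simp add: v \<open>t = \<tau> + r\<close>)
    moreover have "0 < (v - 1) * (exp r - 1)"
      using assms \<open>r > 0\<close> by simp
    ultimately have "1 / sqrt (cosh t - v) \<le> 1 / sqrt ((v - 1) * (exp r - 1))"
      by (intro divide_left_mono) auto
    moreover have "abel_kernel v t = 1 / sqrt (cosh t - v)"
      using True \<open>0 < \<tau>\<close> by (auto simp: abel_kernel_def v cosh_real_strict_mono)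
    ultimately show ?thesis
      using True by (simp add: r_def real_sqrt_mult)
  next
    case False
    then have "\<not> (0 < t \<and> v < cosh t)"
      using \<open>0 < \<tau>\<close> by (auto simp: v not_less intro: cosh_real_nonneg_le_iff[THEN iffD2])
    then show ?thesis
      using assms by (simp only: abel_kernel_def if_False) (simp add: indicator_def)
  qed
  have w: "integrable lborel ?w"
    using integral_inverse_sqrt_exp_minus_one(1) by (simp add: set_integrable_def)
  have w': "integrable lborel (\<lambda>t. (1 / sqrt (v - 1)) * ?w (t - \<tau>))"
    using lborel_integrable_real_affine[OF w, of 1 "- \<tau>"]
    by (intro integrable_mult_right) (simp add: algebra_simps)
  show int: "integrable lborel (abel_kernel v)"
  proof (rule Bochner_Integration.integrable_bound[OF w'])
    show "AE t in lborel. norm (abel_kernel v t) \<le> norm ((1 / sqrt (v - 1)) * ?w (t - \<tau>))"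
      using le abel_kernel_nonneg by (intro AE_I2) (smt (verit, best) real_norm_def)
  qed measurable
  have "(LINT t|lborel. abel_kernel v t) \<le> (LINT t|lborel. (1 / sqrt (v - 1)) * ?w (t - \<tau>))"
    by (intro integral_mono int w' le)
  also have "\<dots> = (1 / sqrt (v - 1)) * (LINT t|lborel. ?w (t - \<tau>))"
    by (rule integral_mult_right_zero)
  also have "(LINT t|lborel. ?w (t - \<tau>)) = (LINT t|lborel. ?w t)"
    using lborel_integral_real_affine[of 1 ?w "- \<tau>"] by (simp add: algebra_simps)
  also have "\<dots> = pi"
    using integral_inverse_sqrt_exp_minus_one(2) by (simp add: set_lebesgue_integral_def)
  finally show "(LINT t|lborel. abel_kernel v t) \<le> pi / sqrt (v - 1)" by simp
qed

text \<open>The arcsine integral. That D drops out of the value is the point: D will carry the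
  dependence on t, so the Abel kernel integrates to a constant.\<close>

lemma integral_inverse_sqrt_quadratic:
  fixes D E :: real
  assumes "0 < D" "0 < E"
  shows "integrable lborel (\<lambda>u. if E * u\<^sup>2 < D then 1 / sqrt (D - E * u\<^sup>2) else 0)"
    and "(LINT u|lborel. (if E * u\<^sup>2 < D then 1 / sqrt (D - E * u\<^sup>2) else 0)) = pi / sqrt E"
proof -
  define r where "r = sqrt (D / E)"
  have "0 < r" and r2: "E * r\<^sup>2 = D" using assms by (auto simp: r_def)
  have dom: "E * u\<^sup>2 < D \<longleftrightarrow> - r < u \<and> u < r" for u
  proof -
    have "E * u\<^sup>2 < D \<longleftrightarrow> u\<^sup>2 < r\<^sup>2"
      using assms by (simp flip: r2)
    also have "\<dots> \<longleftrightarrow> \<bar>u\<bar> < r"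
      using \<open>0 < r\<close> abs_le_square_iff[of r u] by (auto simp: not_le[symmetric])
    finally show ?thesis by auto
  qed
  let ?F = "\<lambda>u. arcsin (u / r) / sqrt E"
  have D: "(?F has_real_derivative 1 / sqrt (D - E * x\<^sup>2)) (at x)"
    if "ereal (- r) < ereal x" "ereal x < ereal r" for x
  proof -
    have x: "- 1 < x / r" "x / r < 1"
      using that \<open>0 < r\<close> by (auto simp: field_simps)
    have "D - E * x\<^sup>2 = E * r\<^sup>2 * (1 - (x / r)\<^sup>2)"
      using \<open>0 < r\<close> by (simp add: power_divide right_diff_distrib flip: r2)
    then have "sqrt (D - E * x\<^sup>2) = sqrt E * r * sqrt (1 - (x / r)\<^sup>2)"
      using \<open>0 < r\<close> by (simp add: real_sqrt_mult)
    moreover have "(?F has_real_derivative inverse (sqrt (1 - (x / r)\<^sup>2)) * (1 / r) / sqrt E) (at x)"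
      by (rule DERIV_cdivide) (use x \<open>0 < r\<close> in \<open>auto intro!: derivative_eq_intros\<close>)
    ultimately show ?thesis
      by (simp only:) (simp add: divide_inverse mult_ac)
  qed
  have c: "isCont (\<lambda>u. 1 / sqrt (D - E * u\<^sup>2)) x"
    if "ereal (- r) < ereal x" "ereal x < ereal r" for x
    using that dom[of x] by (auto intro!: continuous_intros)
  have nn: "AE x in lborel. ereal (- r) < ereal x \<longrightarrow> ereal x < ereal r \<longrightarrow> 0 \<le> 1 / sqrt (D - E * x\<^sup>2)"
  proof (intro AE_I2 impI)
    fix x assume "ereal (- r) < ereal x" "ereal x < ereal r"
    then have "E * x\<^sup>2 < D" using dom by simp
    then show "0 \<le> 1 / sqrt (D - E * x\<^sup>2)" by simp
  qed
  \<comment> \<open>The integrand is singular at both ends, but arcsin is continuous on the closed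
    interval, which gives the boundary limits of the primitive.\<close>
  have cF: "continuous_on {- r..r} ?F"
    using \<open>0 < r\<close> assms by (auto intro!: continuous_intros simp: field_simps)
  have "(?F \<longlongrightarrow> ?F (- r)) (at (- r) within {- r..r})"
    by (rule bspec[OF cF[unfolded continuous_on_def]]) (use \<open>0 < r\<close> in simp)
  moreover have "(?F \<longlongrightarrow> ?F r) (at r within {- r..r})"
    by (rule bspec[OF cF[unfolded continuous_on_def]]) (use \<open>0 < r\<close> in simp)
  ultimately have "(?F \<longlongrightarrow> ?F (- r)) (at_right (- r))" "(?F \<longlongrightarrow> ?F r) (at_left r)"
    using \<open>0 < r\<close> by (simp_all add: at_within_Icc_at_right at_within_Icc_at_left)
  then have l: "((?F \<circ> real_of_ereal) \<longlongrightarrow> - (pi / 2) / sqrt E) (at_right (ereal (- r)))"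
      "((?F \<circ> real_of_ereal) \<longlongrightarrow> (pi / 2) / sqrt E) (at_left (ereal r))"
    unfolding ereal_tendsto_simps using \<open>0 < r\<close> by simp_all
  have "ereal (- r) < ereal r" using \<open>0 < r\<close> by simp
  note FTC = interval_integral_FTC_nonneg[OF this D c nn l]
  have eq: "(\<lambda>u. if E * u\<^sup>2 < D then 1 / sqrt (D - E * u\<^sup>2) else 0) =
      (\<lambda>u. indicator (einterval (ereal (- r)) (ereal r)) u *\<^sub>R (1 / sqrt (D - E * u\<^sup>2)))"
    by (auto simp: fun_eq_iff dom einterval_def indicator_def)
  show "integrable lborel (\<lambda>u. if E * u\<^sup>2 < D then 1 / sqrt (D - E * u\<^sup>2) else 0)"
    unfolding eq using FTC(1) by (simp add: set_integrable_def)
  show "(LINT u|lborel. (if E * u\<^sup>2 < D then 1 / sqrt (D - E * u\<^sup>2) else 0)) = pi / sqrt E"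
    unfolding eq using FTC(2) \<open>0 < r\<close>
    by (simp add: interval_lebesgue_integral_def set_lebesgue_integral_def)
qed

text \<open>For t > a this is the arcsine integral with D = cosh t - cosh a. For 0 < t \<le> a the
  kernel vanishes identically, since its first argument is at least cosh a \<ge> cosh t.\<close>

lemma abel_kernel_slice:
  fixes a E :: real
  assumes "0 < a" "0 < E"
  shows "integrable lborel (\<lambda>u. abel_kernel (cosh a + E * u\<^sup>2) t)"
    and "(LINT u|lborel. abel_kernel (cosh a + E * u\<^sup>2) t) = indicator {a<..} t * (pi / sqrt E)"
proof -
  have "integrable lborel (\<lambda>u. abel_kernel (cosh a + E * u\<^sup>2) t) \<and>
    (LINT u|lborel. abel_kernel (cosh a + E * u\<^sup>2) t) = indicator {a<..} t * (pi / sqrt E)"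
  proof (cases "a < t")
    case True
    then have D: "0 < cosh t - cosh a"
      using assms by (simp add: cosh_real_strict_mono)
    have "(\<lambda>u. abel_kernel (cosh a + E * u\<^sup>2) t) =
        (\<lambda>u. if E * u\<^sup>2 < cosh t - cosh a then 1 / sqrt (cosh t - cosh a - E * u\<^sup>2) else 0)"
      using True assms by (auto simp: fun_eq_iff abel_kernel_def algebra_simps)
    then show ?thesis
      using integral_inverse_sqrt_quadratic[OF D \<open>0 < E\<close>] True by simp
  next
    case False
    have "abel_kernel (cosh a + E * u\<^sup>2) t = 0" for u
    proof -
      have "cosh t \<le> cosh a" if "0 < t"
        using False that assms by (subst cosh_real_nonneg_le_iff) auto
      moreover have "0 \<le> E * u\<^sup>2" using assms by simp
      ultimately show ?thesis by (auto simp: abel_kernel_def)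
    qed
    then show ?thesis using False by simp
  qed
  then show "integrable lborel (\<lambda>u. abel_kernel (cosh a + E * u\<^sup>2) t)"
    and "(LINT u|lborel. abel_kernel (cosh a + E * u\<^sup>2) t) = indicator {a<..} t * (pi / sqrt E)"
    by auto
qed

text \<open>The factor pi of the kernel integral cancels against the constant in
  \<open>abel_inverse\<close>; the remaining 1 / sqrt 2 is dropped. A bound on f for positive t
  suffices because the kernel vanishes elsewhere.\<close>

lemma norm_abel_inverse_le:
  assumes "1 < v" and M: "\<And>t. 0 < t \<Longrightarrow> norm (f t) \<le> M" and "0 \<le> M"
    and [measurable]: "f \<in> borel_measurable borel"
  shows "norm (abel_inverse f v) \<le> M / sqrt (v - 1)"
proof -
  have b: "norm (f t * of_real (abel_kernel v t)) \<le> M * abel_kernel v t" for t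
    using M[of t] abel_kernel_nonneg[of v t]
    by (cases "0 < t") (auto simp: norm_mult abel_kernel_def intro!: divide_right_mono)
  have i: "integrable lborel (\<lambda>t. M * abel_kernel v t)"
    by (intro integrable_mult_right abel_kernel_integral assms)
  have "integrable lborel (\<lambda>t. f t * of_real (abel_kernel v t))"
    by (rule Bochner_Integration.integrable_bound[OF i])
      (auto intro!: AE_I2 order_trans[OF b] abs_ge_self)
  then have "norm (LINT t|lborel. f t * of_real (abel_kernel v t)) \<le>
      (LINT t|lborel. M * abel_kernel v t)"
    by (intro order_trans[OF integral_norm_bound] integral_mono integrable_norm i b)
  also have "\<dots> \<le> M * (pi / sqrt (v - 1))"
    unfolding integral_mult_right_zero
    using abel_kernel_integral(2)[OF \<open>1 < v\<close>] \<open>0 \<le> M\<close> by (rule mult_left_mono)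
  finally have *: "norm (LINT t|lborel. f t * of_real (abel_kernel v t)) \<le> M * (pi / sqrt (v - 1))" .
  have "norm (abel_inverse f v) = 1 / (pi * sqrt 2) * norm (LINT t|lborel. f t * of_real (abel_kernel v t))"
    by (simp add: abel_inverse_def norm_mult norm_divide)
  also have "\<dots> \<le> 1 / (pi * sqrt 2) * (M * (pi / sqrt (v - 1)))"
    by (intro mult_left_mono *) simp
  also have "\<dots> = M / sqrt (v - 1) / sqrt 2" by simp
  also have "\<dots> \<le> M / sqrt (v - 1) / 1"
    using assms by (intro divide_left_mono) auto
  finally show ?thesis by simp
qed

text \<open>By Fubini the u-integral is taken first, where only the kernel depends on u; it gives pi
  / sqrt E for t > a and 0 otherwise, and pi / sqrt E divided by pi sqrt 2 is 1 / sqrt (2 E). The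
  last claim is the same computation with norms, for use when a series of such functions is
  integrated termwise.\<close>

lemma abel_inverse_slice:
  fixes f :: "real \<Rightarrow> complex" and a E :: real
  assumes "0 < a" "0 < E" and f: "set_integrable lborel {a<..} f"
    and [measurable]: "f \<in> borel_measurable borel"
  shows "integrable lborel (\<lambda>u. abel_inverse f (cosh a + E * u\<^sup>2))"
    and "(LINT u|lborel. abel_inverse f (cosh a + E * u\<^sup>2)) =
      - (1 / of_real (sqrt (2 * E))) * (LINT t:{a<..}|lborel. f t)"
    and "(LINT u|lborel. norm (abel_inverse f (cosh a + E * u\<^sup>2))) \<le>
      1 / sqrt (2 * E) * (LINT t:{a<..}|lborel. norm (f t))"
proof -
  let ?k = "\<lambda>u. abel_kernel (cosh a + E * u\<^sup>2)"
  let ?c = "1 / (pi * sqrt 2)"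
  note sl = abel_kernel_slice[OF \<open>0 < a\<close> \<open>0 < E\<close>]
  have norm1: "(LINT u|lborel. norm (f t * of_real (?k u t))) = indicator {a<..} t * norm (f t) * (pi / sqrt E)" for t
    by (simp add: norm_mult abel_kernel_nonneg sl)
  have int: "integrable (lborel \<Otimes>\<^sub>M lborel) (\<lambda>(t, u). f t * of_real (?k u t))"
  proof (rule lborel_pair.Fubini_integrable)
    show "integrable lborel (\<lambda>t. LINT u|lborel. norm (case (t, u) of (t, u) \<Rightarrow> f t * of_real (?k u t)))"
      using f[THEN set_integrable_norm] unfolding prod.case norm1
      by (intro integrable_mult_left) (simp add: set_integrable_def)
  qed (use sl in \<open>auto intro!: AE_I2 integrable_mult_right integrable_of_real\<close>)
  have nint: "integrable (lborel \<Otimes>\<^sub>M lborel) (\<lambda>(t, u). norm (f t * of_real (?k u t)))"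
    using integrable_norm[OF int] by (simp add: case_prod_beta')
  have eq: "abel_inverse f (cosh a + E * u\<^sup>2) = of_real (- ?c) * (LINT t|lborel. f t * of_real (?k u t))" for u
    by (simp add: abel_inverse_def)
  have i2: "integrable lborel (\<lambda>u. LINT t|lborel. f t * of_real (?k u t))"
    using lborel_pair.integrable_snd[OF int] by simp
  show "integrable lborel (\<lambda>u. abel_inverse f (cosh a + E * u\<^sup>2))"
    unfolding eq by (intro integrable_mult_right i2)
  have "(LINT u|lborel. abel_inverse f (cosh a + E * u\<^sup>2)) =
      of_real (- ?c) * (LINT u|lborel. LINT t|lborel. f t * of_real (?k u t))"
    unfolding eq by simp
  also have "(LINT u|lborel. LINT t|lborel. f t * of_real (?k u t)) =
      (LINT t|lborel. LINT u|lborel. f t * of_real (?k u t))"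
    using lborel_pair.Fubini_integral[OF int] by simp
  also have "\<dots> = (LINT t|lborel. (indicator {a<..} t *\<^sub>R f t) * of_real (pi / sqrt E))"
    using sl by (intro Bochner_Integration.integral_cong refl) (simp add: integral_complex_of_real[symmetric] scaleR_conv_of_real del: integral_complex_of_real)
  also have "\<dots> = (LINT t:{a<..}|lborel. f t) * of_real (pi / sqrt E)"
    unfolding set_lebesgue_integral_def by (rule integral_mult_left_zero)
  finally show "(LINT u|lborel. abel_inverse f (cosh a + E * u\<^sup>2)) =
      - (1 / of_real (sqrt (2 * E))) * (LINT t:{a<..}|lborel. f t)"
    by (simp add: real_sqrt_mult)
  have "(LINT u|lborel. norm (abel_inverse f (cosh a + E * u\<^sup>2))) =
      ?c * (LINT u|lborel. norm (LINT t|lborel. f t * of_real (?k u t)))"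
    unfolding eq norm_mult norm_of_real by simp
  also have "\<dots> \<le> ?c * (LINT u|lborel. LINT t|lborel. norm (f t * of_real (?k u t)))"
    using lborel_pair.integrable_snd[OF nint] integrable_norm[OF i2]
    by (intro mult_left_mono integral_mono integral_norm_bound) auto
  also have "(LINT u|lborel. LINT t|lborel. norm (f t * of_real (?k u t))) =
      (LINT t|lborel. LINT u|lborel. norm (f t * of_real (?k u t)))"
    using lborel_pair.Fubini_integral[OF nint] by simp
  also have "\<dots> = (LINT t:{a<..}|lborel. norm (f t)) * (pi / sqrt E)"
    unfolding norm1 by (simp add: set_lebesgue_integral_def)
  finally show "(LINT u|lborel. norm (abel_inverse f (cosh a + E * u\<^sup>2))) \<le>
      1 / sqrt (2 * E) * (LINT t:{a<..}|lborel. norm (f t))"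
    by (simp add: real_sqrt_mult)
qed

section \<open>The point-pair invariant\<close>

text \<open>The open strip is the form in which the contour shift uses the hypotheses: a holomorphic
  function on an open convex set has a primitive.\<close>

locale strip_function =
  fixes h :: "complex \<Rightarrow> complex" and \<sigma> \<delta> C :: real
  assumes sigma_pos: "0 < \<sigma>"
    and holomorphic: "h holomorphic_on {z. \<bar>Im z\<bar> < \<sigma>}"
    and delta_pos: "0 < \<delta>"
    and bound: "\<And>z. \<bar>Im z\<bar> < \<sigma> \<Longrightarrow> norm (h z) \<le> C * (1 + \<bar>Re z\<bar>) powr (- 2 - \<delta>)"
begin

text \<open>The Fourier integral differentiated under the integral sign. Its relation to
  \<open>g_transform h\<close> enters only in integrated form, through \<open>integral_g'\<close>,
  so that \<open>g_transform h\<close> itself is never differentiated.\<close>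

definition g' :: "real \<Rightarrow> complex" where
  "g' t = 1 / (2 * of_real pi) *
    (LINT \<rho>|lborel. - \<i> * of_real \<rho> * h (of_real \<rho>) * exp (- (\<i> * of_real \<rho> * of_real t)))"

lemma C_nonneg: "0 \<le> C"
proof -
  have "norm (h 0) \<le> C"
    using bound[of 0] sigma_pos by simp
  then show ?thesis
    using norm_ge_zero order_trans by blast
qed

lemma bound_h: "norm (h z) \<le> C * (1 + \<bar>Re z\<bar>) powr (- 1 - \<delta>)" if "\<bar>Im z\<bar> < \<sigma>"
proof -
  have "norm (h z) \<le> C * (1 + \<bar>Re z\<bar>) powr (- 2 - \<delta>)"
    using that by (rule bound)
  also have "\<dots> \<le> C * (1 + \<bar>Re z\<bar>) powr (- 1 - \<delta>)"
    using C_nonneg by (intro mult_left_mono powr_mono) auto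
  finally show ?thesis .
qed

text \<open>The factor z is at most (1 + \<sigma>) (1 + |Re z|) in the strip, which lowers the order
  of decay from 2 + \<delta> to 1 + \<delta>.\<close>

lemma bound_id_h:
  "norm (- \<i> * z * h z) \<le> (1 + \<sigma>) * C * (1 + \<bar>Re z\<bar>) powr (- 1 - \<delta>)" if "\<bar>Im z\<bar> < \<sigma>"
proof -
  have "norm z \<le> \<bar>Re z\<bar> + \<bar>Im z\<bar>"
    by (rule cmod_le)
  also have "\<dots> \<le> (1 + \<sigma>) * (1 + \<bar>Re z\<bar>)"
  proof -
    have "0 \<le> \<sigma> * \<bar>Re z\<bar>" using sigma_pos by simp
    moreover have "(1 + \<sigma>) * (1 + \<bar>Re z\<bar>) = 1 + \<bar>Re z\<bar> + \<sigma> + \<sigma> * \<bar>Re z\<bar>"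
      by (simp add: algebra_simps)
    ultimately show ?thesis using that by linarith
  qed
  finally have "norm (- \<i> * z * h z) \<le> ((1 + \<sigma>) * (1 + \<bar>Re z\<bar>)) * (C * (1 + \<bar>Re z\<bar>) powr (- 2 - \<delta>))"
    unfolding norm_mult using bound[OF that] sigma_pos by (auto intro!: mult_mono)
  also have "\<dots> = (1 + \<sigma>) * C * ((1 + \<bar>Re z\<bar>) powr 1 * (1 + \<bar>Re z\<bar>) powr (- 2 - \<delta>))"
    by (simp add: mult_ac)
  also have "\<dots> = (1 + \<sigma>) * C * (1 + \<bar>Re z\<bar>) powr (- 1 - \<delta>)"
    by (subst powr_add[symmetric]) simp
  finally show ?thesis .
qed

lemma holomorphic_id_h: "(\<lambda>z. - \<i> * z * h z) holomorphic_on {z. \<bar>Im z\<bar> < \<sigma>}"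
  by (intro holomorphic_intros holomorphic)

section \<open>Measurability and exponential decay of g and its derivative\<close>

lemma borel_measurable_h [measurable]: "(\<lambda>\<rho>. h (of_real \<rho>)) \<in> borel_measurable borel"
  by (intro borel_measurable_continuous_onI continuous_on_compose2
      [OF holomorphic_on_imp_continuous_on[OF holomorphic]] continuous_intros)
    (use sigma_pos in auto)

lemma borel_measurable_exp_ii [measurable]:
  assumes [measurable]: "x \<in> borel_measurable M" "y \<in> borel_measurable M"
  shows "(\<lambda>p. exp (- (\<i> * complex_of_real (x p) * complex_of_real (y p)))) \<in> borel_measurable M"
  by (rule measurable_compose[where g = exp])
    (auto intro!: borel_measurable_continuous_onI continuous_intros)

lemma borel_measurable_g' [measurable]: "g' \<in> borel_measurable borel"
  unfolding g'_def by measurable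

lemma integrable_id_h: "integrable lborel (\<lambda>\<rho>. - \<i> * of_real \<rho> * h (of_real \<rho>))"
  using strip_fourier_integrable[OF holomorphic_id_h order_refl sigma_pos delta_pos bound_id_h, of 0]
  by simp

lemma integrable_h: "integrable lborel (\<lambda>\<rho>. h (of_real \<rho>) * exp (- (\<i> * of_real \<rho> * of_real t)))"
  using strip_fourier_integrable[OF holomorphic order_refl sigma_pos delta_pos bound_h, of t]
  by simp

text \<open>The depth \<sigma> / 2 is a convenient choice strictly inside the strip; any positive
  rate makes g vanish at infinity and g' integrable on the half-line.\<close>

lemma norm_g_transform_le:
  assumes "0 \<le> t"
  shows "norm (g_transform h t) \<le>
    (1 / (2 * pi) * (C * (LINT x|lborel. (1 + \<bar>x\<bar>) powr (- 1 - \<delta>)))) * exp (- (\<sigma> / 2) * t)"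
proof -
  have "norm (g_transform h t) = 1 / (2 * pi) *
      norm (LINT \<rho>|lborel. h (of_real \<rho>) * exp (- (\<i> * of_real \<rho> * of_real t)))"
    by (simp add: g_transform_def norm_mult norm_divide)
  also have "\<dots> \<le> 1 / (2 * pi) * (C * (LINT x|lborel. (1 + \<bar>x\<bar>) powr (- 1 - \<delta>)) * exp (- (\<sigma> / 2) * t))"
    by (rule mult_left_mono[OF strip_fourier_decay[OF holomorphic]])
      (use sigma_pos delta_pos bound_h assms in auto)
  finally show ?thesis by (simp add: mult_ac)
qed

definition M' :: real where
  "M' = 1 / (2 * pi) * ((1 + \<sigma>) * C * (LINT x|lborel. (1 + \<bar>x\<bar>) powr (- 1 - \<delta>)))"

lemma norm_g'_le:
  assumes "0 \<le> t"
  shows "norm (g' t) \<le> M' * exp (- (\<sigma> / 2) * t)"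
proof -
  have "norm (g' t) = 1 / (2 * pi) *
      norm (LINT \<rho>|lborel. (- \<i> * of_real \<rho> * h (of_real \<rho>)) * exp (- (\<i> * of_real \<rho> * of_real t)))"
    by (simp add: g'_def norm_mult norm_divide)
  also have "\<dots> \<le> 1 / (2 * pi) * ((1 + \<sigma>) * C * (LINT x|lborel. (1 + \<bar>x\<bar>) powr (- 1 - \<delta>)) * exp (- (\<sigma> / 2) * t))"
    by (rule mult_left_mono[OF strip_fourier_decay[OF holomorphic_id_h]])
      (use sigma_pos delta_pos bound_id_h assms in auto)
  finally show ?thesis by (simp add: M'_def mult_ac)
qed

lemma M'_nonneg: "0 \<le> M'"
proof -
  have "0 \<le> (LINT x|lborel. (1 + \<bar>x\<bar>) powr (- 1 - \<delta>))"
    by (intro integral_nonneg_AE) auto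
  then show ?thesis
    using C_nonneg sigma_pos by (auto simp: M'_def)
qed

lemma norm_g'_le_M': "0 \<le> t \<Longrightarrow> norm (g' t) \<le> M'"
  using norm_g'_le[of t] mult_left_mono[of "exp (- (\<sigma> / 2) * t)" 1 M'] M'_nonneg sigma_pos
  by fastforce

lemma set_integrable_g':
  assumes "0 \<le> a"
  shows "set_integrable lborel {a..} g'"
proof (rule set_integrable_bound)
  show "set_integrable lborel {a..} (\<lambda>t. M' * exp (- (\<sigma> / 2) * t))"
    using sigma_pos by (intro set_integrable_mult_right set_integrable_exp_minus) simp
  show "AE t in lborel. t \<in> {a..} \<longrightarrow> norm (g' t) \<le> norm (M' * exp (- (\<sigma> / 2) * t))"
    using assms by (auto intro!: AE_I2 order_trans[OF norm_g'_le] abs_ge_self)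
qed (simp add: set_borel_measurable_def)

text \<open>On a bounded interval the t-integral is taken inside the Fourier integral, where the
  factor - i \<rho> is exactly what the exponential produces on differentiation; this leaves g at
  the two ends. The upper end is then sent to infinity, where g tends to 0.\<close>

lemma integral_g':
  assumes "0 \<le> a"
  shows "(LINT t:{a<..}|lborel. g' t) = - g_transform h a"
proof -
  have finite: "(LINT t:{a..T}|lborel. g' t) = g_transform h T - g_transform h a" if "a \<le> T" for T
  proof -
    let ?e = "\<lambda>\<rho> t. exp (- (\<i> * complex_of_real \<rho> * complex_of_real t))"
    let ?f = "\<lambda>\<rho> t. indicator {a..T} t *\<^sub>R (- \<i> * of_real \<rho> * h (of_real \<rho>) * ?e \<rho> t)"
    have ne: "norm (?e \<rho> t) = 1" for \<rho> t
      by (simp add: norm_exp_eq_Re)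
    have nf: "norm (?f \<rho> t) = indicator {a..T} t * norm (- \<i> * of_real \<rho> * h (of_real \<rho>))" for \<rho> t
      unfolding norm_scaleR norm_mult ne by simp
    have int: "integrable (lborel \<Otimes>\<^sub>M lborel) (\<lambda>(\<rho>, t). ?f \<rho> t)"
    proof (rule lborel_pair.Fubini_integrable)
      show "integrable lborel (\<lambda>\<rho>. LINT t|lborel. norm (case (\<rho>, t) of (\<rho>, t) \<Rightarrow> ?f \<rho> t))"
        unfolding prod.case nf using integrable_norm[OF integrable_id_h]
        by (auto intro!: integrable_mult_right simp: mult.commute)
      show "AE \<rho> in lborel. integrable lborel (\<lambda>t. case (\<rho>, t) of (\<rho>, t) \<Rightarrow> ?f \<rho> t)"
        unfolding prod.case
      proof (rule AE_I2)
        fix \<rho>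
        have "set_integrable lborel {a..T} (\<lambda>t. - \<i> * of_real \<rho> * h (of_real \<rho>) * ?e \<rho> t)"
          unfolding set_integrable_def by (intro borel_integrable_compact continuous_intros) auto
        then show "integrable lborel (?f \<rho>)"
          by (simp add: set_integrable_def)
      qed
    qed measurable
    have inner: "(LINT t|lborel. ?f \<rho> t) = h (of_real \<rho>) * ?e \<rho> T - h (of_real \<rho>) * ?e \<rho> a" for \<rho>
    proof (rule integral_FTC_atLeastAtMost[OF that])
      show "((\<lambda>t. h (of_real \<rho>) * ?e \<rho> t) has_vector_derivative
          - \<i> * of_real \<rho> * h (of_real \<rho>) * ?e \<rho> t) (at t within {a..T})" for t
        by (auto intro!: derivative_eq_intros has_vector_derivative_real_field)
    qed (auto intro!: continuous_intros)
    have "indicator {a..T} t *\<^sub>R g' t = 1 / (2 * of_real pi) * (LINT \<rho>|lborel. ?f \<rho> t)" for t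
      by (simp only: g'_def integral_scaleR_right mult_scaleR_right)
    then have "(LINT t:{a..T}|lborel. g' t) = 1 / (2 * of_real pi) * (LINT t|lborel. LINT \<rho>|lborel. ?f \<rho> t)"
      by (simp only: set_lebesgue_integral_def integral_mult_right_zero)
    also have "(LINT t|lborel. LINT \<rho>|lborel. ?f \<rho> t) = (LINT \<rho>|lborel. LINT t|lborel. ?f \<rho> t)"
      using lborel_pair.Fubini_integral[OF int] by simp
    also have "\<dots> = (LINT \<rho>|lborel. h (of_real \<rho>) * ?e \<rho> T) - (LINT \<rho>|lborel. h (of_real \<rho>) * ?e \<rho> a)"
      unfolding inner by (intro Bochner_Integration.integral_diff integrable_h)
    finally show ?thesis
      by (simp add: g_transform_def algebra_simps)
  qed
  have "((\<lambda>t. (1 / (2 * pi) * (C * (LINT x|lborel. (1 + \<bar>x\<bar>) powr (- 1 - \<delta>)))) * exp (- (\<sigma> / 2) * t)) \<longlongrightarrow> 0) at_top"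
    using sigma_pos by (intro tendsto_mult_right_zero) real_asymp
  then have "(g_transform h \<longlongrightarrow> 0) at_top"
    by (rule Lim_null_comparison[rotated])
      (rule eventually_mono[OF eventually_ge_at_top[of 0]], erule norm_g_transform_le)
  then have "((\<lambda>T. g_transform h T - g_transform h a) \<longlongrightarrow> 0 - g_transform h a) at_top"
    by (intro tendsto_intros)
  moreover have "\<forall>\<^sub>F T in at_top. g_transform h T - g_transform h a = (LINT t:{a..T}|lborel. g' t)"
    using eventually_ge_at_top[of a] by eventually_elim (simp add: finite)
  ultimately have "((\<lambda>T. LINT t:{a..T}|lborel. g' t) \<longlongrightarrow> - g_transform h a) at_top"
    by (simp add: tendsto_cong)
  moreover have "((\<lambda>T. LINT t:{a..T}|lborel. g' t) \<longlongrightarrow> (LINT t:{a..}|lborel. g' t)) at_top"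
    by (rule tendsto_set_lebesgue_integral_at_top) (use assms set_integrable_g' in auto)
  ultimately have "(LINT t:{a..}|lborel. g' t) = - g_transform h a"
    by (intro tendsto_unique[OF trivial_limit_at_top_linorder])
  moreover have "(LINT t:{a..}|lborel. g' t) = (LINT t:{a<..}|lborel. g' t)"
    unfolding set_lebesgue_integral_def
    by (rule integral_cong_AE) (auto intro!: AE_I[of _ _ "{a}"] simp: indicator_def)
  ultimately show ?thesis by simp
qed

text \<open>After insertion of the integral for the Legendre function, the double integrand has
  modulus |\<rho> h(\<rho>)| times the Abel kernel, a product of integrable functions, so the order
  may be changed. The inner integral is then 2 pi i g'(t), and 1 / (pi i) times - 1 / (2 pi sqrt 2)
  times 2 pi i is - 1 / (pi sqrt 2).\<close>

lemma point_pair_invariant_eq_abel_inverse: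
  assumes "z \<in> half_plane" "w \<in> half_plane" "z \<noteq> w"
  shows "point_pair_invariant h z w = abel_inverse g' (1 + (cmod (z - w))\<^sup>2 / (2 * Im z * Im w))"
proof -
  define v where "v = 1 + (cmod (z - w))\<^sup>2 / (2 * Im z * Im w)"
  define \<tau> where "\<tau> = hyp_dist z w"
  have "1 < v" using assms by (auto simp: v_def half_plane_def)
  then have v: "v = cosh \<tau>" "0 < \<tau>"
    unfolding \<tau>_def hyp_dist_def v_def[symmetric] by simp_all
  let ?e = "\<lambda>\<rho> t. exp (- (\<i> * complex_of_real \<rho> * complex_of_real t))"
  let ?f = "\<lambda>\<rho> t. of_real \<rho> * h (of_real \<rho>) * ?e \<rho> t * of_real (abel_kernel v t)"
  let ?c = "- 1 / (2 * of_real pi * of_real (sqrt 2)) :: complex"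
  have dom: "t \<in> {\<tau><..} \<longleftrightarrow> 0 < t \<and> v < cosh t" for t
  proof (cases "0 < t")
    case True
    then show ?thesis using v by (simp add: cosh_real_nonneg_less_iff)
  qed (use v in auto)
  have ne: "norm (?e \<rho> t) = 1" for \<rho> t
    by (simp add: norm_exp_eq_Re)
  note k = abel_kernel_integral(1)[OF \<open>1 < v\<close>]
  have ik: "integrable lborel (\<lambda>t. ?e \<rho> t * of_real (abel_kernel v t))" for \<rho>
    by (rule Bochner_Integration.integrable_bound[OF k])
      (auto simp: norm_mult ne abel_kernel_nonneg)
  have nf: "norm (?f \<rho> t) = norm (- \<i> * of_real \<rho> * h (of_real \<rho>)) * abel_kernel v t" for \<rho> t
    unfolding norm_mult ne by (simp add: abel_kernel_nonneg)
  have int: "integrable (lborel \<Otimes>\<^sub>M lborel) (\<lambda>(\<rho>, t). ?f \<rho> t)"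
  proof (rule lborel_pair.Fubini_integrable)
    show "integrable lborel (\<lambda>\<rho>. LINT t|lborel. norm (case (\<rho>, t) of (\<rho>, t) \<Rightarrow> ?f \<rho> t))"
      unfolding prod.case nf using integrable_norm[OF integrable_id_h] by simp
    show "AE \<rho> in lborel. integrable lborel (\<lambda>t. case (\<rho>, t) of (\<rho>, t) \<Rightarrow> ?f \<rho> t)"
      unfolding prod.case mult.assoc by (intro AE_I2 integrable_mult_right ik[unfolded mult.assoc])
  qed measurable
  have Q: "legendre_Q_cosh \<rho> \<tau> = 1 / of_real (sqrt 2) * (LINT t|lborel. ?e \<rho> t * of_real (abel_kernel v t))" for \<rho>
    unfolding legendre_Q_cosh_def set_lebesgue_integral_def
    by (intro arg_cong2[where f = "(*)"] refl Bochner_Integration.integral_cong)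
      (auto simp: indicator_def dom abel_kernel_def v(1) simp del: greaterThan_iff)
  have "green \<rho> z w * of_real \<rho> * h (of_real \<rho>) = ?c * (LINT t|lborel. ?f \<rho> t)" for \<rho>
    by (simp add: green_def Q flip: \<tau>_def mult.assoc) (simp add: mult.assoc)
  then have "(LINT \<rho>|lborel. green \<rho> z w * of_real \<rho> * h (of_real \<rho>)) =
      ?c * (LINT \<rho>|lborel. LINT t|lborel. ?f \<rho> t)"
    by simp
  also have "(LINT \<rho>|lborel. LINT t|lborel. ?f \<rho> t) = (LINT t|lborel. LINT \<rho>|lborel. ?f \<rho> t)"
    using lborel_pair.Fubini_integral[OF int] by simp
  also have "(\<lambda>t. LINT \<rho>|lborel. ?f \<rho> t) = (\<lambda>t. 2 * of_real pi * \<i> * (g' t * of_real (abel_kernel v t)))"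
  proof
    fix t
    have "(LINT \<rho>|lborel. ?f \<rho> t) =
        (LINT \<rho>|lborel. of_real \<rho> * h (of_real \<rho>) * ?e \<rho> t) * of_real (abel_kernel v t)"
      by (rule integral_mult_left_zero)
    also have "(LINT \<rho>|lborel. of_real \<rho> * h (of_real \<rho>) * ?e \<rho> t) = 2 * of_real pi * \<i> * g' t"
      by (simp add: g'_def mult.assoc)
    finally show "(LINT \<rho>|lborel. ?f \<rho> t) = 2 * of_real pi * \<i> * (g' t * of_real (abel_kernel v t))"
      by (simp only: mult.assoc)
  qed
  also have "(LINT t|lborel. 2 * of_real pi * \<i> * (g' t * of_real (abel_kernel v t))) =
      2 * of_real pi * \<i> * (LINT t|lborel. g' t * of_real (abel_kernel v t))"
    by simp
  finally show ?thesis
    unfolding v_def[symmetric]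
    using assms(3) by (simp add: point_pair_invariant_def abel_inverse_def field_simps)
qed

text \<open>With E = 2 sinh (a / 2)^2 one has sqrt (2 E) = 2 sinh (a / 2), the origin of the
  hyperbolic sine in the formula. In the norm estimate the half-line is enlarged to start at 0, so
  that the numerator no longer depends on a.\<close>

lemma integral_abel_inverse_g':
  assumes "0 < a"
  shows "integrable lborel (\<lambda>u. abel_inverse g' (cosh a + 2 * (sinh (a / 2))\<^sup>2 * u\<^sup>2))"
    and "(LINT u|lborel. abel_inverse g' (cosh a + 2 * (sinh (a / 2))\<^sup>2 * u\<^sup>2)) =
      g_transform h a / of_real (2 * sinh (a / 2))"
    and "(LINT u|lborel. norm (abel_inverse g' (cosh a + 2 * (sinh (a / 2))\<^sup>2 * u\<^sup>2))) \<le>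
      (LINT t:{0..}|lborel. norm (g' t)) / (2 * sinh (a / 2))"
proof -
  let ?E = "2 * (sinh (a / 2))\<^sup>2"
  have E: "0 < ?E" using assms by simp
  have sq: "sqrt (2 * ?E) = 2 * sinh (a / 2)"
    using assms by (simp add: real_sqrt_mult)
  have i: "set_integrable lborel {a<..} g'"
    by (rule set_integrable_subset[OF set_integrable_g'[of 0]]) (use assms in auto)
  note sl = abel_inverse_slice[OF assms E i borel_measurable_g']
  show "integrable lborel (\<lambda>u. abel_inverse g' (cosh a + ?E * u\<^sup>2))"
    by (rule sl)
  show "(LINT u|lborel. abel_inverse g' (cosh a + ?E * u\<^sup>2)) = g_transform h a / of_real (2 * sinh (a / 2))"
    unfolding sl(2) sq using assms by (simp add: integral_g')
  have "(LINT t:{a<..}|lborel. norm (g' t)) \<le> (LINT t:{0..}|lborel. norm (g' t))"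
    unfolding set_lebesgue_integral_def
    by (rule integral_mono)
      (use assms set_integrable_norm[OF i] set_integrable_norm[OF set_integrable_g'[of 0]] in
        \<open>auto simp: set_integrable_def indicator_def\<close>)
  then have "1 / (2 * sinh (a / 2)) * (LINT t:{a<..}|lborel. norm (g' t)) \<le>
    1 / (2 * sinh (a / 2)) * (LINT t:{0..}|lborel. norm (g' t))"
    by (rule mult_left_mono) (use assms in auto)
  with sl(3) show "(LINT u|lborel. norm (abel_inverse g' (cosh a + ?E * u\<^sup>2))) \<le>
      (LINT t:{0..}|lborel. norm (g' t)) / (2 * sinh (a / 2))"
    unfolding sq by simp
qed

end

section \<open>Area of the hyperbolic plane\<close>

lemma nn_integral_lborel_shift:
  fixes f :: "real \<Rightarrow> ennreal"
  assumes "f \<in> borel_measurable borel"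
  shows "(\<integral>\<^sup>+x. f (x + c) \<partial>lborel) = (\<integral>\<^sup>+x. f x \<partial>lborel)"
  using nn_integral_real_affine[OF assms, of 1 c] by (simp add: add.commute)

lemma nn_integral_lborel_reflect:
  fixes f :: "real \<Rightarrow> ennreal"
  assumes "f \<in> borel_measurable borel"
  shows "(\<integral>\<^sup>+x. f (c - x) \<partial>lborel) = (\<integral>\<^sup>+x. f x \<partial>lborel)"
  using nn_integral_real_affine[OF assms, of "- 1" c] by simp

text \<open>The imaginary part comes first so that the height is the outer variable of the iterated
  integral, where it can be replaced by its logarithm.\<close>

lemma lborel_complex_eq:
  "lborel = distr (lborel \<Otimes>\<^sub>M lborel) borel (\<lambda>(y, x). Complex x y)"
proof (rule lborel_eqI)
  fix l u :: complex
  assume lu: "\<And>b. b \<in> Basis \<Longrightarrow> l \<bullet> b \<le> u \<bullet> b"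
  have [measurable]: "(\<lambda>(y, x). Complex x y) \<in> borel \<Otimes>\<^sub>M borel \<rightarrow>\<^sub>M borel"
    unfolding Complex_eq by measurable
  have "(\<lambda>(y, x). Complex x y) -` box l u = {Im l<..<Im u} \<times> {Re l<..<Re u}"
    by (auto simp: in_box_complex_iff)
  then show "emeasure (distr (lborel \<Otimes>\<^sub>M lborel) borel (\<lambda>(y, x). Complex x y)) (box l u) =
      (\<Prod>b\<in>Basis. (u - l) \<bullet> b)"
    using lu[of 1] lu[of \<i>]
    by (simp add: emeasure_distr space_pair_measure lborel.emeasure_pair_measure_Times
        Basis_complex_def ennreal_mult mult.commute)
qed simp

lemma nn_integral_lborel_complex:
  fixes f :: "complex \<Rightarrow> ennreal"
  assumes [measurable]: "f \<in> borel_measurable borel"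
  shows "(\<integral>\<^sup>+z. f z \<partial>lborel) = (\<integral>\<^sup>+y. \<integral>\<^sup>+x. f (Complex x y) \<partial>lborel \<partial>lborel)"
proof -
  have [measurable]: "(\<lambda>(y, x). Complex x y) \<in> borel \<Otimes>\<^sub>M borel \<rightarrow>\<^sub>M borel"
    unfolding Complex_eq by measurable
  have "(\<integral>\<^sup>+z. f z \<partial>lborel) = (\<integral>\<^sup>+p. f (case p of (y, x) \<Rightarrow> Complex x y) \<partial>(lborel \<Otimes>\<^sub>M lborel))"
    by (subst lborel_complex_eq, subst nn_integral_distr) (auto simp: case_prod_beta)
  also have "\<dots> = (\<integral>\<^sup>+y. \<integral>\<^sup>+x. f (Complex x y) \<partial>lborel \<partial>lborel)"
    by (subst lborel.nn_integral_fst[symmetric]) (auto simp: case_prod_beta)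
  finally show ?thesis .
qed

text \<open>This is dy / y = ds. Substitution on the compact intervals from exp (- n) to exp n and
  monotone convergence identify the density with the image of Lebesgue measure under exp on Borel
  sets; equality of the two measures then covers every f.\<close>

lemma nn_integral_exp_substitution:
  fixes f :: "real \<Rightarrow> ennreal"
  assumes [measurable]: "f \<in> borel_measurable borel"
  shows "(\<integral>\<^sup>+y. f y * (indicator {0<..} y * ennreal (1 / y)) \<partial>lborel) = (\<integral>\<^sup>+s. f (exp s) \<partial>lborel)"
proof -
  let ?M = "density lborel (\<lambda>y. indicator {0<..} y * ennreal (1 / y))"
  let ?N = "distr lborel borel (exp :: real \<Rightarrow> real)"
  have [measurable]: "(exp :: real \<Rightarrow> real) \<in> borel_measurable borel"
    by (intro borel_measurable_continuous_onI continuous_intros)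
  have ae: "emeasure ?M A = (SUP n. emeasure lborel (exp -` A \<inter> {- real n..real n}))" 
    if [measurable]: "A \<in> sets borel" for A
  proof -
    have "(\<integral>\<^sup>+y. ennreal (indicator A y / y) * indicator {exp (- real n)..exp (real n)} y \<partial>lborel) =
        emeasure lborel (exp -` A \<inter> {- real n..real n})" for n
    proof -
      have "(\<integral>\<^sup>+y. ennreal (indicator A y / y) * indicator {exp (- real n)..exp (real n)} y \<partial>lborel) =
          (\<integral>\<^sup>+y. ennreal (indicator A y / y * indicator {exp (- real n)..exp (real n)} y) \<partial>lborel)"
        by (intro nn_integral_cong) (auto split: split_indicator)
      also have "\<dots> =
          (\<integral>\<^sup>+x. ennreal (indicator A (exp x) / exp x * exp x * indicator {- real n..real n} x) \<partial>lborel)"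
        by (rule nn_integral_substitution[where f = "\<lambda>y. indicator A y / y" and g = exp and g' = exp
              and a = "- real n" and b = "real n"])
          (auto intro!: derivative_eq_intros continuous_intros simp: set_borel_measurable_def)
      also have "\<dots> = (\<integral>\<^sup>+x. indicator (exp -` A \<inter> {- real n..real n}) x \<partial>lborel)"
        by (intro nn_integral_cong) (auto split: split_indicator)
      finally show ?thesis by simp
    qed
    moreover have "emeasure ?M A =
      (SUP n. \<integral>\<^sup>+y. ennreal (indicator A y / y) * indicator {exp (- real n)..exp (real n)} y \<partial>lborel)"
    proof -
      have "incseq (\<lambda>n y. ennreal (indicator A y / y) * indicator {exp (- real n)..exp (real n)} y)"
      proof (intro incseq_SucI le_funI mult_left_mono)
        fix n y
        have "exp (- real (Suc n)) \<le> exp (- real n)" "exp (real n) \<le> exp (real (Suc n))"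
          by simp_all
        then have sub: "{exp (- real n)..exp (real n)} \<subseteq> {exp (- real (Suc n))..exp (real (Suc n))}"
          by (rule atLeastatMost_subset_iff[THEN iffD2, OF disjI2, OF conjI])
        show "(indicator {exp (- real n)..exp (real n)} y :: ennreal) \<le>
            indicator {exp (- real (Suc n))..exp (real (Suc n))} y"
          by (cases "y \<in> {exp (- real n)..exp (real n)}")
            (simp_all only: indicator_simps subsetD[OF sub] zero_le order_refl not_False_eq_True)
      qed simp
      then have "(\<integral>\<^sup>+y. (SUP n. ennreal (indicator A y / y) * indicator {exp (- real n)..exp (real n)} y) \<partial>lborel) =
          (SUP n. \<integral>\<^sup>+y. ennreal (indicator A y / y) * indicator {exp (- real n)..exp (real n)} y \<partial>lborel)"
        by (rule nn_integral_monotone_convergence_SUP) measurable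
      moreover have "(SUP n. ennreal (indicator A y / y) * indicator {exp (- real n)..exp (real n)} y) =
          indicator {0<..} y * ennreal (1 / y) * indicator A y" for y
      proof (cases "0 < y")
        case True
        have "(SUP n. indicator {exp (- real n)..exp (real n)} y :: ennreal) = 1"
        proof (rule antisym)
          define n where "n = nat \<lceil>\<bar>ln y\<bar>\<rceil>"
          have "\<bar>ln y\<bar> \<le> real n" unfolding n_def by linarith
          then have "- real n \<le> ln y" "ln y \<le> real n" by auto
          then have "exp (- real n) \<le> y" "y \<le> exp (real n)"
            using True exp_le_cancel_iff[of "- real n" "ln y"] exp_le_cancel_iff[of "ln y" "real n"]
            by (simp_all del: exp_le_cancel_iff)
          then show "(1::ennreal) \<le> (SUP n. indicator {exp (- real n)..exp (real n)} y)"
            by (intro SUP_upper2[of n]) auto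
        qed (auto intro!: SUP_least split: split_indicator)
        then show ?thesis
          using True by (subst SUP_mult_left_ennreal[symmetric]) (auto split: split_indicator)
      next
        case False
        then have "y < exp (- real n)" for n
          by (intro le_less_trans[of y 0]) auto
        then have "y \<notin> {exp (- real n)..exp (real n)}" for n
          by (simp add: not_le)
        then show ?thesis using False by simp
      qed
      ultimately show ?thesis by (simp add: emeasure_density)
    qed
    ultimately show ?thesis by simp
  qed
  have "?M = ?N"
  proof (rule measure_eqI)
    fix A assume "A \<in> sets ?M"
    then have [measurable]: "A \<in> sets borel" by simp
    have [measurable]: "exp -` A \<in> sets (borel :: real measure)"
      using measurable_sets[of exp borel borel A] by simp
    have "(SUP n. emeasure lborel (exp -` A \<inter> {- real n..real n})) = emeasure lborel (\<Union>n. exp -` A \<inter> {- real n..real n})"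
      by (rule SUP_emeasure_incseq) (auto simp: incseq_def)
    also have "(\<Union>n. exp -` A \<inter> {- real n..real n}) = exp -` A"
    proof -
      have "x \<in> {- real (nat \<lceil>\<bar>x\<bar>\<rceil>)..real (nat \<lceil>\<bar>x\<bar>\<rceil>)}" for x :: real
        by auto linarith+
      then show ?thesis by blast
    qed
    finally show "emeasure ?M A = emeasure ?N A"
      by (simp add: ae emeasure_distr)
  qed simp
  then have "nn_integral ?M f = nn_integral ?N f" by simp
  then show ?thesis
    by (simp add: nn_integral_density nn_integral_distr mult.commute)
qed

text \<open>Here s is the logarithm of the height, and u = Re z / Im z is the hyperbolic sine of the
  signed distance from the imaginary axis, constant along rays from 0.\<close>

definition hyp_coords :: "real \<Rightarrow> real \<Rightarrow> complex" where
  "hyp_coords s u = of_real (exp s) * (of_real u + \<i>)"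

text \<open>Kept apart from \<open>hyp_area\<close> so that invariance can be shown for Borel
  functions in flat coordinates before the completion of the measure comes in.\<close>

definition hyp_nn_integral :: "(complex \<Rightarrow> ennreal) \<Rightarrow> ennreal" where
  "hyp_nn_integral f = (\<integral>\<^sup>+s. \<integral>\<^sup>+u. f (hyp_coords s u) \<partial>lborel \<partial>lborel)"

lemma hyp_coords_in_half_plane [simp]: "hyp_coords s u \<in> half_plane"
  by (simp add: hyp_coords_def half_plane_def)

lemma borel_measurable_hyp_coords [measurable]:
  assumes [measurable]: "s \<in> borel_measurable M" "u \<in> borel_measurable M"
  shows "(\<lambda>p. hyp_coords (s p) (u p)) \<in> borel_measurable M"
  unfolding hyp_coords_def by measurable

lemma half_plane_measurable [measurable]: "half_plane \<in> sets borel"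
  unfolding half_plane_def by measurable

lemma sets_hyp_area: "X \<in> sets hyp_area \<longleftrightarrow> X \<in> sets lebesgue \<and> X \<subseteq> half_plane"
  by (auto simp: hyp_area_def sets_restrict_space_iff half_plane_measurable)

lemma emeasure_hyp_area:
  assumes "X \<in> sets hyp_area"
  shows "emeasure hyp_area X = (\<integral>\<^sup>+z. ennreal (1 / (Im z)\<^sup>2) * indicator X z \<partial>lebesgue)"
proof -
  from assms have X: "X \<in> sets lebesgue" "X \<subseteq> half_plane" by (auto simp: sets_hyp_area)
  have Im: "(\<lambda>z. ennreal (1 / (Im z)\<^sup>2)) \<in> borel_measurable lebesgue"
    by (rule measurable_completion) measurable
  have "emeasure hyp_area X = (\<integral>\<^sup>+z. ennreal (1 / (Im z)\<^sup>2) * indicator X z \<partial>lebesgue_on half_plane)"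
    unfolding hyp_area_def
    using X Im by (intro emeasure_density measurable_restrict_space1)
      (auto simp: sets_restrict_space_iff half_plane_measurable)
  also have "\<dots> = (\<integral>\<^sup>+z. ennreal (1 / (Im z)\<^sup>2) * indicator X z * indicator half_plane z \<partial>lebesgue)"
    by (rule nn_integral_restrict_space) (auto simp: half_plane_measurable)
  also have "\<dots> = (\<integral>\<^sup>+z. ennreal (1 / (Im z)\<^sup>2) * indicator X z \<partial>lebesgue)"
    using X by (intro nn_integral_cong) (auto split: split_indicator)
  finally show ?thesis .
qed

text \<open>On the line of height y the substitution x = y u turns 1 / y^2 into 1 / y, which is
  absorbed by y = exp s.\<close>

lemma emeasure_hyp_area_borel:
  assumes [measurable]: "X \<in> sets borel" and X: "X \<subseteq> half_plane"
  shows "emeasure hyp_area X = hyp_nn_integral (indicator X)"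
proof -
  have "X \<in> sets hyp_area" using assms by (simp add: sets_hyp_area)
  then have "emeasure hyp_area X = (\<integral>\<^sup>+z. ennreal (1 / (Im z)\<^sup>2) * indicator X z \<partial>lborel)"
    by (simp add: emeasure_hyp_area nn_integral_completion)
  also have "\<dots> = (\<integral>\<^sup>+y. \<integral>\<^sup>+x. ennreal (1 / y\<^sup>2) * indicator X (Complex x y) \<partial>lborel \<partial>lborel)"
    by (subst nn_integral_lborel_complex) simp_all
  also have "\<dots> = (\<integral>\<^sup>+y. (\<integral>\<^sup>+u. indicator X (Complex (y * u) y) \<partial>lborel) *
      (indicator {0<..} y * ennreal (1 / y)) \<partial>lborel)"
  proof (rule nn_integral_cong)
    fix y :: real
    have [measurable]: "(\<lambda>x. Complex x y) \<in> borel_measurable borel"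
      unfolding Complex_eq by measurable
    show "(\<integral>\<^sup>+x. ennreal (1 / y\<^sup>2) * indicator X (Complex x y) \<partial>lborel) =
      (\<integral>\<^sup>+u. indicator X (Complex (y * u) y) \<partial>lborel) * (indicator {0<..} y * ennreal (1 / y))"
    proof (cases "0 < y")
      case True
      have "(\<integral>\<^sup>+x. ennreal (1 / y\<^sup>2) * indicator X (Complex x y) \<partial>lborel) =
          ennreal (1 / y\<^sup>2) * (\<integral>\<^sup>+x. indicator X (Complex x y) \<partial>lborel)"
        by (rule nn_integral_cmult) measurable
      also have "(\<integral>\<^sup>+x. indicator X (Complex x y) \<partial>lborel) = ennreal y * (\<integral>\<^sup>+u. indicator X (Complex (y * u) y) \<partial>lborel)"
        using nn_integral_real_affine[of "\<lambda>x. indicator X (Complex x y)" y 0] True by simp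
      also have "ennreal (1 / y\<^sup>2) * (ennreal y * (\<integral>\<^sup>+u. indicator X (Complex (y * u) y) \<partial>lborel)) =
          ennreal (1 / y\<^sup>2 * y) * (\<integral>\<^sup>+u. indicator X (Complex (y * u) y) \<partial>lborel)"
        using True by (subst ennreal_mult) (auto simp: mult.assoc)
      also have "1 / y\<^sup>2 * y = 1 / y" using True by (simp add: power2_eq_square)
      finally show ?thesis using True by (simp add: mult.commute)
    next
      case False
      then have "Complex x y \<notin> X" for x using X by (auto simp: half_plane_def)
      then show ?thesis by simp
    qed
  qed
  also have "\<dots> = (\<integral>\<^sup>+s. \<integral>\<^sup>+u. indicator X (Complex (exp s * u) (exp s)) \<partial>lborel \<partial>lborel)"
    by (subst nn_integral_exp_substitution) (simp_all add: Complex_eq)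
  also have "\<dots> = hyp_nn_integral (indicator X)"
    by (simp add: hyp_nn_integral_def hyp_coords_def Complex_eq algebra_simps)
  finally show ?thesis .
qed

text \<open>The determinant is only kept positive, not normalised to 1, so that conjugating maps and
  inverses can be written without square roots.\<close>

definition moebius :: "real \<Rightarrow> real \<Rightarrow> real \<Rightarrow> real \<Rightarrow> complex \<Rightarrow> complex" where
  "moebius a b c d z = (of_real a * z + of_real b) / (of_real c * z + of_real d)"

lemma borel_measurable_moebius [measurable]: "moebius a b c d \<in> borel_measurable borel"
  unfolding moebius_def by measurable

lemma hyp_nn_integral_cong:
  "(\<And>z. z \<in> half_plane \<Longrightarrow> f z = f' z) \<Longrightarrow> hyp_nn_integral f = hyp_nn_integral f'"
  by (simp add: hyp_nn_integral_def)

text \<open>A horizontal translation fixes s and shifts u by b exp (- s), a constant for the inner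
  integral.\<close>

lemma hyp_nn_integral_translate:
  assumes [measurable]: "f \<in> borel_measurable borel"
  shows "hyp_nn_integral (\<lambda>z. f (z + of_real b)) = hyp_nn_integral f"
proof -
  have "hyp_coords s u + of_real b = hyp_coords s (u + b * exp (- s))" for s u
  proof -
    have "exp (complex_of_real s) * exp (- complex_of_real s) = 1"
      by (simp add: exp_minus)
    then show ?thesis
      by (simp add: hyp_coords_def algebra_simps flip: exp_of_real)
  qed
  moreover have "(\<integral>\<^sup>+u. f (hyp_coords s (u + b * exp (- s))) \<partial>lborel) = (\<integral>\<^sup>+u. f (hyp_coords s u) \<partial>lborel)" for s
    by (rule nn_integral_lborel_shift) measurable
  ultimately show ?thesis
    unfolding hyp_nn_integral_def by simp
qed

lemma hyp_nn_integral_scale: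
  assumes [measurable]: "f \<in> borel_measurable borel" and "0 < a"
  shows "hyp_nn_integral (\<lambda>z. f (of_real a * z)) = hyp_nn_integral f"
proof -
  have "of_real a * hyp_coords s u = hyp_coords (s + ln a) u" for s u
    using \<open>0 < a\<close> by (simp add: hyp_coords_def exp_add mult_ac)
  then show ?thesis
    unfolding hyp_nn_integral_def
    using nn_integral_lborel_shift[of "\<lambda>s. \<integral>\<^sup>+u. f (hyp_coords s u) \<partial>lborel" "ln a"] by simp
qed

text \<open>In coordinates z \<mapsto> - 1 / z reverses u and sends s to - ln (1 + u^2) - s. For
  fixed u this is a reflection in s, so the s-integral has to be moved inside first.\<close>

lemma hyp_nn_integral_inversion:
  assumes [measurable]: "f \<in> borel_measurable borel"
  shows "hyp_nn_integral (\<lambda>z. f (- 1 / z)) = hyp_nn_integral f"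
proof -
  have J: "- 1 / hyp_coords s u = hyp_coords (- ln (1 + u\<^sup>2) - s) (0 - u)" for s u
  proof -
    have pos: "0 < 1 + u\<^sup>2" by (simp add: add_pos_nonneg)
    have ne: "complex_of_real u + \<i> \<noteq> 0" by (simp add: complex_eq_iff)
    have "complex_of_real (exp (- ln (1 + u\<^sup>2) - s)) = 1 / (of_real (exp s) * (1 + (of_real u)\<^sup>2))"
      using pos by (simp add: exp_diff exp_minus field_simps flip: of_real_exp)
    moreover have "1 + (complex_of_real u)\<^sup>2 = (of_real u + \<i>) * (of_real u - \<i>)"
      by (simp add: algebra_simps power2_eq_square)
    moreover have "complex_of_real u - \<i> \<noteq> 0" by (simp add: complex_eq_iff)
    ultimately show ?thesis
      using ne by (simp add: hyp_coords_def divide_simps) (simp add: algebra_simps)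
  qed
  have "hyp_nn_integral (\<lambda>z. f (- 1 / z)) =
      (\<integral>\<^sup>+u. \<integral>\<^sup>+s. f (hyp_coords (- ln (1 + u\<^sup>2) - s) (0 - u)) \<partial>lborel \<partial>lborel)"
    unfolding hyp_nn_integral_def J by (rule lborel_pair.Fubini') measurable
  also have "\<dots> = (\<integral>\<^sup>+u. \<integral>\<^sup>+s. f (hyp_coords s (0 - u)) \<partial>lborel \<partial>lborel)"
    by (intro nn_integral_cong nn_integral_lborel_reflect) measurable
  also have "\<dots> = (\<integral>\<^sup>+u. \<integral>\<^sup>+s. f (hyp_coords s u) \<partial>lborel \<partial>lborel)"
    by (rule nn_integral_lborel_reflect) measurable
  also have "\<dots> = hyp_nn_integral f"
    unfolding hyp_nn_integral_def by (rule lborel_pair.Fubini') measurable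
  finally show ?thesis .
qed

lemma half_plane_denominator:
  assumes "z \<in> half_plane" "a * d - b * c \<noteq> 0"
  shows "of_real c * z + of_real d \<noteq> (0::complex)"
  using assms by (auto simp: complex_eq_iff half_plane_def)

text \<open>For c = 0 the map is affine. Otherwise it equals a / c - e / (z + d / c) with e the
  determinant divided by c^2, a composite of translations, one inversion and a dilation.\<close>

lemma hyp_nn_integral_moebius:
  assumes f [measurable]: "f \<in> borel_measurable borel" and det: "0 < a * d - b * c"
  shows "hyp_nn_integral (\<lambda>z. f (moebius a b c d z)) = hyp_nn_integral f"
proof (cases "c = 0")
  case True
  with det have "0 < a / d" "d \<noteq> 0" by (auto simp: zero_less_mult_iff zero_less_divide_iff)
  have "hyp_nn_integral (\<lambda>z. f (moebius a b c d z)) =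
      hyp_nn_integral (\<lambda>z. f (of_real (a / d) * z + of_real (b / d)))"
    by (simp add: moebius_def True add_divide_distrib)
  also have "\<dots> = hyp_nn_integral (\<lambda>z. f (z + of_real (b / d)))"
    by (rule hyp_nn_integral_scale[of "\<lambda>z. f (z + of_real (b / d))"]) (use \<open>0 < a / d\<close> in auto)
  also have "\<dots> = hyp_nn_integral f"
    by (rule hyp_nn_integral_translate) fact
  finally show ?thesis .
next
  case False
  let ?e = "(a * d - b * c) / c\<^sup>2"
  have "0 < ?e" using det False by simp
  have eq: "moebius a b c d z =
      of_real ?e * (- 1 / (z + of_real (d / c))) + of_real (a / c)" if "z \<in> half_plane" for z
  proof -
    have "of_real c * z + of_real d \<noteq> 0"
      by (rule half_plane_denominator[of z a d b c]) (use that det in auto)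
    moreover have "z + of_real (d / c) = (of_real c * z + of_real d) / of_real c"
      using False by (simp add: add_divide_distrib)
    ultimately show ?thesis
      using False by (simp add: moebius_def divide_simps power2_eq_square) (simp add: algebra_simps)
  qed
  have "hyp_nn_integral (\<lambda>z. f (moebius a b c d z)) =
      hyp_nn_integral (\<lambda>z. f (of_real ?e * (- 1 / (z + of_real (d / c))) + of_real (a / c)))"
    by (rule hyp_nn_integral_cong) (simp only: eq)
  also have "\<dots> = hyp_nn_integral (\<lambda>z. f (of_real ?e * (- 1 / z) + of_real (a / c)))"
    by (rule hyp_nn_integral_translate[of "\<lambda>z. f (of_real ?e * (- 1 / z) + of_real (a / c))"]) measurable
  also have "\<dots> = hyp_nn_integral (\<lambda>z. f (of_real ?e * z + of_real (a / c)))"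
    by (rule hyp_nn_integral_inversion[of "\<lambda>z. f (of_real ?e * z + of_real (a / c))"]) measurable
  also have "\<dots> = hyp_nn_integral (\<lambda>z. f (z + of_real (a / c)))"
    by (rule hyp_nn_integral_scale[of "\<lambda>z. f (z + of_real (a / c))"]) (use \<open>0 < ?e\<close> in auto)
  also have "\<dots> = hyp_nn_integral f"
    by (rule hyp_nn_integral_translate) fact
  finally show ?thesis .
qed

section \<open>Moebius transformations and isometries\<close>

text \<open>Rational in the coordinates and equivalent to the distance for all comparisons, so
  arcosh can be left out of the computations.\<close>

definition hyp_cosh :: "complex \<Rightarrow> complex \<Rightarrow> real" where
  "hyp_cosh z w = 1 + (cmod (z - w))\<^sup>2 / (2 * Im z * Im w)"

lemma hyp_dist_eq: "hyp_dist z w = arcosh (hyp_cosh z w)"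
  by (simp add: hyp_dist_def hyp_cosh_def)

lemma hyp_cosh_ge_1: "z \<in> half_plane \<Longrightarrow> w \<in> half_plane \<Longrightarrow> 1 \<le> hyp_cosh z w"
  by (simp add: hyp_cosh_def half_plane_def)

lemma hyp_dist_nonneg: "z \<in> half_plane \<Longrightarrow> w \<in> half_plane \<Longrightarrow> 0 \<le> hyp_dist z w"
  by (simp add: hyp_dist_eq hyp_cosh_ge_1)

lemma hyp_dist_eq_iff:
  assumes "z \<in> half_plane" "w \<in> half_plane" "z' \<in> half_plane" "w' \<in> half_plane"
  shows "hyp_dist z w = hyp_dist z' w' \<longleftrightarrow> hyp_cosh z w = hyp_cosh z' w'"
  using assms cosh_arcosh_real[OF hyp_cosh_ge_1] by (metis hyp_dist_eq)

section \<open>Invariance of the distance under real Moebius maps\<close>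

lemma moebius_diff:
  assumes "z \<in> half_plane" "w \<in> half_plane" "a * d - b * c \<noteq> 0"
  shows "moebius a b c d z - moebius a b c d w =
    of_real (a * d - b * c) * (z - w) / ((of_real c * z + of_real d) * (of_real c * w + of_real d))"
  using half_plane_denominator[OF assms(1,3)] half_plane_denominator[OF assms(2,3)]
  by (simp add: moebius_def diff_frac_eq) (simp add: algebra_simps)

lemma Im_moebius:
  assumes "z \<in> half_plane" "a * d - b * c \<noteq> 0"
  shows "Im (moebius a b c d z) = (a * d - b * c) * Im z / (cmod (of_real c * z + of_real d))\<^sup>2"
  by (simp add: moebius_def Im_divide cmod_power2) (simp add: algebra_simps)

lemma moebius_in_half_plane:
  assumes "z \<in> half_plane" "0 < a * d - b * c"
  shows "moebius a b c d z \<in> half_plane"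
proof -
  have "0 < cmod (of_real c * z + of_real d)"
    using half_plane_denominator[of z a d b c] assms by simp
  moreover have "0 < Im z" using assms by (simp add: half_plane_def)
  ultimately show ?thesis
    using assms Im_moebius[of z a d b c] by (simp add: half_plane_def)
qed

text \<open>The squared distance |z - w|^2 and the product Im z Im w are both multiplied by D^2 / (p
  q)^2, so the quotient does not change.\<close>

lemma hyp_cosh_moebius:
  assumes z: "z \<in> half_plane" and w: "w \<in> half_plane" and det: "0 < a * d - b * c"
  shows "hyp_cosh (moebius a b c d z) (moebius a b c d w) = hyp_cosh z w"
proof -
  define D where "D = a * d - b * c"
  define p q where "p = cmod (of_real c * z + of_real d)" and "q = cmod (of_real c * w + of_real d)"
  have D: "0 < D" "D \<noteq> 0" using det by (auto simp: D_def)
  have pq: "0 < p" "0 < q"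
    using half_plane_denominator[of z a d b c] half_plane_denominator[of w a d b c] z w det
    by (auto simp: p_def q_def)
  have e1: "cmod (moebius a b c d z - moebius a b c d w) = D * cmod (z - w) / (p * q)"
    using moebius_diff[OF z w D(2)[unfolded D_def]] D(1)
    unfolding D_def[symmetric] p_def q_def by (simp only: norm_mult norm_divide norm_of_real abs_of_pos)
  have e2: "Im (moebius a b c d z) = D * Im z / p\<^sup>2" "Im (moebius a b c d w) = D * Im w / q\<^sup>2"
    using Im_moebius[OF z D(2)[unfolded D_def]] Im_moebius[OF w D(2)[unfolded D_def]]
    unfolding D_def p_def q_def by blast+
  have "0 < Im z" "0 < Im w" using z w by (auto simp: half_plane_def)
  then show ?thesis
    unfolding hyp_cosh_def e1 e2 using D pq by (simp add: field_simps power2_eq_square)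
qed

lemma moebius_compose:
  assumes z: "z \<in> half_plane" and det: "0 < a * d - b * c" "0 < a' * d' - b' * c'"
  shows "moebius a b c d (moebius a' b' c' d' z) =
    moebius (a * a' + b * c') (a * b' + b * d') (c * a' + d * c') (c * b' + d * d') z"
proof -
  have n: "of_real c' * z + of_real d' \<noteq> 0"
    using half_plane_denominator[of z a' d' b' c'] z det by simp
  have "moebius a' b' c' d' z \<in> half_plane"
    by (rule moebius_in_half_plane) fact+
  then have m: "of_real c * moebius a' b' c' d' z + of_real d \<noteq> 0"
    using half_plane_denominator[of _ a d b c] det by simp
  let ?N = "of_real c' * z + of_real d' :: complex" and ?P = "of_real a' * z + of_real b' :: complex"
  have key: "N * (x * (P / N) + y) = x * P + y * N" if "N \<noteq> 0" for N P x y :: complex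
    using that by (simp add: field_simps)
  have "moebius a b c d (moebius a' b' c' d' z) =
      (?N * (of_real a * (?P / ?N) + of_real b)) / (?N * (of_real c * (?P / ?N) + of_real d))"
    using n by (simp add: moebius_def)
  also have "\<dots> = (of_real a * ?P + of_real b * ?N) / (of_real c * ?P + of_real d * ?N)"
    by (simp only: key[OF n])
  also have "of_real a * ?P + of_real b * ?N = of_real (a * a' + b * c') * z + of_real (a * b' + b * d')"
    by (simp add: algebra_simps)
  also have "of_real c * ?P + of_real d * ?N = of_real (c * a' + d * c') * z + of_real (c * b' + d * d')"
    by (simp add: algebra_simps)
  finally show ?thesis by (simp add: moebius_def)
qed

text \<open>The inverse comes from the adjugate matrix: its product with the original is the
  determinant times the identity, which acts trivially.\<close>

lemma moebius_inverse:
  assumes z: "z \<in> half_plane" and det: "0 < a * d - b * c"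
  shows "moebius d (- b) (- c) a (moebius a b c d z) = z"
    and "moebius a b c d (moebius d (- b) (- c) a z) = z"
  using z det
  by (simp_all add: moebius_compose mult.commute) (simp_all add: moebius_def mult.commute flip: of_real_mult of_real_diff)

text \<open>An affine map z \<mapsto> q z + p brings the first point to \<i>. What remains is a
  rotation z \<mapsto> (c z + s) / (- s z + c) about \<i> taking 2 i to the normalised second point
  w, which exists because w lies on the right hyperbolic circle.\<close>

lemma ex_moebius_maps_pair:
  assumes w: "w1 \<in> half_plane" "w2 \<in> half_plane" and eq: "hyp_cosh w1 w2 = hyp_cosh \<i> (2 * \<i>)"
  obtains a b c d where "0 < a * d - b * c" "moebius a b c d \<i> = w1" "moebius a b c d (2 * \<i>) = w2"
proof -
  define p q where "p = Re w1" and "q = Im w1"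
  have q: "0 < q" using w by (simp add: q_def half_plane_def)
  have w1: "w1 = of_real p + \<i> * of_real q" by (simp add: p_def q_def complex_eq_iff)
  define w where "w = (w2 - of_real p) / of_real q"
  have w2: "w2 = of_real q * w + of_real p" using q by (simp add: w_def)
  have Imw: "0 < Im w" using assms(2) q by (simp add: w_def half_plane_def Im_divide_of_real)
  have "(cmod (w1 - w2))\<^sup>2 / (2 * Im w1 * Im w2) = 1 / 4"
  proof -
    have "hyp_cosh \<i> (2 * \<i>) = 1 + 1 / 4"
      by (simp add: hyp_cosh_def cmod_power2)
    with eq have "hyp_cosh w1 w2 = 1 + 1 / 4" by simp
    then show ?thesis unfolding hyp_cosh_def by linarith
  qed
  moreover have "cmod (w1 - w2) = q * cmod (\<i> - w)"
  proof -
    have "w1 - w2 = of_real q * (\<i> - w)" by (simp add: w1 w2 algebra_simps)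
    then show ?thesis using q by (simp add: norm_mult)
  qed
  moreover have "Im w1 = q" "Im w2 = q * Im w" using q by (simp_all add: w1 w2)
  ultimately have "(cmod (\<i> - w))\<^sup>2 = Im w / 2"
    using q Imw by (simp add: power_mult_distrib field_simps power2_eq_square)
  then have circ: "2 * ((Re w)\<^sup>2 + (Im w)\<^sup>2) + 2 = 5 * Im w"
    unfolding cmod_power2 by (simp add: power2_eq_square algebra_simps)
  \<comment> \<open>The equation says that the rotation sends 2 i to w. It is complex with real
    unknowns, hence solvable because \<open>circ\<close> makes the ratio of its two coefficients
    real; w = i / 2 is reached by z \<mapsto> - 1 / z, that is c = 0 and s = 1.\<close>
  have "\<exists>c s. c\<^sup>2 + s\<^sup>2 > 0 \<and> of_real c * (2 * \<i> - w) + of_real s * (1 + 2 * \<i> * w) = 0"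
  proof (cases "1 + 2 * \<i> * w = 0")
    case True
    then show ?thesis by (intro exI[of _ 0] exI[of _ 1]) auto
  next
    case False
    define r where "r = (2 * \<i> - w) / (1 + 2 * \<i> * w)"
    have "Im r = 0"
      using circ by (simp add: r_def Im_divide power2_eq_square algebra_simps)
    then have "r = of_real (Re r)" by (simp add: complex_eq_iff)
    then have "of_real 1 * (2 * \<i> - w) + of_real (- Re r) * (1 + 2 * \<i> * w) = 0"
      using False by (simp add: r_def field_simps)
    then show ?thesis
      by (intro exI[of _ 1] exI[of _ "- Re r"]) (auto simp: add_pos_nonneg)
  qed
  then obtain c s where cs: "c\<^sup>2 + s\<^sup>2 > 0"
      and z: "of_real c * (2 * \<i> - w) + of_real s * (1 + 2 * \<i> * w) = 0" by blast
  \<comment> \<open>The matrix of the rotation followed by z \<mapsto> q z + p.\<close>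
  let ?a = "q * c - p * s" and ?b = "q * s + p * c" and ?c = "- s" and ?d = c
  have "?a * ?d - ?b * ?c = q * (c\<^sup>2 + s\<^sup>2)"
    by (simp add: algebra_simps power2_eq_square)
  then have det: "0 < ?a * ?d - ?b * ?c" using q cs by simp
  have n1: "of_real ?c * \<i> + of_real ?d \<noteq> 0" "of_real ?c * (2 * \<i>) + of_real ?d \<noteq> 0"
    using cs by (auto simp: complex_eq_iff)
  have "moebius ?a ?b ?c ?d \<i> = w1"
    unfolding moebius_def using n1(1) by (subst divide_eq_eq) (simp add: w1 algebra_simps)
  moreover have "moebius ?a ?b ?c ?d (2 * \<i>) = w2"
  proof -
    have "of_real c * (2 * \<i>) + of_real s = w * (of_real ?c * (2 * \<i>) + of_real ?d)"
      using z by (simp add: algebra_simps)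
    then have "of_real q * (of_real c * (2 * \<i>) + of_real s) = of_real q * (w * (of_real ?c * (2 * \<i>) + of_real ?d))"
      by simp
    then show ?thesis
      unfolding moebius_def using n1(2) by (subst divide_eq_eq) (simp add: w2 algebra_simps)
  qed
  ultimately show ?thesis using det that by blast
qed

text \<open>The distances to \<open>\<i>\<close> and \<open>2 * \<i>\<close> determine a point up to reflection in the imaginary axis.\<close>

lemma isometry_fixing_axis_cases:
  assumes maps: "\<And>z. z \<in> half_plane \<Longrightarrow> f z \<in> half_plane"
    and iso: "\<And>z w. z \<in> half_plane \<Longrightarrow> w \<in> half_plane \<Longrightarrow> hyp_cosh (f z) (f w) = hyp_cosh z w"
    and fixed: "f \<i> = \<i>" "f (2 * \<i>) = 2 * \<i>"
  shows "(\<forall>z\<in>half_plane. f z = z) \<or> (\<forall>z\<in>half_plane. f z = - cnj z)"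
proof -
  have in_H: "\<i> \<in> half_plane" "2 * \<i> \<in> half_plane" by (simp_all add: half_plane_def)
  have pt: "f z = z \<or> f z = - cnj z" if z: "z \<in> half_plane" for z
  proof -
    define X Y x y where "X = Re (f z)" and "Y = Im (f z)" and "x = Re z" and "y = Im z"
    have "0 < y" "0 < Y" using z maps[OF z] by (auto simp: half_plane_def Y_def y_def)
    have "(X\<^sup>2 + (Y - 1)\<^sup>2) / (2 * Y) = (x\<^sup>2 + (y - 1)\<^sup>2) / (2 * y)"
      using iso[OF z in_H(1)] unfolding fixed
      by (simp add: hyp_cosh_def cmod_power2 X_def Y_def x_def y_def)
    then have e1: "(X\<^sup>2 + (Y - 1)\<^sup>2) * y = (x\<^sup>2 + (y - 1)\<^sup>2) * Y"
      using \<open>0 < y\<close> \<open>0 < Y\<close> by (simp add: field_simps)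
    have "(X\<^sup>2 + (Y - 2)\<^sup>2) / (4 * Y) = (x\<^sup>2 + (y - 2)\<^sup>2) / (4 * y)"
      using iso[OF z in_H(2)] unfolding fixed
      by (simp add: hyp_cosh_def cmod_power2 X_def Y_def x_def y_def mult_ac)
    then have e2: "(X\<^sup>2 + (Y - 2)\<^sup>2) * y = (x\<^sup>2 + (y - 2)\<^sup>2) * Y"
      using \<open>0 < y\<close> \<open>0 < Y\<close> by (simp add: field_simps)
    \<comment> \<open>In the difference of the two equations all squares cancel, and the mixed term
      Y y occurs equally on both sides.\<close>
    have "3 * Y = 3 * y"
      using e1 e2 by (simp add: power2_eq_square algebra_simps)
    then have "Y = y" by simp
    with e1 \<open>0 < y\<close> have "X\<^sup>2 = x\<^sup>2" by simp
    then have "X = x \<or> X = - x" by (simp add: power2_eq_iff)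
    with \<open>Y = y\<close> show ?thesis by (auto simp: complex_eq_iff X_def Y_def x_def y_def)
  qed
  \<comment> \<open>The choice cannot vary from point to point: reflecting only one of two points
    off the axis changes their distance.\<close>
  show ?thesis
  proof (rule ccontr)
    assume "\<not> ?thesis"
    then obtain z w where zw: "z \<in> half_plane" "f z \<noteq> z" "w \<in> half_plane" "f w \<noteq> - cnj w" by blast
    then have fz: "f z = - cnj z" "f w = w" using pt by blast+
    have "hyp_cosh (- cnj z) w = hyp_cosh z w"
      using iso[OF zw(1,3)] by (simp add: fz)
    then have "(cmod (- cnj z - w))\<^sup>2 = (cmod (z - w))\<^sup>2"
      using zw by (simp add: hyp_cosh_def half_plane_def field_simps)
    then have "Re z * Re w = 0"
      unfolding cmod_power2 by (simp add: power2_eq_square algebra_simps)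
    then have "Re z = 0 \<or> Re w = 0" by simp
    then show False using zw fz by (auto simp: complex_eq_iff)
  qed
qed

lemma field_differentiable_moebius:
  assumes "z \<in> half_plane" "0 < a * d - b * c"
  shows "moebius a b c d field_differentiable (at z)"
proof -
  have "of_real c * z + of_real d \<noteq> 0"
    using half_plane_denominator[of z a d b c] assms by simp
  then show ?thesis
    unfolding moebius_def by (intro derivative_intros field_differentiable_divide) auto
qed

text \<open>A Moebius map agreeing with f at \<i> and 2 i is undone by ?B, and the composite fixes
  both points, so it is the identity or the reflection in the imaginary axis. The reflection is
  excluded by the sign of the Jacobian at \<i>.\<close>

lemma orientation_preserving_isometry_moebius:
  assumes f: "f \<in> hyp_isometries" and orient: "orientation_preserving f"
  shows "\<exists>a b c d. 0 < a * d - b * c \<and> (\<forall>z\<in>half_plane. f z = moebius a b c d z)"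
proof -
  have in_H: "\<i> \<in> half_plane" "2 * \<i> \<in> half_plane" by (simp_all add: half_plane_def)
  have fH: "f z \<in> half_plane" if "z \<in> half_plane" for z
    using f that by (auto simp: hyp_isometries_def Bij_def bij_betw_def)
  have iso: "hyp_cosh (f z) (f w) = hyp_cosh z w" if "z \<in> half_plane" "w \<in> half_plane" for z w
    using f that fH by (subst hyp_dist_eq_iff[symmetric]) (auto simp: hyp_isometries_def)
  obtain a b c d where det: "0 < a * d - b * c"
      and A: "moebius a b c d \<i> = f \<i>" "moebius a b c d (2 * \<i>) = f (2 * \<i>)"
    by (rule ex_moebius_maps_pair[OF fH[OF in_H(1)] fH[OF in_H(2)] iso[OF in_H]])
  let ?B = "moebius d (- b) (- c) a"
  have det': "0 < d * a - (- b) * (- c)" using det by (simp add: mult.commute)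
  have "(\<forall>z\<in>half_plane. ?B (f z) = z) \<or> (\<forall>z\<in>half_plane. ?B (f z) = - cnj z)"
  proof (rule isometry_fixing_axis_cases)
    show "?B (f z) \<in> half_plane" if "z \<in> half_plane" for z
      using that by (intro moebius_in_half_plane fH det')
    show "hyp_cosh (?B (f z)) (?B (f w)) = hyp_cosh z w" if "z \<in> half_plane" "w \<in> half_plane" for z w
      using that by (simp add: hyp_cosh_moebius[OF _ _ det'] fH iso)
    show "?B (f \<i>) = \<i>" "?B (f (2 * \<i>)) = 2 * \<i>"
      using moebius_inverse(1)[OF in_H(1) det] moebius_inverse(1)[OF in_H(2) det] by (simp_all add: A)
  qed
  then show ?thesis
  proof
    assume id: "\<forall>z\<in>half_plane. ?B (f z) = z"
    have "f z = moebius a b c d z" if "z \<in> half_plane" for z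
      using moebius_inverse(2)[OF fH[OF that] det] id that by simp
    then show ?thesis using det by blast
  next
    assume refl: "\<forall>z\<in>half_plane. ?B (f z) = - cnj z"
    obtain D where D: "(f has_derivative D) (at \<i>)" "Im (cnj (D 1) * D \<i>) > 0"
      using orient in_H unfolding orientation_preserving_def by blast
    obtain \<beta> where "(?B has_field_derivative \<beta>) (at (f \<i>))"
      using field_differentiable_moebius[OF fH[OF in_H(1)] det'] by (auto simp: field_differentiable_def)
    then have "(?B has_derivative (*) \<beta>) (at (f \<i>))"
      by (simp add: has_field_derivative_def)
    from has_derivative_compose[OF D(1) this]
    have "((\<lambda>z. ?B (f z)) has_derivative (\<lambda>v. \<beta> * D v)) (at \<i>)" .
    then have "((\<lambda>z. - cnj z) has_derivative (\<lambda>v. \<beta> * D v)) (at \<i>)"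
      by (rule has_derivative_transform_within_open[where s = half_plane])
        (use refl in_H in \<open>auto simp: half_plane_def open_halfspace_Im_gt\<close>)
    moreover have "((\<lambda>z. - cnj z) has_derivative (\<lambda>v. - cnj v)) (at \<i>)"
      by (intro derivative_intros)
    ultimately have "(\<lambda>v. \<beta> * D v) = (\<lambda>v. - cnj v)"
      by (rule has_derivative_unique)
    then have "\<beta> * D 1 = - 1" "\<beta> * D \<i> = \<i>"
      using fun_cong[of _ _ 1] fun_cong[of _ _ \<i>] by fastforce+
    \<comment> \<open>The Jacobian of the composite is |\<beta>|^2 times that of f, hence
      nonnegative, while for the reflection it is - 1.\<close>
    then have "cnj (\<beta> * D 1) * (\<beta> * D \<i>) = - \<i>" by simp
    then have "of_real ((cmod \<beta>)\<^sup>2) * (cnj (D 1) * D \<i>) = - \<i>"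
      unfolding complex_norm_square by (simp add: mult_ac)
    then have "Im (of_real ((cmod \<beta>)\<^sup>2) * (cnj (D 1) * D \<i>)) = - 1" by simp
    then have "(cmod \<beta>)\<^sup>2 * Im (cnj (D 1) * D \<i>) = - 1" by (simp del: of_real_power)
    moreover have "0 \<le> (cmod \<beta>)\<^sup>2 * Im (cnj (D 1) * D \<i>)" using D(2) by simp
    ultimately show ?thesis by simp
  qed
qed

section \<open>Hyperbolic isometries\<close>

text \<open>Since |z|^2 = (Im z)^2 (1 + u^2) with u = Re z / Im z, the displacement term is (cosh t
  - 1) (1 + u^2), and cosh t - 1 = 2 sinh (t / 2)^2.\<close>

lemma hyp_cosh_dilation:
  assumes "z \<in> half_plane"
  shows "hyp_cosh (of_real (exp t) * z) z = cosh t + 2 * (sinh (t / 2))\<^sup>2 * (Re z / Im z)\<^sup>2"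
proof -
  define e where "e = exp t"
  have e: "0 < e" by (simp add: e_def)
  have y: "0 < Im z" using assms by (simp add: half_plane_def)
  have "of_real e * z - z = of_real (e - 1) * z" by (simp add: algebra_simps)
  then have "cmod (of_real e * z - z) = \<bar>e - 1\<bar> * cmod z" by (simp only: norm_mult norm_of_real)
  then have "hyp_cosh (of_real e * z) z = 1 + (e - 1)\<^sup>2 * ((Re z)\<^sup>2 + (Im z)\<^sup>2) / (2 * (e * Im z) * Im z)"
    by (simp add: hyp_cosh_def power_mult_distrib cmod_power2)
  also have "\<dots> = 1 + (e - 1)\<^sup>2 / (2 * e) * (1 + (Re z / Im z)\<^sup>2)"
    using e y by (simp add: field_simps power2_eq_square)
  also have "(e - 1)\<^sup>2 / (2 * e) = cosh t - 1"
    using e by (simp add: cosh_def e_def exp_minus field_simps power2_eq_square)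
  also have "cosh t - 1 = 2 * (sinh (t / 2))\<^sup>2"
    using cosh_double_cosh[of "t / 2"] cosh_square_eq[of "t / 2"] by simp
  finally have "hyp_cosh (of_real e * z) z = 1 + 2 * (sinh (t / 2))\<^sup>2 + 2 * (sinh (t / 2))\<^sup>2 * (Re z / Im z)\<^sup>2"
    by (simp add: algebra_simps)
  moreover have "1 + 2 * (sinh (t / 2))\<^sup>2 = cosh t"
    using cosh_double_cosh[of "t / 2"] cosh_square_eq[of "t / 2"] by simp
  ultimately show ?thesis by (simp add: e_def)
qed

text \<open>The finite fixed points of the map are the zeros of the quadratic polynomial, so a lower
  bound for the displacement becomes a statement about its zeros.\<close>

lemma hyp_cosh_moebius_self:
  assumes z: "z \<in> half_plane" and det: "0 < a * d - b * c"
  shows "hyp_cosh (moebius a b c d z) z =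
    1 + (cmod (of_real c * z\<^sup>2 + of_real (d - a) * z - of_real b))\<^sup>2 / (2 * (a * d - b * c) * (Im z)\<^sup>2)"
proof -
  let ?n = "of_real c * z + of_real d"
  have n: "?n \<noteq> 0" using half_plane_denominator[of z a d b c] assms by simp
  have y: "0 < Im z" using z by (simp add: half_plane_def)
  have Im: "Im (moebius a b c d z) = (a * d - b * c) * Im z / (cmod ?n)\<^sup>2"
    using Im_moebius[of z a d b c] assms by simp
  have "moebius a b c d z - z = - (of_real c * z\<^sup>2 + of_real (d - a) * z - of_real b) / ?n"
    using n by (simp add: moebius_def field_simps power2_eq_square)
  then have "cmod (moebius a b c d z - z) = cmod (of_real c * z\<^sup>2 + of_real (d - a) * z - of_real b) / cmod ?n"
    by (simp only: norm_divide norm_minus_cancel)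
  then show ?thesis
    unfolding hyp_cosh_def Im using n y det by (simp add: power_divide field_simps power2_eq_square)
qed

text \<open>A displacement bounded away from 0 rules out a fixed point in the half-plane and a
  single fixed point on the boundary. Two boundary fixed points remain; sending them to 0 and
  infinity turns the map into a dilation.\<close>

lemma ex_axis_coordinate:
  assumes det: "0 < A * D - B * C" and "0 < \<kappa>"
    and disp: "\<And>z. z \<in> half_plane \<Longrightarrow> 1 + \<kappa> \<le> hyp_cosh (moebius A B C D z) z"
  obtains a d b c \<mu> where "0 < a * d - b * c" "0 < \<mu>" "\<mu> \<noteq> 1"
    "\<And>z. z \<in> half_plane \<Longrightarrow>
      moebius a b c d (moebius A B C D z) = of_real \<mu> * moebius a b c d z"
proof -
  define \<Delta> where "\<Delta> = A * D - B * C"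
  define Q where "Q z = of_real C * z\<^sup>2 + of_real (D - A) * z - of_real B" for z :: complex
  have "0 < \<Delta>" using det by (simp add: \<Delta>_def)
  have disp': "\<kappa> * (2 * \<Delta> * (Im z)\<^sup>2) \<le> (cmod (Q z))\<^sup>2" if "z \<in> half_plane" for z
  proof -
    have "\<kappa> \<le> (cmod (Q z))\<^sup>2 / (2 * \<Delta> * (Im z)\<^sup>2)"
      using disp[OF that] hyp_cosh_moebius_self[OF that det] by (simp add: Q_def \<Delta>_def)
    moreover have "0 < 2 * \<Delta> * (Im z)\<^sup>2"
      using \<open>0 < \<Delta>\<close> that by (simp add: half_plane_def)
    ultimately show ?thesis by (simp add: pos_le_divide_eq)
  qed
  show ?thesis
  proof (cases "C = 0")
    case True
    then have AD: "0 < A * D" using det by simp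
    then have ne: "A \<noteq> 0" "D \<noteq> 0" by auto
    have "A \<noteq> D"
    proof
      assume "A = D"
      \<comment> \<open>For a translation the displacement tends to 0 with growing height; at this
        height the left side of \<open>disp'\<close> is B^2 + 1 and the right side B^2.\<close>
      define y where "y = sqrt ((B\<^sup>2 + 1) / (2 * \<kappa> * \<Delta>))"
      have y2: "y\<^sup>2 = (B\<^sup>2 + 1) / (2 * \<kappa> * \<Delta>)" and "0 < y"
        using \<open>0 < \<kappa>\<close> \<open>0 < \<Delta>\<close> by (auto simp: y_def add_nonneg_pos)
      have "\<kappa> * (2 * \<Delta> * y\<^sup>2) \<le> B\<^sup>2"
        using disp'[of "\<i> * of_real y"] True \<open>A = D\<close> \<open>0 < y\<close> by (simp add: Q_def half_plane_def)
      then show False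
        using \<open>0 < \<kappa>\<close> \<open>0 < \<Delta>\<close> by (simp add: y2)
    qed
    \<comment> \<open>The finite fixed point; the other one is infinity, so a translation suffices
      as coordinate.\<close>
    define p where "p = B / (D - A)"
    have p: "A * p + B = D * p" using \<open>A \<noteq> D\<close> by (simp add: p_def field_simps)
    show ?thesis
    proof (rule that[of 1 1 "- p" 0 "A / D"])
      show "0 < A / D" using AD by (simp add: zero_less_mult_iff zero_less_divide_iff)
      show "A / D \<noteq> 1" using ne \<open>A \<noteq> D\<close> by simp
      fix z
      have "of_real A * of_real p + of_real B = (of_real D * of_real p :: complex)"
        using p by (metis of_real_add of_real_mult)
      then show "moebius 1 (- p) 0 1 (moebius A B C D z) = of_real (A / D) * moebius 1 (- p) 0 1 z"
        using True ne by (simp add: moebius_def field_simps)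
    qed simp
  next
    case False
    \<comment> \<open>Completing the square: m is the midpoint of the two zeros and \<Theta> the
      discriminant of the polynomial.\<close>
    define m where "m = (A - D) / (2 * C)"
    define \<Theta> where "\<Theta> = (D - A)\<^sup>2 + 4 * B * C"
    have Qm: "Q z = of_real C * ((z - of_real m)\<^sup>2 - of_real (\<Theta> / (4 * C\<^sup>2)))" for z
      using False by (simp add: Q_def m_def \<Theta>_def field_simps power2_eq_square)
    have QI: "(cmod (Q (of_real m + \<i> * of_real y)))\<^sup>2 = C\<^sup>2 * (y\<^sup>2 + \<Theta> / (4 * C\<^sup>2))\<^sup>2" for y
    proof -
      have "Q (of_real m + \<i> * of_real y) = of_real (- (C * (y\<^sup>2 + \<Theta> / (4 * C\<^sup>2))))"
        by (simp add: Qm power_mult_distrib algebra_simps)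
      then have "cmod (Q (of_real m + \<i> * of_real y)) = \<bar>C * (y\<^sup>2 + \<Theta> / (4 * C\<^sup>2))\<bar>"
        by (simp only: norm_of_real abs_minus_cancel)
      then show ?thesis by (simp only: power2_abs power_mult_distrib)
    qed
    have disp_m: "\<kappa> * (2 * \<Delta> * y\<^sup>2) \<le> C\<^sup>2 * (y\<^sup>2 + \<Theta> / (4 * C\<^sup>2))\<^sup>2" if "0 < y" for y
      using disp'[of "of_real m + \<i> * of_real y"] that by (simp add: QI half_plane_def)
    have "\<not> \<Theta> < 0"
    proof
      assume "\<Theta> < 0"
      \<comment> \<open>Then m + i y is a zero of Q, a fixed point in the half-plane.\<close>
      define y where "y = sqrt (- \<Theta> / (4 * C\<^sup>2))"
      have "0 < - \<Theta> / (4 * C\<^sup>2)" using \<open>\<Theta> < 0\<close> False by (intro divide_pos_pos) auto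
      then have "0 < y" "y\<^sup>2 = - \<Theta> / (4 * C\<^sup>2)" by (simp_all add: y_def)
      then have "y\<^sup>2 + \<Theta> / (4 * C\<^sup>2) = 0" by simp
      then have "\<kappa> * (2 * \<Delta> * y\<^sup>2) \<le> 0"
        using disp_m[OF \<open>0 < y\<close>] by (simp only: power_zero_numeral mult_zero_right)
      moreover have "0 < \<kappa> * (2 * \<Delta> * y\<^sup>2)"
        using \<open>0 < \<kappa>\<close> \<open>0 < \<Delta>\<close> \<open>0 < y\<close> by simp
      ultimately show False by linarith
    qed
    moreover have "\<Theta> \<noteq> 0"
    proof
      assume "\<Theta> = 0"
      \<comment> \<open>Above a double zero |Q|^2 = C^2 y^4; with C^2 y^2 = \<kappa> \<Delta> the
        inequality would read 2 \<le> 1 up to a positive factor.\<close>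
      define y where "y = sqrt (\<kappa> * \<Delta>) / \<bar>C\<bar>"
      have y2: "C\<^sup>2 * y\<^sup>2 = \<kappa> * \<Delta>" and "0 < y"
        using \<open>0 < \<kappa>\<close> \<open>0 < \<Delta>\<close> False by (auto simp: y_def power_divide)
      have "\<kappa> * (2 * \<Delta> * y\<^sup>2) \<le> (C\<^sup>2 * y\<^sup>2) * y\<^sup>2"
        using disp_m[OF \<open>0 < y\<close>] \<open>\<Theta> = 0\<close> by (simp add: power2_eq_square mult_ac)
      then have "2 * (\<kappa> * \<Delta> * y\<^sup>2) \<le> \<kappa> * \<Delta> * y\<^sup>2"
        unfolding y2 by (simp add: mult_ac)
      moreover have "0 < \<kappa> * \<Delta> * y\<^sup>2" using \<open>0 < \<kappa>\<close> \<open>0 < \<Delta>\<close> \<open>0 < y\<close> by simp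
      ultimately show False by linarith
    qed
    ultimately have "0 < \<Theta>" by linarith
    define e where "e = sqrt \<Theta> / (2 * \<bar>C\<bar>)"
    have "0 < e" and e2: "e\<^sup>2 = \<Theta> / (4 * C\<^sup>2)"
      using \<open>0 < \<Theta>\<close> False by (auto simp: e_def power_divide power_mult_distrib)
    have root: "moebius A B C D z - of_real x = of_real (A - C * x) * (z - of_real x) / (of_real C * z + of_real D)"
      if z: "z \<in> half_plane" and "x = m + e \<or> x = m - e" for x z
    proof -
      have "(x - m)\<^sup>2 = e\<^sup>2" using that(2) by auto
      then have "Q (of_real x) = 0"
        by (simp add: Qm flip: e2 of_real_diff of_real_power)
      then have "of_real B = of_real C * (of_real x)\<^sup>2 + of_real (D - A) * (of_real x :: complex)"
        by (simp add: Q_def)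
      moreover have "of_real C * z + of_real D \<noteq> 0"
        using half_plane_denominator[of z A D B C] z det by simp
      ultimately show ?thesis
        by (simp add: moebius_def field_simps power2_eq_square)
    qed
    define p q where "p = m - e" and "q = m + e"
    have pq: "p < q" using \<open>0 < e\<close> by (simp add: p_def q_def)
    have H: "moebius A B C D z \<in> half_plane" if "z \<in> half_plane" for z
      by (rule moebius_in_half_plane) fact+
    have ii: "\<i> \<in> half_plane" by (simp add: half_plane_def)
    have nr: "z \<noteq> of_real x" if "z \<in> half_plane" for z x
      using that by (auto simp: half_plane_def)
    \<comment> \<open>Otherwise the map would be constant with the real value p.\<close>
    have Ap: "A - C * p \<noteq> 0"
    proof
      assume "A - C * p = 0"
      then have "moebius A B C D \<i> = of_real p"
        using root[OF ii, of p] by (simp add: p_def)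
      then show False using nr[OF H[OF ii]] by blast
    qed
    define \<mu> where "\<mu> = (A - C * q) / (A - C * p)"
    have conj: "moebius 1 (- q) 1 (- p) (moebius A B C D z) = of_real \<mu> * moebius 1 (- q) 1 (- p) z"
      if "z \<in> half_plane" for z
    proof -
      let ?n = "of_real C * z + of_real D"
      have n: "?n \<noteq> 0" using half_plane_denominator[of z A D B C] that det by simp
      have "moebius 1 (- q) 1 (- p) (moebius A B C D z) =
          (moebius A B C D z - of_real q) / (moebius A B C D z - of_real p)"
        by (simp add: moebius_def[of 1])
      also have "\<dots> = (of_real (A - C * q) * (z - of_real q) / ?n) / (of_real (A - C * p) * (z - of_real p) / ?n)"
        using root[OF that, of p] root[OF that, of q] by (simp add: p_def q_def)
      also have "\<dots> = of_real (A - C * q) / of_real (A - C * p) * ((z - of_real q) / (z - of_real p))"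
        using n by simp
      also have "\<dots> = of_real \<mu> * moebius 1 (- q) 1 (- p) z"
        by (simp add: moebius_def \<mu>_def)
      finally show ?thesis .
    qed
    \<comment> \<open>The larger fixed point q goes to 0 and p to infinity; this order makes the
      determinant q - p positive.\<close>
    have det1: "0 < 1 * (- p) - (- q) * (1::real)" using pq by simp
    show ?thesis
    proof (rule that[OF det1 _ _ conj])
      have "0 < Im (moebius 1 (- q) 1 (- p) (moebius A B C D \<i>))"
        using moebius_in_half_plane[OF H[OF ii] det1] by (simp add: half_plane_def)
      also have "\<dots> = \<mu> * Im (moebius 1 (- q) 1 (- p) \<i>)"
        by (simp add: conj[OF ii])
      finally show "0 < \<mu>"
        using moebius_in_half_plane[OF ii det1] by (simp add: half_plane_def zero_less_mult_iff)
      show "\<mu> \<noteq> 1"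
        using Ap pq False by (simp add: \<mu>_def)
    qed
  qed
qed

text \<open>The infimum defining the length bounds the displacement from below, which gives an axis
  coordinate with some multiplier. The multiplier is made larger than 1, and its logarithm is
  identified with the length because the minimal displacement is attained on the axis.\<close>

lemma hyperbolic_isometry_normal_form:
  assumes "hyperbolic_isometry \<gamma>"
  obtains a b c d where "0 < a * d - b * c"
    "\<And>z. z \<in> half_plane \<Longrightarrow>
      moebius a b c d (\<gamma> z) = of_real (exp (isometry_length \<gamma>)) * moebius a b c d z"
proof -
  let ?l = "isometry_length \<gamma>"
  have iso: "\<gamma> \<in> hyp_isometries" and orient: "orientation_preserving \<gamma>" and pos: "0 < ?l"
    using assms by (auto simp: hyperbolic_isometry_def)
  obtain A B C D where det: "0 < A * D - B * C"
      and \<gamma>: "\<And>z. z \<in> half_plane \<Longrightarrow> \<gamma> z = moebius A B C D z"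
    using orientation_preserving_isometry_moebius[OF iso orient] by blast
  have H: "\<gamma> z \<in> half_plane" if "z \<in> half_plane" for z
    using moebius_in_half_plane[OF that det] that by (simp add: \<gamma>)
  have "bdd_below ((\<lambda>z. hyp_dist (\<gamma> z) z) ` half_plane)"
    by (rule bdd_belowI2[of _ 0]) (simp add: hyp_dist_nonneg H)
  then have len: "?l \<le> hyp_dist (\<gamma> z) z" if "z \<in> half_plane" for z
    unfolding isometry_length_def using that by (rule cINF_lower)
  have disp: "1 + (cosh ?l - 1) \<le> hyp_cosh (moebius A B C D z) z" if "z \<in> half_plane" for z
  proof -
    have "cosh ?l \<le> cosh (hyp_dist (\<gamma> z) z)"
      using len[OF that] pos by (subst cosh_real_nonneg_le_iff) (auto simp: hyp_dist_nonneg H that)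
    also have "\<dots> = hyp_cosh (\<gamma> z) z"
      by (simp add: hyp_dist_eq hyp_cosh_ge_1 H that)
    finally show ?thesis by (simp add: \<gamma> that)
  qed
  have \<kappa>: "0 < cosh ?l - 1"
    using pos cosh_real_strict_mono[of 0 ?l] by simp
  obtain a d b c \<mu> where m: "0 < a * d - b * c" "0 < \<mu>" "\<mu> \<noteq> 1" and
      "\<And>z. z \<in> half_plane \<Longrightarrow>
        moebius a b c d (moebius A B C D z) = of_real \<mu> * moebius a b c d z"
    by (rule ex_axis_coordinate[OF det \<kappa>]) (erule disp, rule that, assumption, assumption, assumption, simp)
  then have conj0: "moebius a b c d (\<gamma> z) = of_real \<mu> * moebius a b c d z" if "z \<in> half_plane" for z
    using that by (simp add: \<gamma>)
  have "\<exists>a b c d \<mu>. 0 < a * d - b * c \<and> 1 < \<mu> \<and>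
      (\<forall>z\<in>half_plane. moebius a b c d (\<gamma> z) = of_real \<mu> * moebius a b c d z)"
  proof (cases "1 < \<mu>")
    case True
    then show ?thesis using m(1) conj0 by blast
  next
    case False
    \<comment> \<open>Following the coordinate by z \<mapsto> - 1 / z exchanges 0 and infinity and
      so inverts the multiplier.\<close>
    have neg_inv: "moebius (- c) (- d) a b z = - 1 / moebius a b c d z" for z
      by (simp add: moebius_def minus_divide_left)
    have "moebius (- c) (- d) a b (\<gamma> z) = of_real (1 / \<mu>) * moebius (- c) (- d) a b z"
      if "z \<in> half_plane" for z
      using conj0[OF that] by (simp add: neg_inv)
    moreover have "0 < (- c) * b - (- d) * a" using m(1) by (simp add: algebra_simps)
    moreover have "1 < 1 / \<mu>" using m False by simp
    ultimately show ?thesis by blast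
  qed
  then obtain a b c d \<mu> where det1: "0 < a * d - b * c" and "1 < \<mu>"
      and conj: "\<And>z. z \<in> half_plane \<Longrightarrow> moebius a b c d (\<gamma> z) = of_real \<mu> * moebius a b c d z"
    by blast
  let ?m = "moebius a b c d"
  define L where "L = ln \<mu>"
  have L: "0 < L" "\<mu> = exp L" using \<open>1 < \<mu>\<close> by (simp_all add: L_def)
  have dist: "hyp_dist (\<gamma> z) z = arcosh (cosh L + 2 * (sinh (L / 2))\<^sup>2 * (Re (?m z) / Im (?m z))\<^sup>2)"
    if z: "z \<in> half_plane" for z
    using hyp_cosh_moebius[OF H[OF z] z det1] hyp_cosh_dilation[OF moebius_in_half_plane[OF z det1], of L]
    by (simp add: hyp_dist_eq conj[OF z] L(2))
  have "?l = L"
    unfolding isometry_length_def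
  proof (rule cInf_eq_minimum)
    \<comment> \<open>The point sent to \<i> lies on the axis, where the term with Re / Im
      vanishes.\<close>
    let ?z = "moebius d (- b) (- c) a \<i>"
    have ii: "\<i> \<in> half_plane" by (simp add: half_plane_def)
    have z: "?z \<in> half_plane"
      using det1 by (intro moebius_in_half_plane ii) (simp add: mult.commute)
    have "?m ?z = \<i>" using moebius_inverse(2)[OF ii det1] .
    then have "hyp_dist (\<gamma> ?z) ?z = L"
      using dist[OF z] L by (simp add: arcosh_cosh_real)
    then show "L \<in> (\<lambda>z. hyp_dist (\<gamma> z) z) ` half_plane" using z by force
    fix x assume "x \<in> (\<lambda>z. hyp_dist (\<gamma> z) z) ` half_plane"
    then obtain z where z: "z \<in> half_plane" "x = hyp_dist (\<gamma> z) z" by blast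
    let ?v = "cosh L + 2 * (sinh (L / 2))\<^sup>2 * (Re (?m z) / Im (?m z))\<^sup>2"
    have "cosh L \<le> ?v" by simp
    moreover have "1 \<le> cosh L" by (rule cosh_real_ge_1)
    ultimately have "arcosh (cosh L) \<le> arcosh ?v"
      using arcosh_less_iff_real[of ?v "cosh L"] by linarith
    then show "L \<le> x" using L by (simp add: arcosh_cosh_real z dist)
  qed
  then show ?thesis using that det1 conj L by simp
qed

section \<open>Fundamental domains of a cyclic hyperbolic group\<close>

text \<open>Preimages compose and respect set operations without injectivity. They are cut down to
  the half-plane because T is arbitrary outside it.\<close>

definition hyp_preserving :: "(complex \<Rightarrow> complex) \<Rightarrow> bool" where
  "hyp_preserving T \<longleftrightarrow> (\<forall>z\<in>half_plane. T z \<in> half_plane) \<and>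
     (\<forall>X\<in>sets hyp_area. T -` X \<inter> half_plane \<in> sets hyp_area \<and>
       emeasure hyp_area (T -` X \<inter> half_plane) = emeasure hyp_area X)"

lemma hyp_preserving_cong:
  assumes "hyp_preserving S" "\<And>z. z \<in> half_plane \<Longrightarrow> S z = T z"
  shows "hyp_preserving T"
proof -
  have "S -` X \<inter> half_plane = T -` X \<inter> half_plane" for X
    using assms(2) by auto
  then show ?thesis
    using assms by (simp add: hyp_preserving_def)
qed

lemma hyp_preserving_compose:
  assumes S: "hyp_preserving S" and T: "hyp_preserving T"
  shows "hyp_preserving (\<lambda>z. S (T z))"
proof -
  have "(\<lambda>z. S (T z)) -` X \<inter> half_plane = T -` (S -` X \<inter> half_plane) \<inter> half_plane" for X
    using T by (auto simp: hyp_preserving_def)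
  then show ?thesis
    using S T by (simp add: hyp_preserving_def del: vimage_Int)
qed

section \<open>Null sets, and Moebius maps on the completed area measure\<close>

lemma null_sets_hyp_areaI:
  assumes "X \<in> null_sets lebesgue" "X \<subseteq> half_plane"
  shows "X \<in> null_sets hyp_area"
proof
  show X: "X \<in> sets hyp_area"
    using assms by (auto simp: sets_hyp_area)
  show "emeasure hyp_area X = 0"
    unfolding emeasure_hyp_area[OF X] by (rule nn_integral_null_set) fact
qed

lemma null_sets_hyp_areaD:
  assumes "X \<in> sets borel" "X \<subseteq> half_plane" "emeasure hyp_area X = 0"
  shows "X \<in> null_sets lborel"
proof -
  have X: "X \<in> sets hyp_area" using assms by (simp add: sets_hyp_area)
  have [measurable]: "X \<in> sets borel" by fact
  have "(\<integral>\<^sup>+z. ennreal (1 / (Im z)\<^sup>2) * indicator X z \<partial>lborel) = 0"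
    using assms(3) by (simp add: emeasure_hyp_area[OF X] nn_integral_completion)
  then have "AE z in lborel. ennreal (1 / (Im z)\<^sup>2) * indicator X z = 0"
    by (subst (asm) nn_integral_0_iff_AE) measurable
  then have "AE z in lborel. z \<notin> X"
    by eventually_elim (use assms(2) in \<open>auto simp: half_plane_def split: split_indicator_asm\<close>)
  then show ?thesis
    using assms(1) by (subst AE_iff_null_sets) auto
qed

text \<open>For Borel sets this is the invariance of the coordinate integral. A set of the completed
  measure is a Borel set together with a subset of a Borel null set; the preimage of the latter is
  again null, and completeness takes care of the subset.\<close>

lemma hyp_preserving_moebius:
  assumes det: "0 < a * d - b * c"
  shows "hyp_preserving (moebius a b c d)"
  unfolding hyp_preserving_def
proof (intro conjI ballI)
  let ?T = "moebius a b c d"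
  show H: "?T z \<in> half_plane" if "z \<in> half_plane" for z
    using that det by (rule moebius_in_half_plane)
  have borel: "?T -` Y \<inter> half_plane \<in> sets borel"
      "emeasure hyp_area (?T -` Y \<inter> half_plane) = emeasure hyp_area Y"
    if Y [measurable]: "Y \<in> sets borel" and "Y \<subseteq> half_plane" for Y
  proof -
    show B: "?T -` Y \<inter> half_plane \<in> sets borel"
      using measurable_sets_borel[OF borel_measurable_moebius Y] by (auto simp: half_plane_measurable)
    have "emeasure hyp_area (?T -` Y \<inter> half_plane) = hyp_nn_integral (indicator (?T -` Y \<inter> half_plane))"
      by (rule emeasure_hyp_area_borel[OF B]) simp
    also have "\<dots> = hyp_nn_integral (\<lambda>z. indicator Y (?T z))"
      by (rule hyp_nn_integral_cong) (auto split: split_indicator)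
    also have "\<dots> = hyp_nn_integral (indicator Y)"
      by (rule hyp_nn_integral_moebius) (use det in auto)
    also have "\<dots> = emeasure hyp_area Y"
      by (rule emeasure_hyp_area_borel[symmetric]) fact+
    finally show "emeasure hyp_area (?T -` Y \<inter> half_plane) = emeasure hyp_area Y" .
  qed
  fix X assume "X \<in> sets hyp_area"
  then have X: "X \<in> sets (completion lborel)" "X \<subseteq> half_plane"
    by (auto simp: sets_hyp_area)
  from X(1) obtain S N N' where SN: "X = S \<union> N" "N \<subseteq> N'" "N' \<in> null_sets lborel" "S \<in> sets lborel"
    by (rule sets_completionE)
  then have S: "S \<in> sets borel" "S \<subseteq> half_plane" using X by auto
  let ?N = "N' \<inter> half_plane"
  have N: "?N \<in> sets borel" "?N \<subseteq> half_plane" "N \<subseteq> ?N"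
    using SN X by (auto simp: half_plane_measurable)
  have "?N \<in> null_sets lborel"
    using SN(3) N(1) by (auto intro: null_sets_subset)
  then have N0: "?N \<in> null_sets hyp_area"
    by (intro null_sets_hyp_areaI null_sets_completionI) auto
  then have "emeasure hyp_area (?T -` ?N \<inter> half_plane) = 0"
    using borel(2)[OF N(1,2)] by auto
  then have "?T -` ?N \<inter> half_plane \<in> null_sets lebesgue"
    by (intro null_sets_completionI null_sets_hyp_areaD borel(1) N) auto
  then have "?T -` N \<inter> half_plane \<in> null_sets lebesgue"
    by (rule null_sets_completion_subset[rotated]) (use N in auto)
  then have TN: "?T -` N \<inter> half_plane \<in> null_sets hyp_area"
    by (rule null_sets_hyp_areaI) auto
  have TS: "?T -` S \<inter> half_plane \<in> sets hyp_area"
    using borel(1)[OF S] by (auto simp: sets_hyp_area)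
  have TX: "?T -` X \<inter> half_plane = (?T -` S \<inter> half_plane) \<union> (?T -` N \<inter> half_plane)"
    using SN by auto
  show "?T -` X \<inter> half_plane \<in> sets hyp_area"
    unfolding TX using TS TN by auto
  have "N \<in> null_sets hyp_area"
  proof (rule null_sets_hyp_areaI)
    show "N \<in> null_sets lebesgue"
      using SN by (intro null_sets_completion_subset[OF SN(2)] null_sets_completionI)
    show "N \<subseteq> half_plane" using N by auto
  qed
  then have "emeasure hyp_area X = emeasure hyp_area S"
    unfolding SN(1) using S by (intro emeasure_Un_null_set) (auto simp: sets_hyp_area)
  moreover have "emeasure hyp_area (?T -` X \<inter> half_plane) = emeasure hyp_area (?T -` S \<inter> half_plane)"
    unfolding TX by (rule emeasure_Un_null_set[OF TS TN])
  ultimately show "emeasure hyp_area (?T -` X \<inter> half_plane) = emeasure hyp_area X"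
    using borel(2)[OF S] by simp
qed

section \<open>The cyclic group in its axis coordinate\<close>

locale axis_coordinate =
  fixes \<gamma> :: "complex \<Rightarrow> complex" and l a b c d :: real
  assumes bij: "\<gamma> \<in> Bij half_plane"
    and l_pos: "0 < l"
    and det: "0 < a * d - b * c"
    and conj: "\<And>z. z \<in> half_plane \<Longrightarrow> moebius a b c d (\<gamma> z) = of_real (exp l) * moebius a b c d z"
begin

abbreviation m :: "complex \<Rightarrow> complex" where "m \<equiv> moebius a b c d"
abbreviation m' :: "complex \<Rightarrow> complex" where "m' \<equiv> moebius d (- b) (- c) a"

lemma det': "0 < d * a - (- b) * (- c)"
  using det by (simp add: mult.commute)

lemma m_in: "z \<in> half_plane \<Longrightarrow> m z \<in> half_plane"
  using det by (rule moebius_in_half_plane[rotated])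

lemma m'_m: "z \<in> half_plane \<Longrightarrow> m' (m z) = z"
  using det by (rule moebius_inverse(1)[rotated])

lemma iso_pow_step:
  assumes "z \<in> half_plane"
  shows "iso_pow \<gamma> (n + 1) z = iso_pow \<gamma> n (\<gamma> z)"
proof -
  interpret group "BijGroup half_plane" by (rule group_BijGroup)
  have carrier_eq: "carrier (BijGroup half_plane) = Bij half_plane"
    by (simp add: BijGroup_def)
  have carrier: "\<gamma> \<in> carrier (BijGroup half_plane)"
    using bij by (simp only: carrier_eq)
  have "iso_pow \<gamma> n \<in> carrier (BijGroup half_plane)"
    unfolding iso_pow_def by (rule int_pow_closed[OF carrier])
  then have n: "iso_pow \<gamma> n \<in> Bij half_plane"
    by (simp only: carrier_eq)
  have "iso_pow \<gamma> (n + 1) = iso_pow \<gamma> n \<otimes>\<^bsub>BijGroup half_plane\<^esub> \<gamma>"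
    unfolding iso_pow_def int_pow_mult[OF carrier] int_pow_1[OF carrier] ..
  also have "\<dots> = compose half_plane (iso_pow \<gamma> n) \<gamma>"
    using n bij by (simp add: BijGroup_def)
  finally show ?thesis
    using assms by (simp add: compose_def)
qed

lemma m_iso_pow:
  assumes "z \<in> half_plane"
  shows "iso_pow \<gamma> n z \<in> half_plane \<and> m (iso_pow \<gamma> n z) = of_real (exp (of_int n * l)) * m z"
  using assms
proof (induction n arbitrary: z rule: int_induct[where k = 0])
  case base
  then show ?case by (simp add: iso_pow_def BijGroup_def)
next
  case (step1 n)
  have "\<gamma> z \<in> half_plane"
    using bij step1.prems by (auto simp: Bij_def bij_betw_def)
  then have IH: "iso_pow \<gamma> n (\<gamma> z) \<in> half_plane"
      "m (iso_pow \<gamma> n (\<gamma> z)) = of_real (exp (of_int n * l)) * m (\<gamma> z)"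
    using step1.IH by blast+
  have "exp (of_int (n + 1) * l) = exp (of_int n * l) * exp l"
    by (simp add: exp_add distrib_right)
  then show ?case
    using IH unfolding iso_pow_step[OF step1.prems] conj[OF step1.prems] by simp
next
  case (step2 n)
  \<comment> \<open>Downwards, z is replaced by its preimage w under \<gamma>: the power n - 1 at z
    is the power n at w, to which the induction hypothesis applies.\<close>
  have "z \<in> \<gamma> ` half_plane"
    using bij step2.prems by (simp add: Bij_def bij_betw_def)
  then obtain w where w: "w \<in> half_plane" "\<gamma> w = z" by blast
  have "iso_pow \<gamma> (n - 1) z = iso_pow \<gamma> n w"
    using iso_pow_step[OF w(1), of "n - 1"] w(2) by simp
  with step2.IH[OF w(1)] show ?case
    using conj[OF w(1)] w(2)
    by (simp add: left_diff_distrib exp_diff)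
qed

lemma iso_pow_in: "z \<in> half_plane \<Longrightarrow> iso_pow \<gamma> n z \<in> half_plane"
  using m_iso_pow by blast

lemma iso_pow_eq:
  assumes "z \<in> half_plane"
  shows "iso_pow \<gamma> n z = m' (of_real (exp (of_int n * l)) * m z)"
  using m'_m[of "iso_pow \<gamma> n z"] m_iso_pow[OF assms, of n] by simp

lemma iso_pow_iso_pow:
  assumes "z \<in> half_plane"
  shows "iso_pow \<gamma> n (iso_pow \<gamma> k z) = iso_pow \<gamma> (n + k) z"
proof -
  have "m (iso_pow \<gamma> n (iso_pow \<gamma> k z)) = m (iso_pow \<gamma> (n + k) z)"
    using assms by (simp add: m_iso_pow iso_pow_in exp_add distrib_right)
  then show ?thesis
    using m'_m assms by (metis iso_pow_in)
qed

lemma iso_pow_0: "z \<in> half_plane \<Longrightarrow> iso_pow \<gamma> 0 z = z"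
  by (simp add: iso_pow_def BijGroup_def)

text \<open>The overlap condition on a fundamental domain speaks of distinct group elements; this
  makes it available for distinct exponents.\<close>

lemma iso_pow_inj: "iso_pow \<gamma> i = iso_pow \<gamma> j \<longleftrightarrow> i = j"
proof
  assume eq: "iso_pow \<gamma> i = iso_pow \<gamma> j"
  have ii: "\<i> \<in> half_plane" by (simp add: half_plane_def)
  have ne: "m \<i> \<noteq> 0" using m_in[OF ii] by (auto simp: half_plane_def)
  have "of_real (exp (of_int i * l)) * m \<i> = of_real (exp (of_int j * l)) * m \<i>"
    using eq m_iso_pow[OF ii] by metis
  then have "complex_of_real (exp (of_int i * l)) = of_real (exp (of_int j * l))"
    by (rule iffD1[OF mult_right_cancel[OF ne]])
  then have "exp (of_int i * l) = exp (of_int j * l)"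
    by (rule of_real_eq_iff[THEN iffD1])
  then show "i = j" using l_pos by simp
qed simp

lemma hyp_preserving_iso_pow: "hyp_preserving (iso_pow \<gamma> n)"
proof (rule hyp_preserving_cong)
  let ?e = "exp (of_int n * l)"
  have "hyp_preserving (moebius ?e 0 0 1)"
    by (rule hyp_preserving_moebius) simp
  then have "hyp_preserving (\<lambda>z. moebius ?e 0 0 1 (m z))"
    using hyp_preserving_moebius[OF det]
    by (rule hyp_preserving_compose[where S = "moebius ?e 0 0 1" and T = m])
  with hyp_preserving_moebius[OF det'] show "hyp_preserving (\<lambda>z. m' (moebius ?e 0 0 1 (m z)))"
    by (rule hyp_preserving_compose[where S = m' and T = "\<lambda>z. moebius ?e 0 0 1 (m z)"])
  show "m' (moebius ?e 0 0 1 (m z)) = iso_pow \<gamma> n z" if "z \<in> half_plane" for z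
    unfolding iso_pow_eq[OF that] by (simp add: moebius_def[of "exp _"])
qed

text \<open>The coordinate u of \<open>m z\<close>. It is constant on orbits, hence a function on
  the quotient.\<close>

definition U :: "complex \<Rightarrow> real" where
  "U z = Re (m z) / Im (m z)"

lemma borel_measurable_U [measurable]: "U \<in> borel_measurable borel"
  unfolding U_def by measurable

lemma U_iso_pow: "z \<in> half_plane \<Longrightarrow> U (iso_pow \<gamma> n z) = U z"
  by (simp add: U_def m_iso_pow)

text \<open>The region where the coordinate s of \<open>m z\<close> lies between n l and (n + 1) l.
  Half-open strips partition the half-plane exactly, so all null sets come from F.\<close>

definition strip :: "int \<Rightarrow> complex set" where
  "strip n = {z \<in> half_plane. of_int n * l \<le> ln (Im (m z)) \<and> ln (Im (m z)) < (of_int n + 1) * l}"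

lemma strip_borel [measurable]: "strip n \<in> sets borel"
proof -
  have "strip n = half_plane \<inter> {z. of_int n * l \<le> ln (Im (m z)) \<and> ln (Im (m z)) < (of_int n + 1) * l}"
    by (auto simp: strip_def)
  also have "\<dots> \<in> sets borel" by measurable
  finally show ?thesis .
qed

lemma strip_iff_floor: "z \<in> strip n \<longleftrightarrow> z \<in> half_plane \<and> \<lfloor>ln (Im (m z)) / l\<rfloor> = n"
  using l_pos by (simp add: strip_def floor_eq_iff pos_le_divide_eq pos_divide_less_eq)

lemma disjoint_strip: "disjoint_family strip"
  by (auto simp: disjoint_family_on_def strip_iff_floor)

lemma UN_strip: "(\<Union>n. strip n) = half_plane"
  by (auto simp: strip_iff_floor)

lemma iso_pow_in_strip:
  assumes "z \<in> half_plane"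
  shows "iso_pow \<gamma> n z \<in> strip n \<longleftrightarrow> z \<in> strip 0"
proof -
  have "0 < Im (m z)" using m_in[OF assms] by (simp add: half_plane_def)
  then have "ln (Im (m (iso_pow \<gamma> n z))) = of_int n * l + ln (Im (m z))"
    using assms by (simp add: m_iso_pow ln_mult)
  then show ?thesis
    using assms by (auto simp: strip_def iso_pow_in algebra_simps)
qed

text \<open>In the coordinates s and u the set is the rectangle {0..<l} times A.\<close>

lemma emeasure_strip:
  assumes [measurable]: "A \<in> sets borel"
  shows "emeasure hyp_area (U -` A \<inter> strip 0) = ennreal l * emeasure lborel A"
proof -
  define W where "W = {z \<in> half_plane. 0 \<le> ln (Im z) \<and> ln (Im z) < l \<and> Re z / Im z \<in> A}"
  have W_borel: "W \<in> sets borel"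
  proof -
    have "W = half_plane \<inter> {z. 0 \<le> ln (Im z) \<and> ln (Im z) < l \<and> Re z / Im z \<in> A}"
      by (auto simp: W_def)
    also have "\<dots> \<in> sets borel" by measurable
    finally show ?thesis .
  qed
  have W_sub: "W \<subseteq> half_plane" by (auto simp: W_def)
  have "U -` A \<inter> strip 0 = m -` W \<inter> half_plane"
    using m_in by (auto simp: U_def strip_def W_def)
  then have "emeasure hyp_area (U -` A \<inter> strip 0) = emeasure hyp_area W"
    using hyp_preserving_moebius[OF det] W_borel W_sub by (simp add: hyp_preserving_def sets_hyp_area)
  also have "\<dots> = (\<integral>\<^sup>+s. \<integral>\<^sup>+u. indicator W (hyp_coords s u) \<partial>lborel \<partial>lborel)"
    using emeasure_hyp_area_borel[OF W_borel W_sub] by (simp add: hyp_nn_integral_def)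
  also have "\<dots> = (\<integral>\<^sup>+s. \<integral>\<^sup>+u. indicator {0..<l} s * indicator A u \<partial>lborel \<partial>lborel)"
  proof -
    have "hyp_coords s u \<in> W \<longleftrightarrow> s \<in> {0..<l} \<and> u \<in> A" for s u
      by (simp add: W_def) (simp add: hyp_coords_def)
    then have "indicator W (hyp_coords s u) = (indicator {0..<l} s * indicator A u :: ennreal)" for s u
      by (simp add: indicator_def)
    then show ?thesis by simp
  qed
  also have "\<dots> = ennreal l * emeasure lborel A"
    using l_pos by (simp add: nn_integral_cmult nn_integral_multc)
  finally show ?thesis .
qed

text \<open>F is cut along the strips and the piece in strip n is moved back to strip 0 by the power
  - n, which keeps area and U. The moved pieces are the parts of the translates of F over A in strip
  0; since the translates tile the half-plane up to null sets, the pieces add up to all of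
  \<open>W\<close>.\<close>

lemma emeasure_fundamental_domain:
  assumes F: "fundamental_domain (range (iso_pow \<gamma>)) F" and A [measurable]: "A \<in> sets borel"
  shows "emeasure hyp_area (U -` A \<inter> F) = ennreal l * emeasure lborel A"
proof -
  have F_sets: "F \<in> sets hyp_area" and F_sub: "F \<subseteq> half_plane"
    using F by (auto simp: fundamental_domain_def sets_hyp_area)
  define G where "G n = iso_pow \<gamma> n -` F \<inter> half_plane" for n
  have G_sets: "G n \<in> sets hyp_area" for n
    using hyp_preserving_iso_pow F_sets by (simp add: G_def hyp_preserving_def)
  have image: "iso_pow \<gamma> (- n) ` F = G n" for n
  proof (intro equalityI subsetI)
    fix z assume "z \<in> iso_pow \<gamma> (- n) ` F"
    then show "z \<in> G n"
      using F_sub by (auto simp: G_def iso_pow_in iso_pow_iso_pow iso_pow_0 subset_iff)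
  next
    fix z assume "z \<in> G n"
    then have "z = iso_pow \<gamma> (- n) (iso_pow \<gamma> n z)" "iso_pow \<gamma> n z \<in> F"
      by (auto simp: G_def iso_pow_iso_pow iso_pow_0)
    then show "z \<in> iso_pow \<gamma> (- n) ` F" by blast
  qed
  have "(\<Union>f\<in>range (iso_pow \<gamma>). f ` F) = (\<Union>n. G n)"
  proof -
    have "(\<Union>f\<in>range (iso_pow \<gamma>). f ` F) = (\<Union>n. iso_pow \<gamma> (- n) ` F)"
    proof (intro equalityI subsetI)
      fix z assume "z \<in> (\<Union>f\<in>range (iso_pow \<gamma>). f ` F)"
      then obtain k where "z \<in> iso_pow \<gamma> (- (- k)) ` F" by auto
      then show "z \<in> (\<Union>n. iso_pow \<gamma> (- n) ` F)" by blast
    qed blast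
    then show ?thesis by (simp add: image)
  qed
  then have cover: "half_plane - (\<Union>n. G n) \<in> null_sets hyp_area"
    using F by (simp add: fundamental_domain_def)
  have overlap: "G i \<inter> G j \<in> null_sets hyp_area" if "i \<noteq> j" for i j
  proof -
    have "iso_pow \<gamma> (- i) \<noteq> iso_pow \<gamma> (- j)" using that by (simp add: iso_pow_inj)
    then show ?thesis
      using F by (auto simp: fundamental_domain_def simp flip: image)
  qed
  \<comment> \<open>Points in no translate or in more than one. Outside this null set the tiling is
    exact and countable additivity applies.\<close>
  define N where "N = (half_plane - (\<Union>n. G n)) \<union> (\<Union>i. \<Union>j\<in>- {i}. G i \<inter> G j)"
  have N: "N \<in> null_sets hyp_area"
    unfolding N_def by (intro null_sets.Un cover null_sets_UN' overlap) auto
  define W where "W = U -` A \<inter> strip 0"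
  have U_A: "U -` A \<inter> half_plane \<in> sets borel"
    using measurable_sets_borel[OF borel_measurable_U A] by (auto simp: half_plane_measurable)
  have "W = (U -` A \<inter> half_plane) \<inter> strip 0" by (auto simp: W_def strip_def)
  then have W: "W \<in> sets hyp_area"
    using U_A by (auto simp: sets_hyp_area)
  have piece_sets: "U -` A \<inter> F \<inter> strip n \<in> sets hyp_area" for n
  proof -
    have "U -` A \<inter> F \<inter> strip n = ((U -` A \<inter> half_plane) \<inter> strip n) \<inter> F" using F_sub by auto
    moreover have "(U -` A \<inter> half_plane) \<inter> strip n \<in> sets hyp_area"
      using U_A by (auto simp: sets_hyp_area)
    ultimately show ?thesis using F_sets by (metis sets.Int)
  qed
  have piece: "emeasure hyp_area (U -` A \<inter> F \<inter> strip n) = emeasure hyp_area ((G n \<inter> W) - N)" for n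
  proof -
    have "emeasure hyp_area (U -` A \<inter> F \<inter> strip n) =
        emeasure hyp_area (iso_pow \<gamma> n -` (U -` A \<inter> F \<inter> strip n) \<inter> half_plane)"
      using hyp_preserving_iso_pow piece_sets by (simp add: hyp_preserving_def del: vimage_Int)
    also have "iso_pow \<gamma> n -` (U -` A \<inter> F \<inter> strip n) \<inter> half_plane = G n \<inter> W"
      by (auto simp: G_def W_def U_iso_pow iso_pow_in_strip)
    also have "emeasure hyp_area (G n \<inter> W) = emeasure hyp_area ((G n \<inter> W) - N)"
      using emeasure_Diff_null_set[OF N] G_sets W by (metis sets.Int)
    finally show ?thesis .
  qed
  have "emeasure hyp_area (U -` A \<inter> F) = emeasure hyp_area (\<Union>n. U -` A \<inter> F \<inter> strip n)"
    using F_sub UN_strip by (intro arg_cong[where f = "emeasure hyp_area"]) blast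
  also have "\<dots> = (\<integral>\<^sup>+n. emeasure hyp_area (U -` A \<inter> F \<inter> strip n) \<partial>count_space UNIV)"
    using disjoint_strip by (intro emeasure_UN_countable piece_sets)
      (auto simp: disjoint_family_on_def)
  also have "\<dots> = (\<integral>\<^sup>+n. emeasure hyp_area ((G n \<inter> W) - N) \<partial>count_space UNIV)"
    by (simp only: piece)
  also have "\<dots> = emeasure hyp_area (\<Union>n. (G n \<inter> W) - N)"
  proof (rule emeasure_UN_countable[symmetric])
    show "(G n \<inter> W) - N \<in> sets hyp_area" for n
      using G_sets W N by auto
    show "disjoint_family (\<lambda>n. (G n \<inter> W) - N)"
      by (auto simp: disjoint_family_on_def N_def)
  qed auto
  also have "(\<Union>n. (G n \<inter> W) - N) = W - N"
    by (auto simp: N_def W_def strip_def)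
  also have "emeasure hyp_area (W - N) = emeasure hyp_area W"
    by (rule emeasure_Diff_null_set[OF N W])
  also have "\<dots> = ennreal l * emeasure lborel A"
    unfolding W_def by (rule emeasure_strip[OF A])
  finally show ?thesis .
qed

lemma distr_U_fundamental_domain:
  assumes F: "fundamental_domain (range (iso_pow \<gamma>)) F"
  shows "distr (restrict_space hyp_area F) borel U = density lborel (\<lambda>_. ennreal l)"
    and "U \<in> borel_measurable (restrict_space hyp_area F)"
proof -
  have F_sets: "F \<in> sets hyp_area" and F_sub: "F \<subseteq> half_plane"
    using F by (auto simp: fundamental_domain_def sets_hyp_area)
  have space: "space (restrict_space hyp_area F) = F"
    using F_sets sets.sets_into_space by (auto simp: space_restrict_space)
  have pre: "U -` A \<inter> F \<in> sets hyp_area" if "A \<in> sets borel" for A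
  proof -
    have "U -` A \<inter> half_plane \<in> sets hyp_area"
      using measurable_sets_borel[OF borel_measurable_U that] by (auto simp: sets_hyp_area half_plane_measurable)
    moreover have "U -` A \<inter> F = (U -` A \<inter> half_plane) \<inter> F" using F_sub by auto
    ultimately show ?thesis using F_sets by (metis sets.Int)
  qed
  show U: "U \<in> borel_measurable (restrict_space hyp_area F)"
    by (rule measurableI) (use pre F_sets in \<open>auto simp: space sets_restrict_space_iff\<close>)
  show "distr (restrict_space hyp_area F) borel U = density lborel (\<lambda>_. ennreal l)"
  proof (rule measure_eqI)
    fix A assume "A \<in> sets (distr (restrict_space hyp_area F) borel U)"
    then have A: "A \<in> sets borel" by simp
    have "emeasure (distr (restrict_space hyp_area F) borel U) A = emeasure (restrict_space hyp_area F) (U -` A \<inter> F)"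
      using emeasure_distr[OF U A] by (simp add: space)
    also have "\<dots> = emeasure hyp_area (U -` A \<inter> F)"
      using F_sets by (intro emeasure_restrict_space) auto
    also have "\<dots> = ennreal l * emeasure lborel A"
      by (rule emeasure_fundamental_domain[OF F A])
    also have "\<dots> = emeasure (density lborel (\<lambda>_. ennreal l)) A"
      using A by (simp add: emeasure_density nn_integral_cmult)
    finally show "emeasure (distr (restrict_space hyp_area F) borel U) A =
      emeasure (density lborel (\<lambda>_. ennreal l)) A" .
  qed simp
qed

text \<open>The integrand depends on z only through \<open>U\<close>, so both claims follow from the
  image of the area of F under \<open>U\<close>.\<close>

lemma integral_fundamental_domain:
  fixes \<phi> :: "real \<Rightarrow> complex"
  assumes F: "fundamental_domain (range (iso_pow \<gamma>)) F" and \<phi>: "integrable lborel \<phi>"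
    and f: "\<And>z. z \<in> half_plane \<Longrightarrow> f z = \<phi> (U z)"
  shows "set_integrable hyp_area F f"
    and "(LINT z:F|hyp_area. f z) = of_real l * (LINT u|lborel. \<phi> u)"
proof -
  have F_sets: "F \<in> sets hyp_area" and F_sub: "F \<subseteq> half_plane"
    using F by (auto simp: fundamental_domain_def sets_hyp_area)
  have F_space: "F \<inter> space hyp_area \<in> sets hyp_area" using F_sets by simp
  note D = distr_U_fundamental_domain[OF F]
  have [measurable]: "\<phi> \<in> borel_measurable borel" using \<phi> by auto
  have i: "integrable (density lborel (\<lambda>_. ennreal l)) \<phi>"
    using \<phi> l_pos by (subst integrable_density) auto
  have v: "integral\<^sup>L (density lborel (\<lambda>_. ennreal l)) \<phi> = l *\<^sub>R (LINT u|lborel. \<phi> u)"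
    using l_pos by (subst integral_density) auto
  have eq: "indicator F z *\<^sub>R f z = indicator F z *\<^sub>R \<phi> (U z)" for z
    using f F_sub by (auto split: split_indicator)
  have "integrable (restrict_space hyp_area F) (\<lambda>z. \<phi> (U z))"
    using i unfolding D(1)[symmetric] by (subst (asm) integrable_distr_eq) (use D(2) in auto)
  then show "set_integrable hyp_area F f"
    unfolding set_integrable_def eq integrable_restrict_space[OF F_space] .
  have "(LINT z:F|hyp_area. f z) = (LINT z|restrict_space hyp_area F. \<phi> (U z))"
    unfolding set_lebesgue_integral_def eq integral_restrict_space[OF F_space] ..
  also have "\<dots> = integral\<^sup>L (density lborel (\<lambda>_. ennreal l)) \<phi>"
    unfolding D(1)[symmetric] by (rule integral_distr[symmetric]) (use D(2) in auto)
  finally show "(LINT z:F|hyp_area. f z) = of_real l * (LINT u|lborel. \<phi> u)"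
    by (simp add: v scaleR_conv_of_real)
qed

end

section \<open>The trace formula\<close>

lemma UNIV_int_eq: "(UNIV :: int set) = {0} \<union> (range (\<lambda>n. int (Suc n)) \<union> range (\<lambda>n. - int (Suc n)))"
proof (intro equalityI subsetI UNIV_I)
  fix k :: int
  consider "k = 0" | "k = int (Suc (nat (k - 1)))" | "k = - int (Suc (nat (- k - 1)))"
    by linarith
  then show "k \<in> {0} \<union> (range (\<lambda>n. int (Suc n)) \<union> range (\<lambda>n. - int (Suc n)))"
    by cases blast+
qed

lemma summable_on_intI:
  fixes f :: "int \<Rightarrow> 'a :: banach"
  assumes "summable (\<lambda>n. norm (f (int (Suc n))))" "summable (\<lambda>n. norm (f (- int (Suc n))))"
  shows "f summable_on UNIV"
proof -
  have "f summable_on range (\<lambda>n. int (Suc n))"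
    using norm_summable_imp_summable_on[OF assms(1)]
    by (subst summable_on_reindex) (auto simp: o_def inj_on_def)
  moreover have "f summable_on range (\<lambda>n. - int (Suc n))"
    using norm_summable_imp_summable_on[OF assms(2)]
    by (subst summable_on_reindex) (auto simp: o_def inj_on_def)
  ultimately show ?thesis
    unfolding UNIV_int_eq by (intro summable_on_Un_disjoint) auto
qed

lemma has_sum_int_even:
  fixes f :: "int \<Rightarrow> 'a :: {banach, real_normed_algebra_1}"
  assumes "summable (\<lambda>n. norm (f (int (Suc n))))" "\<And>n. f (- int (Suc n)) = f (int (Suc n))"
  shows "(f has_sum (f 0 + 2 * (\<Sum>n. f (int (Suc n))))) UNIV"
proof -
  let ?S = "\<Sum>n. f (int (Suc n))"
  have "((\<lambda>n. f (int (Suc n))) has_sum ?S) UNIV"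
    by (rule norm_summable_imp_has_sum[OF assms(1) summable_sums[OF summable_norm_cancel[OF assms(1)]]])
  then have "(f has_sum ?S) (range (\<lambda>n. int (Suc n)))" "(f has_sum ?S) (range (\<lambda>n. - int (Suc n)))"
    using assms(2) by (auto simp: has_sum_reindex o_def inj_on_def)
  then have two: "(f has_sum (?S + ?S)) (range (\<lambda>n. int (Suc n)) \<union> range (\<lambda>n. - int (Suc n)))"
    by (rule has_sum_Un_disjoint) auto
  have "(f has_sum f 0) {0}"
    by (rule has_sum_finiteI) auto
  from has_sum_Un_disjoint[OF this two] show ?thesis
    unfolding UNIV_int_eq mult_2 by force
qed

text \<open>From |t| \<ge> 2 on, exp |t| is at least 4, so the 1 is at most half of exp |t| / 2, a
  lower bound for cosh t.\<close>

lemma cosh_minus_one_ge_exp: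
  fixes t :: real
  assumes "2 \<le> \<bar>t\<bar>"
  shows "exp \<bar>t\<bar> / 4 \<le> cosh t - 1"
proof -
  have "4 \<le> exp (2::real)"
  proof -
    have "2 \<le> exp (1::real)" using exp_ge_add_one_self[of 1] by simp
    then have "2 * 2 \<le> exp (1::real) * exp 1" by (intro mult_mono) auto
    then show ?thesis by (simp flip: exp_add)
  qed
  also have "\<dots> \<le> exp \<bar>t\<bar>" using assms by simp
  finally have "4 \<le> exp \<bar>t\<bar>" .
  moreover have "exp \<bar>t\<bar> \<le> 2 * cosh t"
    by (cases "0 \<le> t") (simp_all add: cosh_def)
  ultimately show ?thesis by linarith
qed

section \<open>The series over the group\<close>

locale hyperbolic_trace = strip_function h \<sigma> \<delta> C + axis_coordinate \<gamma> l a b c d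
  for h :: "complex \<Rightarrow> complex" and \<sigma> \<delta> C :: real
    and \<gamma> :: "complex \<Rightarrow> complex" and l a b c d :: real
begin

lemma hyp_cosh_iso_pow:
  assumes "z \<in> half_plane" "w \<in> half_plane"
  shows "hyp_cosh (iso_pow \<gamma> n z) w = hyp_cosh (of_real (exp (of_int n * l)) * m z) (m w)"
  using hyp_cosh_moebius[OF iso_pow_in[OF assms(1), of n] assms(2) det] m_iso_pow[OF assms(1), of n] by simp

lemma point_pair_invariant_eq:
  assumes "z \<in> half_plane" "w \<in> half_plane" "1 < hyp_cosh z w"
  shows "point_pair_invariant h z w = abel_inverse g' (hyp_cosh z w)"
proof -
  have "z \<noteq> w" using assms(3) by (auto simp: hyp_cosh_def)
  then show ?thesis
    using assms by (simp add: point_pair_invariant_eq_abel_inverse hyp_cosh_def)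
qed

lemma norm_point_pair_invariant_le:
  assumes "z \<in> half_plane" "w \<in> half_plane" "0 < k" "k \<le> hyp_cosh z w - 1"
  shows "norm (point_pair_invariant h z w) \<le> M' / sqrt k"
proof -
  have v: "1 < hyp_cosh z w" using assms by simp
  have "norm (point_pair_invariant h z w) \<le> M' / sqrt (hyp_cosh z w - 1)"
    unfolding point_pair_invariant_eq[OF assms(1,2) v]
    by (rule norm_abel_inverse_le[OF v norm_g'_le_M' M'_nonneg borel_measurable_g']) simp
  also have "\<dots> \<le> M' / sqrt k"
    using assms M'_nonneg by (intro divide_left_mono) auto
  finally show ?thesis .
qed

text \<open>Dropping the horizontal displacement leaves two points on a vertical line, whose
  distance is the difference of the logarithms of their heights.\<close>

lemma hyp_cosh_iso_pow_ge:
  assumes z: "z \<in> half_plane" and w: "w \<in> half_plane"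
  shows "cosh (of_int n * l + ln (Im (m z) / Im (m w))) - 1 \<le> hyp_cosh (iso_pow \<gamma> n z) w - 1"
proof -
  define Y V where "Y = Im (m z)" and "V = Im (m w)"
  define e where "e = exp (of_int n * l)"
  have pos: "0 < Y" "0 < V" "0 < e"
    using m_in[OF z] m_in[OF w] by (auto simp: Y_def V_def e_def half_plane_def)
  define x where "x = e * Y / V"
  have "0 < x" using pos by (simp add: x_def)
  have "exp (of_int n * l + ln (Y / V)) = x"
    using pos by (simp add: exp_add x_def e_def)
  moreover have "cosh t - 1 = (exp t + inverse (exp t)) / 2 - 1" for t :: real
    by (simp add: cosh_def exp_minus)
  ultimately have "cosh (of_int n * l + ln (Y / V)) - 1 = (x + inverse x) / 2 - 1"
    by metis
  also have "\<dots> = (x - 1)\<^sup>2 / (2 * x)"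
    using \<open>0 < x\<close> by (simp add: field_simps power2_eq_square)
  also have "\<dots> = (e * Y - V)\<^sup>2 / (2 * (e * Y) * V)"
    using pos by (simp add: x_def field_simps power2_eq_square)
  also have "\<dots> \<le> (cmod (of_real e * m z - m w))\<^sup>2 / (2 * (e * Y) * V)"
  proof -
    have "\<bar>Im (of_real e * m z - m w)\<bar> \<le> cmod (of_real e * m z - m w)"
      by (rule abs_Im_le_cmod)
    then have "\<bar>e * Y - V\<bar> \<le> cmod (of_real e * m z - m w)"
      by (simp add: Y_def V_def)
    then have "(e * Y - V)\<^sup>2 \<le> (cmod (of_real e * m z - m w))\<^sup>2"
      by (metis abs_ge_zero power2_abs power_mono)
    then show ?thesis using pos by (intro divide_right_mono) auto
  qed
  also have "\<dots> = hyp_cosh (iso_pow \<gamma> n z) w - 1"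
    unfolding hyp_cosh_iso_pow[OF z w] by (simp add: hyp_cosh_def Y_def V_def e_def)
  finally show ?thesis by (simp add: Y_def V_def)
qed

text \<open>The hypothesis on n makes the logarithmic height difference at least 2, where cosh - 1
  is of exponential size; the Abel bound takes its inverse square root, whence the rate l /
  2.\<close>

lemma norm_point_pair_invariant_iso_pow_le:
  assumes z: "z \<in> half_plane" and w: "w \<in> half_plane"
    and n: "\<bar>ln (Im (m z) / Im (m w))\<bar> + 2 \<le> \<bar>of_int n\<bar> * l"
  shows "norm (point_pair_invariant h (iso_pow \<gamma> n z) w) \<le>
    2 * M' * exp (\<bar>ln (Im (m z) / Im (m w))\<bar> / 2) * exp (- (l / 2) * \<bar>of_int n\<bar>)"
proof -
  define r where "r = ln (Im (m z) / Im (m w))"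
  define t where "t = of_int n * l + r"
  have t: "\<bar>of_int n\<bar> * l - \<bar>r\<bar> \<le> \<bar>t\<bar>"
  proof -
    have "\<bar>of_int n * l\<bar> - \<bar>r\<bar> \<le> \<bar>t\<bar>" by (simp add: t_def)
    then show ?thesis using l_pos by (simp add: abs_mult)
  qed
  have "exp (\<bar>of_int n\<bar> * l - \<bar>r\<bar>) / 4 \<le> exp \<bar>t\<bar> / 4" using t by simp
  also have "\<dots> \<le> cosh t - 1" by (rule cosh_minus_one_ge_exp) (use t n in \<open>simp add: r_def\<close>)
  also have "\<dots> \<le> hyp_cosh (iso_pow \<gamma> n z) w - 1"
    using hyp_cosh_iso_pow_ge[OF z w, of n] by (simp add: t_def r_def)
  finally have "norm (point_pair_invariant h (iso_pow \<gamma> n z) w) \<le> M' / sqrt (exp (\<bar>of_int n\<bar> * l - \<bar>r\<bar>) / 4)"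
    by (intro norm_point_pair_invariant_le iso_pow_in z w) auto
  also have "sqrt (exp (\<bar>of_int n\<bar> * l - \<bar>r\<bar>) / 4) = exp ((\<bar>of_int n\<bar> * l - \<bar>r\<bar>) / 2) / 2"
    by (rule real_sqrt_unique) (auto simp: power_divide exp_double[symmetric])
  also have "M' / (exp ((\<bar>of_int n\<bar> * l - \<bar>r\<bar>) / 2) / 2) = 2 * M' * exp (\<bar>r\<bar> / 2) * exp (- (l / 2) * \<bar>of_int n\<bar>)"
  proof -
    have key: "x / (A / R / 2) = 2 * x * R * (1 / A)" for x A R :: real
      by simp
    have "(\<bar>of_int n\<bar> * l - \<bar>r\<bar>) / 2 = (l / 2) * \<bar>of_int n\<bar> - \<bar>r\<bar> / 2"
      by (simp add: field_simps)
    then have e1: "exp ((\<bar>of_int n\<bar> * l - \<bar>r\<bar>) / 2) = exp ((l / 2) * \<bar>of_int n\<bar>) / exp (\<bar>r\<bar> / 2)"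
      by (simp only: exp_diff)
    have e2: "exp (- (l / 2) * \<bar>of_int n\<bar>) = 1 / exp ((l / 2) * \<bar>of_int n\<bar>)"
      by (simp only: mult_minus_left exp_minus inverse_eq_divide)
    show ?thesis unfolding e1 e2 by (rule key)
  qed
  finally show ?thesis by (simp add: r_def)
qed

lemma summable_exp: "summable (\<lambda>n. K * exp (- (l / 2) * real (Suc n)))"
proof -
  have "summable (\<lambda>n. (K * exp (- (l / 2))) * exp (- (l / 2)) ^ n)"
    using l_pos by (intro summable_mult summable_geometric) simp
  moreover have "exp (- (l / 2)) ^ n = exp (- (l / 2) * real n)" for n
    by (simp add: exp_of_nat_mult[symmetric] mult.commute)
  ultimately show ?thesis
    by (simp add: mult.assoc distrib_left flip: exp_add)
qed

text \<open>The exponential bound is needed only for all but finitely many n, so terms in which the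
  translate of z comes close to w, or equals it, require no estimate.\<close>

lemma point_pair_invariant_summable_on:
  assumes z: "z \<in> half_plane" and w: "w \<in> half_plane"
  shows "(\<lambda>n. point_pair_invariant h (iso_pow \<gamma> n z) w) summable_on UNIV"
proof -
  let ?r = "\<bar>ln (Im (m z) / Im (m w))\<bar>"
  let ?K = "2 * M' * exp (?r / 2)"
  have ev: "\<forall>\<^sub>F n in sequentially. ?r + 2 \<le> real (Suc n) * l"
    using l_pos by real_asymp
  have "summable (\<lambda>n. norm (point_pair_invariant h (iso_pow \<gamma> (s * int (Suc n)) z) w))"
    if "\<bar>s\<bar> = 1" for s
  proof (rule summable_comparison_test_ev[OF _ summable_exp])
    show "\<forall>\<^sub>F n in sequentially. norm (norm (point_pair_invariant h (iso_pow \<gamma> (s * int (Suc n)) z) w)) \<le>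
        ?K * exp (- (l / 2) * real (Suc n))"
      using ev
    proof eventually_elim
      case (elim n)
      have "\<bar>of_int (s * int (Suc n))\<bar> = real (Suc n)"
        using that by (simp add: abs_mult flip: of_int_abs)
      then show ?case
        using norm_point_pair_invariant_iso_pow_le[OF z w, of "s * int (Suc n)"] elim by simp
    qed
  qed
  from this[of 1] this[of "- 1"] show ?thesis
    by (intro summable_on_intI) simp_all
qed

text \<open>The common value, as a function of u, of the diagonal terms for the exponents n + 1 and
  - (n + 1): the index starts at 0.\<close>

definition \<kappa> :: "nat \<Rightarrow> real \<Rightarrow> complex" where
  "\<kappa> n u = abel_inverse g' (cosh (real (Suc n) * l) + 2 * (sinh (real (Suc n) * l / 2))\<^sup>2 * u\<^sup>2)"

lemma point_pair_invariant_iso_pow_diag: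
  assumes z: "z \<in> half_plane" and s: "\<bar>s\<bar> = 1"
  shows "point_pair_invariant h (iso_pow \<gamma> (s * int (Suc n)) z) z = \<kappa> n (U z)"
proof -
  have s': "s = 1 \<or> s = - 1" using s by linarith
  have "hyp_cosh (iso_pow \<gamma> (s * int (Suc n)) z) z =
      cosh (real (Suc n) * l) + 2 * (sinh (real (Suc n) * l / 2))\<^sup>2 * (U z)\<^sup>2"
    unfolding hyp_cosh_iso_pow[OF z z] hyp_cosh_dilation[OF m_in[OF z]]
    using s' by (auto simp: U_def simp del: of_nat_Suc)
  moreover have "1 < cosh (real (Suc n) * l)"
    using cosh_real_strict_mono[of 0 "real (Suc n) * l"] l_pos by simp
  then have "1 < cosh (real (Suc n) * l) + 2 * (sinh (real (Suc n) * l / 2))\<^sup>2 * (U z)\<^sup>2"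
    by (rule less_le_trans) simp
  ultimately show ?thesis
    using point_pair_invariant_eq[OF iso_pow_in[OF z] z] by (simp add: \<kappa>_def)
qed

text \<open>With x = (n + 1) l / 2 one has 2 x \<ge> l, hence exp (- x) \<le> exp x exp (- l). Thus
  sinh x is at least a fixed fraction of exp x, and 1 / sinh x is dominated by a geometric
  sequence.\<close>

lemma inverse_sinh_le: "1 / sinh (real (Suc n) * l / 2) \<le> 2 / (1 - exp (- l)) * exp (- (l / 2) * real (Suc n))"
proof -
  define x where "x = real (Suc n) * l / 2"
  have x: "l / 2 \<le> x" using l_pos by (simp add: x_def)
  have "exp (- x) \<le> exp (x - l)" using x by simp
  also have "\<dots> = exp x * exp (- l)" by (simp only: diff_conv_add_uminus exp_add)
  finally have "exp x * (1 - exp (- l)) / 2 \<le> (exp x - exp (- x)) / 2"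
    unfolding right_diff_distrib mult_1_right by (rule divide_right_mono[OF diff_left_mono]) simp
  also have "\<dots> = sinh x" by (simp add: sinh_def)
  finally have le: "exp x * (1 - exp (- l)) / 2 \<le> sinh x" .
  have pos: "0 < exp x * (1 - exp (- l)) / 2" using l_pos by simp
  have "1 / sinh x \<le> 1 / (exp x * (1 - exp (- l)) / 2)"
    by (rule frac_le[OF zero_le_one order_refl pos le])
  also have "\<dots> = 2 / (1 - exp (- l)) * exp (- x)"
    using l_pos by (simp add: exp_minus field_simps)
  finally show ?thesis by (simp add: x_def mult_ac)
qed

lemma summable_inverse_sinh: "summable (\<lambda>n. K * (1 / sinh (real (Suc n) * l / 2)))"
proof (rule summable_mult, rule summable_comparison_test'[OF summable_exp])
  fix n :: nat
  show "norm (1 / sinh (real (Suc n) * l / 2)) \<le> 2 / (1 - exp (- l)) * exp (- (l / 2) * real (Suc n))"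
    using inverse_sinh_le[of n] l_pos by (simp del: of_nat_Suc)
qed

lemma \<kappa>_integral:
  "integrable lborel (\<kappa> n)"
  "(LINT u|lborel. \<kappa> n u) = g_transform h (real (Suc n) * l) / of_real (2 * sinh (real (Suc n) * l / 2))"
  "(LINT u|lborel. norm (\<kappa> n u)) \<le> (LINT t:{0..}|lborel. norm (g' t)) / (2 * sinh (real (Suc n) * l / 2))"
  using integral_abel_inverse_g'[of "real (Suc n) * l"] l_pos
  unfolding \<kappa>_def[abs_def] by (simp_all del: of_nat_Suc)

text \<open>The bound is uniform in u, because the first argument of the Abel kernel exceeds 1
  already at u = 0, by 2 sinh^2 of half the translation length.\<close>

lemma norm_\<kappa>_le: "norm (\<kappa> n u) \<le> M' * (1 / sinh (real (Suc n) * l / 2))"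
proof -
  let ?t = "real (Suc n) * l" and ?s = "sinh (real (Suc n) * l / 2)"
  have "0 < ?s" using l_pos by simp
  have c: "cosh ?t - 1 = 2 * ?s\<^sup>2"
    using cosh_double_cosh[of "?t / 2"] cosh_square_eq[of "?t / 2"] by (simp del: of_nat_Suc)
  let ?v = "cosh ?t + 2 * ?s\<^sup>2 * u\<^sup>2"
  have v: "?s\<^sup>2 \<le> ?v - 1"
  proof -
    have "0 \<le> ?s\<^sup>2 + 2 * ?s\<^sup>2 * u\<^sup>2" by simp
    then show ?thesis using c by linarith
  qed
  have "1 < ?v" using v \<open>0 < ?s\<close> zero_less_power[of ?s 2] by linarith
  then have "norm (\<kappa> n u) \<le> M' / sqrt (?v - 1)"
    unfolding \<kappa>_def
    by (rule norm_abel_inverse_le[OF _ norm_g'_le_M' M'_nonneg borel_measurable_g']) simp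
  also have "\<dots> \<le> M' / sqrt (?s\<^sup>2)"
    using v \<open>0 < ?s\<close> M'_nonneg \<open>1 < ?v\<close> by (intro divide_left_mono real_sqrt_le_mono mult_pos_pos) auto
  also have "\<dots> = M' * (1 / ?s)" using \<open>0 < ?s\<close> by simp
  finally show ?thesis .
qed

lemma summable_norm_\<kappa>: "summable (\<lambda>n. norm (\<kappa> n u))"
  by (rule summable_comparison_test'[OF summable_inverse_sinh[of M']])
    (use norm_\<kappa>_le in simp)

lemma periodized_eq:
  assumes z: "z \<in> half_plane"
  shows "periodized_invariant h \<gamma> z z - point_pair_invariant h z z = 2 * (\<Sum>n. \<kappa> n (U z))"
proof -
  let ?f = "\<lambda>n. point_pair_invariant h (iso_pow \<gamma> n z) z"
  have p: "?f (int (Suc n)) = \<kappa> n (U z)" and q: "?f (- int (Suc n)) = \<kappa> n (U z)" for n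
    using point_pair_invariant_iso_pow_diag[OF z, of 1 n] point_pair_invariant_iso_pow_diag[OF z, of "- 1" n] by simp_all
  have "(?f has_sum (?f 0 + 2 * (\<Sum>n. ?f (int (Suc n))))) UNIV"
    by (rule has_sum_int_even) (simp_all only: p q summable_norm_\<kappa>)
  then have "periodized_invariant h \<gamma> z z = ?f 0 + 2 * (\<Sum>n. ?f (int (Suc n)))"
    unfolding periodized_invariant_def by (rule infsumI)
  then show ?thesis
    by (simp only: p iso_pow_0[OF z]) simp
qed

text \<open>Termwise integration: both the pointwise norms and the L1 norms are at most a constant
  times 1 / sinh ((n + 1) l / 2), which is summable.\<close>

lemma \<kappa>_suminf_integral:
  "integrable lborel (\<lambda>u. \<Sum>n. \<kappa> n u)"
  "(\<lambda>n. LINT u|lborel. \<kappa> n u) sums (LINT u|lborel. (\<Sum>n. \<kappa> n u))"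
proof -
  have 1: "AE u in lborel. summable (\<lambda>n. norm (\<kappa> n u))"
    by (intro AE_I2 summable_norm_\<kappa>)
  have 2: "summable (\<lambda>n. LINT u|lborel. norm (\<kappa> n u))"
  proof (rule summable_comparison_test'[OF summable_inverse_sinh])
    fix n
    have "(LINT u|lborel. norm (\<kappa> n u)) \<ge> 0" by simp
    then show "norm (LINT u|lborel. norm (\<kappa> n u)) \<le>
        ((LINT t:{0..}|lborel. norm (g' t)) / 2) * (1 / sinh (real (Suc n) * l / 2))"
      using \<kappa>_integral(3)[of n] by simp
  qed
  show "integrable lborel (\<lambda>u. \<Sum>n. \<kappa> n u)"
    by (rule integrable_suminf[OF \<kappa>_integral(1) 1 2])
  show "(\<lambda>n. LINT u|lborel. \<kappa> n u) sums (LINT u|lborel. (\<Sum>n. \<kappa> n u))"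
    by (rule sums_integral[OF \<kappa>_integral(1) 1 2])
qed

text \<open>The factor 2 from the two signs of the exponent cancels the 2 in the integral of
  \<open>\<kappa> n\<close>, leaving l g / sinh.\<close>

lemma trace_formula:
  assumes F: "fundamental_domain (range (iso_pow \<gamma>)) F"
  shows "set_integrable hyp_area F (\<lambda>z. periodized_invariant h \<gamma> z z - point_pair_invariant h z z)"
    and "(\<lambda>n. of_real l * g_transform h (real (Suc n) * l) / of_real (sinh (real (Suc n) * l / 2)))
      sums (LINT z:F|hyp_area. periodized_invariant h \<gamma> z z - point_pair_invariant h z z)"
proof -
  have i: "integrable lborel (\<lambda>u. 2 * (\<Sum>n. \<kappa> n u))"
    by (intro integrable_mult_right \<kappa>_suminf_integral)
  note I = integral_fundamental_domain[OF F i periodized_eq]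
  show "set_integrable hyp_area F (\<lambda>z. periodized_invariant h \<gamma> z z - point_pair_invariant h z z)"
    by (rule I(1))
  have "(LINT z:F|hyp_area. periodized_invariant h \<gamma> z z - point_pair_invariant h z z) =
      of_real l * (LINT u|lborel. 2 * (\<Sum>n. \<kappa> n u))"
    by (rule I(2))
  moreover have "(\<lambda>n. of_real l * (2 * (LINT u|lborel. \<kappa> n u))) sums
      (of_real l * (2 * (LINT u|lborel. (\<Sum>n. \<kappa> n u))))"
    by (intro sums_mult \<kappa>_suminf_integral)
  ultimately show "(\<lambda>n. of_real l * g_transform h (real (Suc n) * l) / of_real (sinh (real (Suc n) * l / 2)))
      sums (LINT z:F|hyp_area. periodized_invariant h \<gamma> z z - point_pair_invariant h z z)"
    by (simp add: \<kappa>_integral(2) del: of_nat_Suc)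
qed

end

text \<open>Summability of the periodization and integrability over F are asserted along with the
  value, so that neither the infinite sum nor the integral is a default value. The series is indexed
  from 0, hence the \<open>Suc n\<close>.\<close>

theorem proposition6:
  fixes \<gamma> :: "complex \<Rightarrow> complex" and l \<sigma> \<delta> C :: real and h :: "complex \<Rightarrow> complex"
  assumes "hyperbolic_isometry \<gamma>"
    and "l = isometry_length \<gamma>"
    and "\<sigma> > 1 / 2"
    and "h analytic_on {\<rho>. \<bar>Im \<rho>\<bar> \<le> \<sigma>}"
    and "\<And>\<rho>. \<bar>Im \<rho>\<bar> \<le> \<sigma> \<Longrightarrow> h (- \<rho>) = h \<rho>"
    and "\<delta> > 0" and "C > 0"
    and "\<And>\<rho>. \<bar>Im \<rho>\<bar> \<le> \<sigma> \<Longrightarrow> cmod (h \<rho>) \<le> C * (1 + \<bar>Re \<rho>\<bar>) powr (- 2 - \<delta>)"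
  shows "(\<forall>z\<in>half_plane. \<forall>w\<in>half_plane.
            (\<lambda>n::int. point_pair_invariant h (iso_pow \<gamma> n z) w) summable_on UNIV) \<and>
         (\<forall>F. fundamental_domain (range (iso_pow \<gamma>)) F \<longrightarrow>
            set_integrable hyp_area F
              (\<lambda>z. periodized_invariant h \<gamma> z z - point_pair_invariant h z z) \<and>
            (\<lambda>n. of_real l * g_transform h (real (Suc n) * l)
                   / of_real (sinh (real (Suc n) * l / 2)))
              sums (LINT z:F|hyp_area.
                      periodized_invariant h \<gamma> z z - point_pair_invariant h z z))"
proof -
  obtain a d b c where det: "0 < a * d - b * c"
      and conj: "\<And>z. z \<in> half_plane \<Longrightarrow>
        moebius a b c d (\<gamma> z) = of_real (exp (isometry_length \<gamma>)) * moebius a b c d z"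
    by (rule hyperbolic_isometry_normal_form[OF assms(1)]) (rule that, assumption, simp)
  interpret hyperbolic_trace h \<sigma> \<delta> C \<gamma> l a b c d
  proof
    show "h holomorphic_on {z. \<bar>Im z\<bar> < \<sigma>}"
      using assms(4) by (rule analytic_imp_holomorphic[OF analytic_on_subset]) auto
    show "cmod (h z) \<le> C * (1 + \<bar>Re z\<bar>) powr (- 2 - \<delta>)" if "\<bar>Im z\<bar> < \<sigma>" for z
      using that by (intro assms(8)) simp
    show "\<gamma> \<in> Bij half_plane" "0 < l"
      using assms(1,2) by (auto simp: hyperbolic_isometry_def hyp_isometries_def)
    show "moebius a b c d (\<gamma> z) = of_real (exp l) * moebius a b c d z" if "z \<in> half_plane" for z
      using conj[OF that] by (simp add: assms(2))
  qed (use assms det in auto)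
  show ?thesis
    using point_pair_invariant_summable_on trace_formula by blast
qed

end
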